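(* LU-equivalence and LC-equivalence coincide for graph states on up to 19 qubits: for any two graphs $G_1,G_2$ on the same vertex set $V$ with $|V|\leq 19$, $G_1$ and $G_2$ are LU-equivalent if and only if they are LC-equivalent.
   Context: All graphs are finite, simple and undirected, on a totally ordered vertex set $V$ with $n=|V|$. The graph state of $G$ is the $n$-qubit state $|G\rangle=\frac{1}{\sqrt{2^n}}\sum_{x\in\{0,1\}^n}(-1)^{|G[x]|}|x\rangle$, where qubits are indexed by $V$, $x$ is identified with the subset of vertices of which it is the indicator, and $|G[x]|$ is the number of edges of the subgraph of $G$ induced by $x$. Two graphs $G_1,G_2$ on the same vertex set are LU-equivalent if there is a local unitary $U=\bigotimes_{u\in V}U_u$, each $U_u$ a single-qubit unitary, with $|G_2\rangle=U|G_1\rangle$. They are LC-equivalent if the graph states are related by such a local unitary in which each $U_u$ is a single-qubit Clifford operator (generated by $H$ and $Z(\pi/2)=\mathrm{diag}(1,i)$, up to global phase); equivalently (known theorem), if $G_2$ is obtained from $G_1$ by a sequence of local complementations, where the local complementation of $G$ at $u$ complements the subgraph induced by the neighbourhood of $u$. *)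

theory Defs
  imports "HOL-Analysis.Analysis"
begin

definition simple_graph :: "'v set \<Rightarrow> 'v set set \<Rightarrow> bool" where
  "simple_graph V E \<longleftrightarrow> finite V \<and> (\<forall>e\<in>E. e \<subseteq> V \<and> card e = 2)"

definition induced_edges :: "'v set set \<Rightarrow> 'v set \<Rightarrow> 'v set set" where
  "induced_edges E x = {e \<in> E. e \<subseteq> x}"

text \<open>
  A state of the qubits indexed by \<open>V\<close> is given by its amplitudes in the computational basis.
  A basis vector is identified with the set \<open>x \<subseteq> V\<close> of the qubits that carry the value 1, so a
  state is a function on sets; by convention it vanishes on the sets that are not subsets of \<open>V\<close>.
\<close>

definition graph_state :: "'v set \<Rightarrow> 'v set set \<Rightarrow> 'v set \<Rightarrow> complex" where
  "graph_state V E x =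
    (if x \<subseteq> V
     then 1 / complex_of_real (sqrt (2 ^ card V)) * (- 1) ^ card (induced_edges E x)
     else 0)"

text \<open>
  Single-qubit operators are 2 by 2 complex matrices; \<open>False\<close> and \<open>True\<close> index the basis
  vectors 0 and 1, and \<open>A $ i $ j\<close> is the entry in row \<open>i\<close> and column \<open>j\<close>.
\<close>

type_synonym qubit_op = "complex ^ bool ^ bool"

definition dagger :: "qubit_op \<Rightarrow> qubit_op" where
  "dagger A = map_matrix cnj (transpose A)"

definition unitary :: "qubit_op \<Rightarrow> bool" where
  "unitary A \<longleftrightarrow> dagger A ** A = mat 1 \<and> A ** dagger A = mat 1"

definition hadamard :: qubit_op where
  "hadamard = (\<chi> i j. (if i \<and> j then - 1 else 1) / complex_of_real (sqrt 2))"

definition phase_gate :: qubit_op where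
  "phase_gate = (\<chi> i j. if i = j then (if i then \<i> else 1) else 0)"

text \<open>
  The single-qubit Clifford group: the group generated by the Hadamard gate, the phase gate
  \<open>diag(1,\<i>)\<close> and the global phases \<open>mat c\<close>, that is, \<open>c\<close> times the identity. A rule for
  inverses is redundant, see \<open>clifford_dagger\<close> below.
\<close>

inductive clifford :: "qubit_op \<Rightarrow> bool" where
  hadamard: "clifford hadamard"
| phase_gate: "clifford phase_gate"
| global_phase: "norm c = 1 \<Longrightarrow> clifford (mat c)"
| mult: "clifford A \<Longrightarrow> clifford B \<Longrightarrow> clifford (A ** B)"

text \<open>
  The action of the tensor product of the operators \<open>U u\<close>, \<open>u \<in> V\<close>, on a state: the matrix entry
  of the tensor product in row \<open>y\<close> and column \<open>x\<close> is the product of the entries of the factors.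
\<close>

definition tensor_entry :: "'v set \<Rightarrow> ('v \<Rightarrow> qubit_op) \<Rightarrow> 'v set \<Rightarrow> 'v set \<Rightarrow> complex" where
  "tensor_entry V U y x = (\<Prod>u\<in>V. U u $ (u \<in> y) $ (u \<in> x))"

definition apply_local ::
  "'v set \<Rightarrow> ('v \<Rightarrow> qubit_op) \<Rightarrow> ('v set \<Rightarrow> complex) \<Rightarrow> 'v set \<Rightarrow> complex" where
  "apply_local V U \<psi> y =
    (if y \<subseteq> V then (\<Sum>x\<in>Pow V. tensor_entry V U y x * \<psi> x) else 0)"

definition LU_equivalent :: "'v set \<Rightarrow> 'v set set \<Rightarrow> 'v set set \<Rightarrow> bool" where
  "LU_equivalent V E1 E2 \<longleftrightarrow>
    (\<exists>U. (\<forall>u\<in>V. unitary (U u)) \<and> graph_state V E2 = apply_local V U (graph_state V E1))"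

definition LC_equivalent :: "'v set \<Rightarrow> 'v set set \<Rightarrow> 'v set set \<Rightarrow> bool" where
  "LC_equivalent V E1 E2 \<longleftrightarrow>
    (\<exists>U. (\<forall>u\<in>V. clifford (U u)) \<and> graph_state V E2 = apply_local V U (graph_state V E1))"

lemma dagger_mult: "dagger (A ** B) = dagger B ** dagger A"
  by (simp add: dagger_def matrix_matrix_mult_def transpose_def vec_eq_iff mult.commute)

lemma dagger_mat: "dagger (mat c) = mat (cnj c)"
  by (auto simp: dagger_def mat_def transpose_def vec_eq_iff)

lemma dagger_hadamard: "dagger hadamard = hadamard"
  by (auto simp: dagger_def hadamard_def transpose_def vec_eq_iff)

lemma dagger_phase_gate: "dagger phase_gate = phase_gate ** (phase_gate ** phase_gate)"
  by (auto simp: dagger_def phase_gate_def transpose_def vec_eq_iff matrix_matrix_mult_def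
      UNIV_bool)

lemma clifford_dagger: "clifford A \<Longrightarrow> clifford (dagger A)"
  by (induction rule: clifford.induct)
    (auto simp: dagger_mult dagger_mat dagger_hadamard dagger_phase_gate intro: clifford.intros)

lemma unitary_hadamard: "unitary hadamard"
proof -
  have "complex_of_real (sqrt 2) * complex_of_real (sqrt 2) = 2"
    by (simp flip: of_real_mult)
  then have "hadamard ** hadamard = mat 1"
    by (auto simp: hadamard_def vec_eq_iff matrix_matrix_mult_def UNIV_bool mat_def)
  then show ?thesis
    by (simp add: unitary_def dagger_hadamard)
qed

lemma unitary_phase_gate: "unitary phase_gate"
  by (auto simp: unitary_def dagger_def transpose_def phase_gate_def vec_eq_iff
      matrix_matrix_mult_def UNIV_bool mat_def)

lemma unitary_mat:
  assumes "norm c = 1"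
  shows "unitary (mat c)"
proof -
  have "c * cnj c = 1" "cnj c * c = 1"
    using assms complex_norm_square[of c] by (simp_all add: mult.commute)
  then have "mat (cnj c) ** mat c = (mat 1 :: qubit_op)" "mat c ** mat (cnj c) = (mat 1 :: qubit_op)"
    by (auto simp: vec_eq_iff matrix_matrix_mult_def UNIV_bool mat_def)
  then show ?thesis
    by (simp add: unitary_def dagger_mat)
qed

lemma unitary_mult:
  assumes "unitary A" "unitary B"
  shows "unitary (A ** B)"
proof -
  have "dagger B ** dagger A ** (A ** B) = dagger B ** (dagger A ** A) ** B"
    and "A ** B ** (dagger B ** dagger A) = A ** (B ** dagger B) ** dagger A"
    by (simp_all only: matrix_mul_assoc)
  then show ?thesis
    using assms by (simp add: unitary_def dagger_mult)
qed

lemma clifford_unitary: "clifford A \<Longrightarrow> unitary A"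
  by (induction rule: clifford.induct)
    (auto intro: unitary_hadamard unitary_phase_gate unitary_mat unitary_mult)

end

theory Submission
  imports Defs
begin

text \<open>
  A local unitary \<open>U\<close> acts on the tensor of Pauli expectations of a state through a rotation of
  the three Pauli axes at each qubit. Since the expectations of a graph state are \<open>0\<close> or \<open>\<plusminus>1\<close> and
  their support is a group, comparing Gram matrices of slices of the two tensors shows that every
  \<open>U u\<close> takes some Pauli axis to a Pauli axis, unless \<open>u\<close> belongs to an isolated edge of both
  graphs, where \<open>U\<close> can be modified. Up to Clifford operators on both sides, all \<open>U u\<close> are therefore
  diagonal, \<open>diag(1, e\<^sub>u)\<close> up to a phase.

  A diagonal operator between stabilizer states is constrained on a subgroup \<open>L\<close> of the power set of
  \<open>V\<close>: the function \<open>y \<mapsto> (\<Prod>u\<in>y. e\<^sub>u)\<close> is quadratic on \<open>L\<close>. Group the qubits by their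
  column \<open>{y \<in> L. u \<in> y}\<close> and multiply the phases in each group. The constraints say that the eighth
  powers of these products are orthogonal to all monomials of degree at most 4, so that they are 1
  because their support has fewer than 32 elements; and that the set of columns whose fourth power
  is \<open>- 1\<close> is a codeword of the dual of the third-order Reed--Muller code. Having fewer than 24
  elements, it is empty or a 4-dimensional flat. Every half of a flat has 0, 8 or 16 elements, hence
  dividing the phases on the flat by a primitive eighth root of unity does not change the products
  over the elements of \<open>L\<close> and leaves fourth roots of unity, that is, Clifford operators.
\<close>

subsection \<open>Balanced set families\<close>

text \<open>The obstacle to recovering Pauli axes is the isolated edge: on its two-qubit state, any
  unitary at one end equals some unitary at the other, so the state determines no axis there.
  Elsewhere the supports of the stabilizers leave less freedom. The exponents 4 and 8 come from
  inclusion-exclusion: passing from a symmetric difference to an intersection costs a square, so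
  each further set in an intersection doubles the exponent. Quadratic phases have squares that are
  signs on twofold intersections, hence trivial fourth powers on threefold ones and trivial eighth
  powers on fourfold ones. The size enters as a number of columns. A nonempty support orthogonal to
  degree 4 has at least 32 elements; orthogonality to degree 3 over the two-element field allows 16
  and nothing else below 24. The constraints say nothing about degree 0, so the empty column is used
  as a dummy that repairs that case. At most 22 nonempty columns and this dummy stay below
  24.\<close>

definition sdiff :: "'a set \<Rightarrow> 'a set \<Rightarrow> 'a set" (infixl "\<ominus>" 65) where
  "x \<ominus> y = (x - y) \<union> (y - x)"

lemma mem_sdiff [simp]: "v \<in> x \<ominus> y \<longleftrightarrow> (v \<in> x) \<noteq> (v \<in> y)"
  by (auto simp: sdiff_def)

lemma sdiff_commute: "x \<ominus> y = y \<ominus> x"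
  and sdiff_assoc: "x \<ominus> y \<ominus> z = x \<ominus> (y \<ominus> z)"
  and sdiff_self [simp]: "x \<ominus> x = {}"
  and sdiff_empty [simp]: "x \<ominus> {} = x" "{} \<ominus> x = x"
  and sdiff_cancel [simp]: "x \<ominus> (x \<ominus> y) = y" "y \<ominus> x \<ominus> x = y"
  by (auto simp: set_eq_iff)

lemma sdiff_subset: "x \<subseteq> V \<Longrightarrow> y \<subseteq> V \<Longrightarrow> x \<ominus> y \<subseteq> V"
  by (auto simp: sdiff_def)

lemma sdiff_Int: "(x \<ominus> y) \<inter> z = (x \<inter> z) \<ominus> (y \<inter> z)"
  by (auto simp: set_eq_iff)

lemma sdiff_left_cancel: "x \<ominus> y = x \<ominus> z \<longleftrightarrow> y = z"
  by (metis sdiff_cancel(1))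

lemma sdiff_right_cancel: "y \<ominus> x = z \<ominus> x \<longleftrightarrow> y = z"
  by (metis sdiff_cancel(2))

text \<open>The two products on the right count \<open>x \<inter> y\<close> twice, whereas
  \<open>x \<ominus> y\<close> omits it; hence the square. Repeated use trades conditions on
  symmetric differences for powers of products over intersections.\<close>

lemma prod_sdiff:
  fixes f :: "'a \<Rightarrow> complex"
  assumes "finite x" "finite y"
  shows "prod f (x \<ominus> y) * prod f (x \<inter> y) ^ 2 = prod f x * prod f y"
proof -
  have x: "prod f x = prod f (x - y) * prod f (x \<inter> y)"
    using prod.Int_Diff[of x f y] assms by (simp add: mult.commute)
  have y: "prod f y = prod f (y - x) * prod f (x \<inter> y)"
    using prod.Int_Diff[of y f x] assms by (simp add: Int_commute mult.commute)
  have "prod f (x \<ominus> y) = prod f (x - y) * prod f (y - x)"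
    unfolding sdiff_def using assms by (intro prod.union_disjoint) auto
  then show ?thesis by (simp add: x y power2_eq_square)
qed

text \<open>
  For \<open>g = (\<lambda>_. - 1)\<close>, this says that the indicator function of \<open>S\<close> is orthogonal over the
  two-element field to all polynomials of degree at most \<open>t\<close>, so that it is a codeword of the
  dual of a Reed--Muller code.
\<close>

definition balanced :: "nat \<Rightarrow> 'a set set \<Rightarrow> ('a set \<Rightarrow> complex) \<Rightarrow> bool" where
  "balanced t S g \<longleftrightarrow>
    (\<forall>J c. finite J \<longrightarrow> card J \<le> t \<longrightarrow> prod g {a \<in> S. a \<inter> J = c} = 1)"

lemma balancedD:
  "balanced t S g \<Longrightarrow> finite J \<Longrightarrow> card J \<le> t \<Longrightarrow> prod g {a \<in> S. a \<inter> J = c} = 1"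
  by (simp add: balanced_def)

text \<open>Moebius inversion: it is enough to test monomials (all of \<open>K\<close> present)
  instead of arbitrary patterns \<open>c\<close> on \<open>J\<close>. The induction counts the
  elements of \<open>J\<close> that the pattern requires to be absent.\<close>

lemma balancedI:
  assumes "finite S" and nz: "\<And>a. a \<in> S \<Longrightarrow> g a \<noteq> 0"
    and K: "\<And>K. finite K \<Longrightarrow> card K \<le> t \<Longrightarrow> prod g {a \<in> S. K \<subseteq> a} = 1"
  shows "balanced t S g"
  unfolding balanced_def
proof (intro allI impI)
  fix J c :: "'a set"
  assume "finite J" "card J \<le> t"
  then show "prod g {a \<in> S. a \<inter> J = c} = 1"
  proof (induction "card (J - c)" arbitrary: J c)
    case 0
    show ?case
    proof (cases "c \<subseteq> J")
      case True
      with 0 have "c = J" by auto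
      then have "{a \<in> S. a \<inter> J = c} = {a \<in> S. J \<subseteq> a}" by auto
      with K 0 show ?thesis by simp
    next
      case False
      then have "{a \<in> S. a \<inter> J = c} = {}" by auto
      then show ?thesis by (simp only: prod.empty)
    qed
  next
    case (Suc n)
    then obtain j where j: "j \<in> J" "j \<notin> c"
      by (metis Diff_eq_empty_iff card.empty nat.distinct(1) subsetI)
    show ?case
    proof (cases "c \<subseteq> J")
      case True
      have "card (J - {j} - c) = n"
      proof -
        have "J - {j} - c = (J - c) - {j}" by auto
        then show ?thesis using Suc.hyps(2) j Suc.prems by simp
      qed
      moreover have "card (J - insert j c) = n"
      proof -
        have "J - insert j c = (J - c) - {j}" by auto
        then show ?thesis using Suc.hyps(2) j Suc.prems by simp
      qed
      moreover have "card (J - {j}) \<le> t"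
        using Suc.prems by (meson card_Diff1_le le_trans)
      ultimately have 1: "prod g {a \<in> S. a \<inter> (J - {j}) = c} = 1"
        and 2: "prod g {a \<in> S. a \<inter> J = insert j c} = 1"
        using Suc.hyps(1) Suc.prems by (metis finite_Diff)+
      \<comment> \<open>Forgetting \<open>j\<close> merges the patterns \<open>c\<close> and
        \<open>insert j c\<close>. The merged pattern and the second one both require one absence
        fewer, so they are covered by induction.\<close>
      have "{a \<in> S. a \<inter> (J - {j}) = c} = {a \<in> S. a \<inter> J = c} \<union> {a \<in> S. a \<inter> J = insert j c}"
        using j True by blast
      moreover have "{a \<in> S. a \<inter> J = c} \<inter> {a \<in> S. a \<inter> J = insert j c} = {}"
        using j by auto
      ultimately have "prod g {a \<in> S. a \<inter> (J - {j}) = c} =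
          prod g {a \<in> S. a \<inter> J = c} * prod g {a \<in> S. a \<inter> J = insert j c}"
        using \<open>finite S\<close> by (simp add: prod.union_disjoint)
      with 1 2 show ?thesis by simp
    next
      case False
      then have "{a \<in> S. a \<inter> J = c} = {}" by auto
      then show ?thesis by (simp only: prod.empty)
    qed
  qed
qed

text \<open>Prescribing whether \<open>i\<close> is a member amounts to adding \<open>i\<close> to
  the tested set \<open>J\<close>, which uses up one degree.\<close>

lemma balanced_halves:
  assumes "balanced (Suc t) S g"
  shows "balanced t {a \<in> S. i \<in> a} g" "balanced t {a \<in> S. i \<notin> a} g"
proof -
  have "prod g {a \<in> {a \<in> S. i \<in> a}. a \<inter> J = c} = 1 \<and> prod g {a \<in> {a \<in> S. i \<notin> a}. a \<inter> J = c} = 1"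
    if J: "finite J" "card J \<le> t" for J c
  proof -
    have card: "card (insert i J) \<le> Suc t"
      using J by (simp add: card_insert_if)
    show ?thesis
    proof (cases "c \<subseteq> J")
      case False
      then have "{a \<in> {a \<in> S. i \<in> a}. a \<inter> J = c} = {}" "{a \<in> {a \<in> S. i \<notin> a}. a \<inter> J = c} = {}"
        by auto
      then show ?thesis by (simp only: prod.empty)
    next
      case c: True
      have "prod g {a \<in> {a \<in> S. i \<in> a}. a \<inter> J = c} = 1"
      proof (cases "i \<in> J \<and> i \<notin> c")
        case True
        then have "{a \<in> {a \<in> S. i \<in> a}. a \<inter> J = c} = {}" by auto
        then show ?thesis by (simp only: prod.empty)
      next
        case False
        then have "{a \<in> {a \<in> S. i \<in> a}. a \<inter> J = c} = {a \<in> S. a \<inter> insert i J = insert i c}"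
          using c by (cases "i \<in> J") (auto simp: set_eq_iff)
        then show ?thesis
          using balancedD[OF assms _ card, of "insert i c"] J by simp
      qed
      moreover have "prod g {a \<in> {a \<in> S. i \<notin> a}. a \<inter> J = c} = 1"
      proof (cases "i \<in> c")
        case True
        then have "{a \<in> {a \<in> S. i \<notin> a}. a \<inter> J = c} = {}" by auto
        then show ?thesis by (simp only: prod.empty)
      next
        case False
        then have "{a \<in> {a \<in> S. i \<notin> a}. a \<inter> J = c} = {a \<in> S. a \<inter> insert i J = c}"
          using c by blast
        then show ?thesis
          using balancedD[OF assms _ card, of "c"] J by simp
      qed
      ultimately show ?thesis ..
    qed
  qed
  then show "balanced t {a \<in> S. i \<in> a} g" "balanced t {a \<in> S. i \<notin> a} g"
    unfolding balanced_def by blast+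
qed

lemma card_halves:
  "finite S \<Longrightarrow> card S = card {a \<in> S. i \<in> a} + card {a \<in> S. i \<notin> a}"
  by (subst card_Un_disjoint[symmetric]) (auto intro: arg_cong[of _ _ card])

lemma ex_splitting:
  assumes "2 \<le> card (S :: 'a set set)"
  obtains i where "{a \<in> S. i \<in> a} \<noteq> {}" "{a \<in> S. i \<notin> a} \<noteq> {}"
proof -
  have "finite S" using assms card.infinite by force
  moreover have "\<not> card S \<le> Suc 0" using assms by simp
  ultimately obtain a b where ab: "a \<in> S" "b \<in> S" "a \<noteq> b"
    by (auto simp: card_le_Suc0_iff_eq)
  then obtain i where "(i \<in> a) \<noteq> (i \<in> b)" by blast
  with ab that show thesis by blast
qed

section \<open>Minimum size of a balanced family\<close>

lemma balanced_card_ge_2: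
  assumes "finite S" "\<And>a. a \<in> S \<Longrightarrow> g a \<noteq> 1" "balanced t S g" "S \<noteq> {}"
  shows "2 \<le> card S"
proof (rule ccontr)
  assume "\<not> 2 \<le> card S"
  moreover have "card S \<noteq> 0" using assms by simp
  ultimately have "card S = 1" by linarith
  then obtain a where "S = {a}" by (auto simp: card_1_singleton_iff)
  moreover have "prod g S = 1" using balancedD[OF assms(3), of "{}" "{}"] by simp
  ultimately show False using assms(2) by simp
qed

text \<open>The minimum distance argument for Reed--Muller codes, with complex values in place of
  bits; \<open>g a \<noteq> 1\<close> makes \<open>S\<close> the support. A coordinate that is not
  constant on \<open>S\<close> splits it into two nonempty halves, balanced to one degree less, so
  the bound doubles with each degree.\<close>

lemma balanced_min_card:
  assumes "finite S" "\<And>a. a \<in> S \<Longrightarrow> g a \<noteq> 1" "balanced t S g" "S \<noteq> {}"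
  shows "2 ^ Suc t \<le> card S"
  using assms
proof (induction t arbitrary: S)
  case 0
  then show ?case using balanced_card_ge_2[of S g 0] by simp
next
  case (Suc t)
  have c2: "2 \<le> card S" by (rule balanced_card_ge_2) (use Suc.prems in auto)
  obtain i where i: "{a \<in> S. i \<in> a} \<noteq> {}" "{a \<in> S. i \<notin> a} \<noteq> {}"
    by (rule ex_splitting[OF c2])
  have "2 ^ Suc t \<le> card {a \<in> S. i \<in> a}" "2 ^ Suc t \<le> card {a \<in> S. i \<notin> a}"
    by (intro Suc.IH; use Suc.prems i balanced_halves[OF Suc.prems(3), of i] in simp)+
  then show ?case using card_halves[of S i] Suc.prems by simp
qed

section \<open>The binary case: derivatives and flats\<close>

abbreviation even_balanced :: "nat \<Rightarrow> 'a set set \<Rightarrow> bool" where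
  "even_balanced t f \<equiv> balanced t f (\<lambda>_. - 1)"

lemma even_balanced_iff:
  "even_balanced t f \<longleftrightarrow>
    (\<forall>J c. finite J \<longrightarrow> card J \<le> t \<longrightarrow> even (card {a \<in> f. a \<inter> J = c}))"
  unfolding balanced_def by (simp add: minus_one_power_iff)

lemma card_sdiff_add:
  assumes "finite X" "finite Y"
  shows "card (X \<ominus> Y) + 2 * card (X \<inter> Y) = card X + card Y"
proof -
  have "card (X \<ominus> Y) = card (X - Y) + card (Y - X)"
    unfolding sdiff_def using assms by (intro card_Un_disjoint) auto
  moreover have "card X = card (X - Y) + card (X \<inter> Y)" "card Y = card (Y - X) + card (X \<inter> Y)"
    using assms by (simp_all add: card_Diff_subset_Int card_mono Int_commute)
  ultimately show ?thesis by simp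
qed

lemma inj_on_sdiff: "inj_on (\<lambda>a. a \<ominus> u) A"
  by (auto simp: inj_on_def sdiff_right_cancel)

lemma mem_image_sdiff: "a \<in> (\<lambda>a. a \<ominus> u) ` f \<longleftrightarrow> a \<ominus> u \<in> f"
  by (metis (no_types, lifting) image_iff sdiff_cancel(2))

text \<open>One degree beyond the hypothesis the pattern counts may be odd, but they all have the
  same parity: two patterns that differ in one coordinate merge into a pattern on at most
  \<open>t\<close> coordinates, whose count is even.\<close>

lemma even_balanced_patterns:
  assumes f: "finite f" "even_balanced t f" and J: "finite J" "card J \<le> Suc t" and c: "c \<subseteq> J"
  shows "even (card {a \<in> f. a \<inter> J = c} + card {a \<in> f. a \<inter> J = {}})"
proof -
  have "finite c" using J c finite_subset by blast
  then show ?thesis using c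
  proof (induction c)
    case empty
    then show ?case by simp
  next
    case (insert j c)
    have "card (J - {j}) \<le> t" using insert J by simp
    then have "even (card {a \<in> f. a \<inter> (J - {j}) = c})"
      using f J by (auto simp: even_balanced_iff)
    moreover have "{a \<in> f. a \<inter> (J - {j}) = c} = {a \<in> f. a \<inter> J = c} \<union> {a \<in> f. a \<inter> J = insert j c}"
      using insert by blast
    moreover have "{a \<in> f. a \<inter> J = c} \<inter> {a \<in> f. a \<inter> J = insert j c} = {}"
      using insert by auto
    ultimately have "even (card {a \<in> f. a \<inter> J = c} + card {a \<in> f. a \<inter> J = insert j c})"
      using f by (simp add: card_Un_disjoint)
    moreover have "even (card {a \<in> f. a \<inter> J = c} + card {a \<in> f. a \<inter> J = {}})"
      using insert by simp
    ultimately show ?case by presburger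
  qed
qed

text \<open>The set is the derivative along \<open>u\<close> of the indicator function of
  \<open>f\<close>. Translation by \<open>u\<close> permutes the patterns on \<open>J\<close>, and
  at degree \<open>Suc t\<close> all patterns have counts of the same parity, so the two counts that
  are combined have an even sum.\<close>

lemma even_balanced_derivative:
  assumes f: "finite f" "even_balanced t f"
  shows "even_balanced (Suc t) (f \<ominus> (\<lambda>a. a \<ominus> u) ` f)"
  unfolding even_balanced_iff
proof (intro allI impI)
  fix J c :: "'a set"
  assume J: "finite J" "card J \<le> Suc t"
  let ?N = "\<lambda>c. {a \<in> f. a \<inter> J = c}"
  show "even (card {a \<in> f \<ominus> (\<lambda>a. a \<ominus> u) ` f. a \<inter> J = c})"
  proof (cases "c \<subseteq> J")
    case False
    then have "{a \<in> f \<ominus> (\<lambda>a. a \<ominus> u) ` f. a \<inter> J = c} = {}" by auto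
    then show ?thesis by (simp only: card.empty even_zero)
  next
    case c: True
    have eq: "(a \<ominus> u) \<inter> J = c \<ominus> (u \<inter> J) \<longleftrightarrow> a \<inter> J = c" for a
      by (simp only: sdiff_Int sdiff_right_cancel)
    have "{a \<in> f \<ominus> (\<lambda>a. a \<ominus> u) ` f. a \<inter> J = c} = ?N c \<ominus> (\<lambda>a. a \<ominus> u) ` ?N (c \<ominus> (u \<inter> J))"
    proof (rule set_eqI)
      fix a
      show "a \<in> {a \<in> f \<ominus> (\<lambda>a. a \<ominus> u) ` f. a \<inter> J = c} \<longleftrightarrow>
          a \<in> ?N c \<ominus> (\<lambda>a. a \<ominus> u) ` ?N (c \<ominus> (u \<inter> J))"
        by (simp only: mem_Collect_eq mem_sdiff mem_image_sdiff eq) blast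
    qed
    moreover have "card ((\<lambda>a. a \<ominus> u) ` ?N (c \<ominus> (u \<inter> J))) = card (?N (c \<ominus> (u \<inter> J)))"
      by (intro card_image inj_on_sdiff)
    moreover have "even (card (?N c) + card (?N (c \<ominus> (u \<inter> J))))"
    proof -
      have "c \<ominus> (u \<inter> J) \<subseteq> J" using c by (intro sdiff_subset) auto
      then have "even (card (?N (c \<ominus> (u \<inter> J))) + card (?N {}))"
        using even_balanced_patterns[OF f J] by blast
      moreover have "even (card (?N c) + card (?N {}))"
        using even_balanced_patterns[OF f J c] .
      ultimately show ?thesis by presburger
    qed
    moreover have "card (?N c \<ominus> (\<lambda>a. a \<ominus> u) ` ?N (c \<ominus> (u \<inter> J))) +
        2 * card (?N c \<inter> (\<lambda>a. a \<ominus> u) ` ?N (c \<ominus> (u \<inter> J))) =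
        card (?N c) + card ((\<lambda>a. a \<ominus> u) ` ?N (c \<ominus> (u \<inter> J)))"
      using f(1) by (intro card_sdiff_add) auto
    ultimately show ?thesis by presburger
  qed
qed

text \<open>
  The smaller half \<open>F\<close> of \<open>f\<close> with respect to some coordinate is a flat by induction; for a
  direction \<open>u\<close> of \<open>F\<close>, the derivative of \<open>f\<close> along \<open>u\<close> is too small not to vanish, so \<open>f\<close> is a
  union of translates of \<open>F\<close>.
\<close>

theorem even_balanced_flat:
  assumes "finite f" "even_balanced t f" "f \<noteq> {}" "card f < 3 * 2 ^ t"
  shows "card f = 2 ^ Suc t \<and> (\<forall>x\<in>f. \<forall>y\<in>f. \<forall>z\<in>f. x \<ominus> y \<ominus> z \<in> f)"
  using assms
proof (induction t arbitrary: f)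
  case 0
  have "card f = 2"
    using balanced_min_card[of f "\<lambda>_. -1" 0] 0 by simp
  then obtain x y where "f = {x, y}" by (auto simp: card_2_iff)
  then show ?case using \<open>card f = 2\<close>
    by (auto simp: sdiff_commute[of x y] sdiff_assoc)
next
  case (Suc t)
  have "4 * 2 ^ t \<le> card f"
    using balanced_min_card[of f "\<lambda>_. -1" "Suc t"] Suc.prems by simp
  moreover have "1 \<le> (2::nat) ^ t" by simp
  ultimately have c2: "2 \<le> card f" by linarith
  obtain i where i: "{a \<in> f. i \<in> a} \<noteq> {}" "{a \<in> f. i \<notin> a} \<noteq> {}"
    by (rule ex_splitting[OF c2])
  define h where "h b = {a \<in> f. (i \<in> a) = b}" for b
  have h: "even_balanced t (h b)" "h b \<noteq> {}" "finite (h b)" "h b \<subseteq> f" for b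
    using i Suc.prems balanced_halves[OF Suc.prems(2), of i] by (cases b; auto simp: h_def)+
  have "card f = card (h True) + card (h False)"
    using card_halves[of f i] Suc.prems by (simp add: h_def)
  with Suc.prems have "card (h True) < 3 * 2 ^ t \<or> card (h False) < 3 * 2 ^ t"
    by auto
  then obtain b where b: "card (h b) < 3 * 2 ^ t" by blast
  let ?F = "h b"
  have F: "card ?F = 2 ^ Suc t" and F3: "\<And>x y z. x \<in> ?F \<Longrightarrow> y \<in> ?F \<Longrightarrow> z \<in> ?F \<Longrightarrow> x \<ominus> y \<ominus> z \<in> ?F"
    using Suc.IH[of ?F] h b by blast+
  have inv: "a \<ominus> (x \<ominus> y) \<in> f" if xy: "x \<in> ?F" "y \<in> ?F" and "a \<in> f" for x y a
  proof -
    let ?\<tau> = "\<lambda>a. a \<ominus> (x \<ominus> y)"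
    have sub: "?F \<subseteq> f \<inter> ?\<tau> ` f"
    proof
      fix z assume z: "z \<in> ?F"
      then have "?\<tau> z \<in> ?F" using F3[OF xy z] by (metis sdiff_commute)
      with z h(4) show "z \<in> f \<inter> ?\<tau> ` f" by (auto simp: mem_image_sdiff)
    qed
    have "card (?\<tau> ` f) = card f" by (intro card_image inj_on_sdiff)
    then have "card (f \<ominus> ?\<tau> ` f) + 2 * card (f \<inter> ?\<tau> ` f) = 2 * card f"
      using card_sdiff_add[of f "?\<tau> ` f"] Suc.prems by simp
    moreover have "card ?F \<le> card (f \<inter> ?\<tau> ` f)"
      using sub Suc.prems by (intro card_mono) auto
    \<comment> \<open>From \<open>2 * card f < 6 * 2 ^ Suc t\<close> at least
      \<open>2 * 2 ^ Suc t\<close> is subtracted. What remains is below the minimum size for degree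
      \<open>Suc (Suc t)\<close>, the degree of the derivative.\<close>
    ultimately have "card (f \<ominus> ?\<tau> ` f) < 2 ^ Suc (Suc (Suc t))"
      using F Suc.prems(4) by simp
    moreover have "finite (f \<ominus> ?\<tau> ` f)" using Suc.prems by (simp add: sdiff_def)
    ultimately have "f \<ominus> ?\<tau> ` f = {}"
      using balanced_min_card[of "f \<ominus> ?\<tau> ` f" "\<lambda>_. -1" "Suc (Suc t)"]
        even_balanced_derivative[OF Suc.prems(1,2), of "x \<ominus> y"] by force
    then have "?\<tau> ` f = f" by (metis sdiff_cancel(1) sdiff_empty(1))
    with \<open>a \<in> f\<close> show ?thesis by blast
  qed
  obtain p z where p: "p \<in> ?F" and z: "z \<in> h (\<not> b)" using h(2) by blast
  let ?G = "(\<lambda>x. z \<ominus> (x \<ominus> p)) ` ?F"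
  have cosets: "(\<lambda>x. w \<ominus> (x \<ominus> p)) ` ?F \<subseteq> h (\<not> b)" if "w \<in> h (\<not> b)" for w
    using inv[OF _ p] that p by (auto simp: h_def)
  have card_coset: "card ((\<lambda>x. w \<ominus> (x \<ominus> p)) ` ?F) = card ?F" for w
    by (intro card_image) (auto simp: inj_on_def sdiff_left_cancel sdiff_right_cancel)
  have small: "card (h (\<not> b)) < 2 * card ?F"
    using \<open>card f = card (h True) + card (h False)\<close> Suc.prems(4) F by (cases b) auto
  \<comment> \<open>The other half is a union of translates of \<open>?F\<close>. A second translate
    would be disjoint from \<open>?G\<close>, and two of them do not fit into fewer than
    \<open>2 * card ?F\<close> elements.\<close>
  have hG: "h (\<not> b) = ?G"
  proof (rule ccontr)
    assume "h (\<not> b) \<noteq> ?G"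
    then obtain w where w: "w \<in> h (\<not> b)" "w \<notin> ?G" using cosets[OF z] by blast
    have "(\<lambda>x. w \<ominus> (x \<ominus> p)) ` ?F \<inter> ?G = {}"
    proof (rule ccontr)
      assume "(\<lambda>x. w \<ominus> (x \<ominus> p)) ` ?F \<inter> ?G \<noteq> {}"
      then obtain x y where xy: "x \<in> ?F" "y \<in> ?F" "w \<ominus> (x \<ominus> p) = z \<ominus> (y \<ominus> p)" by auto
      then have "w = z \<ominus> ((y \<ominus> p \<ominus> x) \<ominus> p)"
        by (auto simp: set_eq_iff)
      with F3[OF xy(2) p xy(1)] w(2) show False by blast
    qed
    then have "card ((\<lambda>x. w \<ominus> (x \<ominus> p)) ` ?F \<union> ?G) = 2 * card ?F"
      using h(3) by (simp add: card_Un_disjoint card_coset)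
    moreover have "card ((\<lambda>x. w \<ominus> (x \<ominus> p)) ` ?F \<union> ?G) \<le> card (h (\<not> b))"
      using cosets w z h(3) by (intro card_mono) auto
    ultimately show False using small by simp
  qed
  have "card (h (\<not> b)) = card ?F" using hG card_coset by simp
  with \<open>card f = card (h True) + card (h False)\<close> F have "card f = 2 ^ Suc (Suc t)"
    by (cases b) auto
  have dir: "w \<ominus> (x \<ominus> y) \<in> f" if "x \<in> h c" "y \<in> h c" "w \<in> f" for x y w c
  proof (cases "c = b")
    case True
    then show ?thesis using inv that by simp
  next
    case False
    then have "c = (\<not> b)" by auto
    then have "x \<in> ?G" "y \<in> ?G" using that hG by blast+
    then obtain x' y' where "x' \<in> ?F" "y' \<in> ?F" "x = z \<ominus> (x' \<ominus> p)" "y = z \<ominus> (y' \<ominus> p)"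
      by blast
    then have "x \<ominus> y = x' \<ominus> y'" by (auto simp: set_eq_iff)
    with \<open>x' \<in> ?F\<close> \<open>y' \<in> ?F\<close> show ?thesis using inv that(3) by simp
  qed
  have "x \<ominus> y \<ominus> w \<in> f" if "x \<in> f" "y \<in> f" "w \<in> f" for x y w
  proof -
    have dir': "w \<ominus> (x \<ominus> y) \<in> f" if "x \<in> f" "y \<in> f" "w \<in> f" "(i \<in> x) = (i \<in> y)" for x y w
      using dir[of x "i \<in> x" y w] that by (simp add: h_def)
    have eqs: "x \<ominus> y \<ominus> w = w \<ominus> (x \<ominus> y)" "x \<ominus> y \<ominus> w = y \<ominus> (x \<ominus> w)" "x \<ominus> y \<ominus> w = x \<ominus> (y \<ominus> w)"
      by (auto simp: set_eq_iff)
    \<comment> \<open>Two of the three elements lie in the same half, and their difference is a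
      direction of \<open>f\<close>.\<close>
    consider "(i \<in> x) = (i \<in> y)" | "(i \<in> x) = (i \<in> w)" | "(i \<in> y) = (i \<in> w)" by blast
    then show ?thesis
      using dir'[of x y w] dir'[of x w y] dir'[of y w x] that eqs by cases simp_all
  qed
  with \<open>card f = 2 ^ Suc (Suc t)\<close> show ?case by blast
qed

text \<open>Membership of \<open>i\<close> is an affine function on the flat. If it is not constant,
  translation by \<open>a \<ominus> b\<close>, with \<open>i\<close> in \<open>a\<close> but not in
  \<open>b\<close>, exchanges its two fibres.\<close>

lemma flat_halves_card:
  assumes f: "finite f" "\<And>x y z. x \<in> f \<Longrightarrow> y \<in> f \<Longrightarrow> z \<in> f \<Longrightarrow> x \<ominus> y \<ominus> z \<in> f"
    and "card f = 2 * n"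
  shows "card {a \<in> f. i \<in> a} \<in> {0, n, 2 * n}"
proof (cases "\<exists>a b. a \<in> f \<and> b \<in> f \<and> i \<in> a \<and> i \<notin> b")
  case False
  then have "{a \<in> f. i \<in> a} = {} \<or> {a \<in> f. i \<in> a} = f" by blast
  then have "card {a \<in> f. i \<in> a} = 0 \<or> card {a \<in> f. i \<in> a} = card f"
    by (metis card.empty)
  then show ?thesis using assms(3) by (elim disjE) simp_all
next
  case True
  then obtain a b where ab: "a \<in> f" "b \<in> f" "i \<in> a" "i \<notin> b" by blast
  have "bij_betw (\<lambda>x. a \<ominus> b \<ominus> x) {a \<in> f. i \<in> a} {a \<in> f. i \<notin> a}"
    by (rule bij_betwI[where g = "\<lambda>x. a \<ominus> b \<ominus> x"]) (use ab f(2) in auto)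
  then have "card {a \<in> f. i \<in> a} = card {a \<in> f. i \<notin> a}" by (rule bij_betw_same_card)
  then have "card {a \<in> f. i \<in> a} = n"
    using card_halves[OF f(1), of i] assms(3) by simp
  then show ?thesis by simp
qed

section \<open>Phases that are quadratic on a group of sets\<close>

lemma ex_insert_nonempty:
  assumes "finite K" "K \<noteq> {}" "card K \<le> Suc n" "1 \<le> n"
  obtains x K' where "K = insert x K'" "finite K'" "K' \<noteq> {}" "card K' \<le> n"
proof -
  obtain x where x: "x \<in> K" using assms by blast
  show thesis
  proof (cases "K - {x} = {}")
    case True
    then have "K = insert x {x}" using x by blast
    then show thesis using that[of x "{x}"] assms by simp
  next
    case False
    then show thesis using that[of x "K - {x}"] assms x by (simp add: insert_absorb)
  qed
qed

lemma ex_singleton: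
  assumes "finite K" "K \<noteq> {}" "card K \<le> 1"
  obtains x where "K = {x}"
  using assms by (metis One_nat_def card_le_Suc0_iff_eq ex_in_conv singletonI subsetI subset_antisym singletonD)

text \<open>The listed elements may coincide, so that a statement about any three members of a
  family covers at once all its nonempty subfamilies of at most three members.\<close>

lemma ex_insert3:
  assumes "finite K" "K \<noteq> {}" "card K \<le> 3"
  obtains x y z where "K = {x, y, z}"
proof -
  obtain x K1 where 1: "K = insert x K1" "finite K1" "K1 \<noteq> {}" "card K1 \<le> 2"
    using ex_insert_nonempty[of K 2] assms by (auto simp: numeral_eq_Suc)
  obtain y K2 where 2: "K1 = insert y K2" "finite K2" "K2 \<noteq> {}" "card K2 \<le> 1"
    using ex_insert_nonempty[of K1 1] 1 by (auto simp: numeral_eq_Suc)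
  obtain z where "K2 = {z}" using ex_singleton 2 by blast
  with 1 2 that show thesis by blast
qed

lemma ex_insert4:
  assumes "finite K" "K \<noteq> {}" "card K \<le> 4"
  obtains w x y z where "K = {w, x, y, z}"
proof -
  obtain w K1 where "K = insert w K1" "finite K1" "K1 \<noteq> {}" "card K1 \<le> 3"
    using ex_insert_nonempty[of K 3] assms by (auto simp: numeral_eq_Suc)
  moreover from this obtain x y z where "K1 = {x, y, z}" using ex_insert3 by blast
  ultimately show thesis using that by blast
qed

text \<open>\<open>quad\<close> says that \<open>y \<mapsto> prod e y\<close> is quadratic on
  \<open>L\<close>: translation by \<open>a\<close> changes it by a constant and a character
  \<omega> with values 1 and -1. Its third derivative is therefore trivial, and
  \<open>prod_sdiff\<close> expresses this through intersections.\<close>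

lemma quadratic_intersections:
  fixes e :: "'v \<Rightarrow> complex"
  assumes V: "finite V" and LV: "\<And>y. y \<in> L \<Longrightarrow> y \<subseteq> V"
    and L: "\<And>y z. y \<in> L \<Longrightarrow> z \<in> L \<Longrightarrow> y \<ominus> z \<in> L"
    and nz: "\<And>v. v \<in> V \<Longrightarrow> e v \<noteq> 0"
    and quad: "\<And>a. a \<in> L \<Longrightarrow> \<exists>\<omega>. \<forall>y\<in>L. \<omega> y ^ 2 = 1 \<and>
        prod e (y \<ominus> a) = prod e a * prod e y * \<omega> y \<and> (\<forall>z\<in>L. \<omega> (y \<ominus> z) = \<omega> y * \<omega> z)"
  shows "x \<in> L \<Longrightarrow> y \<in> L \<Longrightarrow> z \<in> L \<Longrightarrow> prod e (x \<inter> y \<inter> z) ^ 4 = 1"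
    and "w \<in> L \<Longrightarrow> x \<in> L \<Longrightarrow> y \<in> L \<Longrightarrow> z \<in> L \<Longrightarrow> prod e (w \<inter> x \<inter> y \<inter> z) ^ 8 = 1"
proof -
  have fin: "finite y" if "y \<in> L" for y using V LV that finite_subset by blast
  have pnz: "prod e T \<noteq> 0" if "T \<subseteq> V" for T
    using that nz V by (metis prod_zero_iff rev_finite_subset subsetD)
  have \<beta>: "prod e (y \<inter> z) ^ 2 * prod e (y \<inter> z) ^ 2 = 1 \<and>
      prod e ((x \<ominus> y) \<inter> z) ^ 2 = prod e (x \<inter> z) ^ 2 * prod e (y \<inter> z) ^ 2"
    if xyz: "x \<in> L" "y \<in> L" "z \<in> L" for x y z
  proof -
    obtain \<omega> where \<omega>: "\<And>y. y \<in> L \<Longrightarrow> \<omega> y ^ 2 = 1"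
      "\<And>y. y \<in> L \<Longrightarrow> prod e (y \<ominus> z) = prod e z * prod e y * \<omega> y"
      "\<And>x y. x \<in> L \<Longrightarrow> y \<in> L \<Longrightarrow> \<omega> (x \<ominus> y) = \<omega> x * \<omega> y"
      using quad[OF xyz(3)] by blast
    \<comment> \<open>The square of the product over \<open>y \<inter> z\<close> is the polar form
      of the quadratic function, so it inherits multiplicativity in \<open>y\<close> from
      \<omega>.\<close>
    have eq: "prod e (y \<inter> z) ^ 2 = \<omega> y" if "y \<in> L" for y
    proof -
      have "prod e z * prod e y * \<omega> y * prod e (y \<inter> z) ^ 2 = prod e y * prod e z"
        using prod_sdiff[of y z e] fin \<omega>(2) that xyz by simp
      then have "\<omega> y * prod e (y \<inter> z) ^ 2 = 1"
        using pnz LV that xyz by simp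
      then have "\<omega> y ^ 2 * prod e (y \<inter> z) ^ 2 = \<omega> y"
        by (metis mult.assoc mult.right_neutral power2_eq_square)
      then show ?thesis using \<omega>(1) that by simp
    qed
    show ?thesis
      using eq xyz L \<omega>(1,3) by (simp flip: power2_eq_square)
  qed
  have four: "prod e (x \<inter> y \<inter> z) ^ 4 = 1" if xyz: "x \<in> L" "y \<in> L" "z \<in> L" for x y z
  proof -
    have "prod e ((x \<inter> z) \<ominus> (y \<inter> z)) * prod e ((x \<inter> z) \<inter> (y \<inter> z)) ^ 2 =
        prod e (x \<inter> z) * prod e (y \<inter> z)"
      using fin xyz by (intro prod_sdiff) auto
    \<comment> \<open>Squaring makes the outer factors values of the polar form, which cancel by
      multiplicativity and leave a fourth power.\<close>
    then have "prod e ((x \<inter> z) \<ominus> (y \<inter> z)) ^ 2 * (prod e ((x \<inter> z) \<inter> (y \<inter> z)) ^ 2) ^ 2 =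
        prod e (x \<inter> z) ^ 2 * prod e (y \<inter> z) ^ 2"
      by (metis power_mult_distrib)
    moreover have "prod e (x \<inter> z) \<noteq> 0" "prod e (y \<inter> z) \<noteq> 0"
      using LV xyz by (auto intro!: pnz)
    moreover have "(x \<inter> z) \<inter> (y \<inter> z) = x \<inter> y \<inter> z" by blast
    ultimately show ?thesis
      using \<beta>[OF xyz] by (simp flip: sdiff_Int power_mult)
  qed
  then show "x \<in> L \<Longrightarrow> y \<in> L \<Longrightarrow> z \<in> L \<Longrightarrow> prod e (x \<inter> y \<inter> z) ^ 4 = 1" .
  show "prod e (w \<inter> x \<inter> y \<inter> z) ^ 8 = 1" if wxyz: "w \<in> L" "x \<in> L" "y \<in> L" "z \<in> L"
  proof -
    have "prod e ((w \<inter> (y \<inter> z)) \<ominus> (x \<inter> (y \<inter> z))) * prod e ((w \<inter> (y \<inter> z)) \<inter> (x \<inter> (y \<inter> z))) ^ 2 =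
        prod e (w \<inter> (y \<inter> z)) * prod e (x \<inter> (y \<inter> z))"
      using fin wxyz by (intro prod_sdiff) auto
    \<comment> \<open>Fourth powers of the outer factors are 1 by \<open>four\<close>, which leaves
      the eighth power.\<close>
    then have "prod e ((w \<inter> (y \<inter> z)) \<ominus> (x \<inter> (y \<inter> z))) ^ 4 *
        (prod e ((w \<inter> (y \<inter> z)) \<inter> (x \<inter> (y \<inter> z))) ^ 2) ^ 4 =
        prod e (w \<inter> (y \<inter> z)) ^ 4 * prod e (x \<inter> (y \<inter> z)) ^ 4"
      by (metis power_mult_distrib)
    moreover have "(w \<inter> (y \<inter> z)) \<inter> (x \<inter> (y \<inter> z)) = w \<inter> x \<inter> y \<inter> z" by blast
    ultimately show ?thesis
      using four[OF L[OF wxyz(1,2)] wxyz(3,4)] four[OF wxyz(1,3,4)] four[OF wxyz(2,3,4)]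
      by (simp add: Int_assoc flip: sdiff_Int power_mult)
  qed
qed

lemma balanced_nontrivial:
  assumes "finite S" "balanced t S g"
  shows "balanced t {a \<in> S. g a \<noteq> 1} g"
  unfolding balanced_def
proof (intro allI impI)
  fix J c :: "'a set"
  assume "finite J" "card J \<le> t"
  then have "prod g {a \<in> S. a \<inter> J = c} = 1" using assms(2) balancedD by blast
  moreover have "prod g {a \<in> {a \<in> S. g a \<noteq> 1}. a \<inter> J = c} = prod g {a \<in> S. a \<inter> J = c}"
    using assms(1) by (intro prod.mono_neutral_left) auto
  ultimately show "prod g {a \<in> {a \<in> S. g a \<noteq> 1}. a \<inter> J = c} = 1" by simp
qed

text \<open>Only products over members of \<open>L\<close> have to be kept. Qubits with the same
  column occur in the same members of \<open>L\<close>, so only the product \<open>E\<close> of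
  their phases counts, and there are no more of these products than qubits. The bound 22 is 24 less
  one for the dummy column and one for strictness.\<close>

proposition quarter_phases:
  fixes e :: "'v \<Rightarrow> complex"
  assumes V: "finite V" "card V \<le> 22" and LV: "\<And>y. y \<in> L \<Longrightarrow> y \<subseteq> V"
    and L: "\<And>y z. y \<in> L \<Longrightarrow> z \<in> L \<Longrightarrow> y \<ominus> z \<in> L"
    and nz: "\<And>v. v \<in> V \<Longrightarrow> e v \<noteq> 0"
    and quad: "\<And>a. a \<in> L \<Longrightarrow> \<exists>\<omega>. \<forall>y\<in>L. \<omega> y ^ 2 = 1 \<and>
        prod e (y \<ominus> a) = prod e a * prod e y * \<omega> y \<and> (\<forall>z\<in>L. \<omega> (y \<ominus> z) = \<omega> y * \<omega> z)"
  obtains e' where "\<And>v. e' v ^ 4 = 1" "\<And>y. y \<in> L \<Longrightarrow> prod e' y = prod e y"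
proof -
  note int4 = quadratic_intersections(1)[OF V(1) LV L nz quad]
  note int8 = quadratic_intersections(2)[OF V(1) LV L nz quad]
  \<comment> \<open>A column lists the members of \<open>L\<close> that contain a qubit. Qubits with
    empty column lie in no member of \<open>L\<close> and are discarded from
    \<open>C\<close>.\<close>
  define col where "col v = {y \<in> L. v \<in> y}" for v
  define C where "C = col ` V - {{}}"
  define E where "E a = (\<Prod>v | v \<in> V \<and> col v = a. e v)" for a
  have finC: "finite C" using V by (simp add: C_def)
  have "card C \<le> card (col ` V)" using V unfolding C_def by (intro card_mono) auto
  with card_image_le[OF V(1), of col] V(2) have cardC: "card C \<le> 22" by linarith
  have Enz: "E a \<noteq> 0" for a using V nz by (auto simp: E_def)
  \<comment> \<open>A product over the qubits common to all members of \<open>K\<close> is regrouped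
    by columns. Since \<open>K\<close> is nonempty, these columns are nonempty and so belong to
    \<open>C\<close>.\<close>
  have group: "(\<Prod>a | a \<in> C \<and> K \<subseteq> a. \<Prod>v | v \<in> V \<and> col v = a. h v) = prod h {v \<in> V. K \<subseteq> col v}"
    if "K \<noteq> {}" for K and h :: "'v \<Rightarrow> complex"
  proof -
    have "(\<Prod>a | a \<in> C \<and> K \<subseteq> a. \<Prod>v | v \<in> {v \<in> V. K \<subseteq> col v} \<and> col v = a. h v) =
        prod h {v \<in> V. K \<subseteq> col v}"
      using V finC that by (intro prod.group) (auto simp: C_def)
    moreover have "(\<Prod>a | a \<in> C \<and> K \<subseteq> a. \<Prod>v | v \<in> {v \<in> V. K \<subseteq> col v} \<and> col v = a. h v) =
        (\<Prod>a | a \<in> C \<and> K \<subseteq> a. \<Prod>v | v \<in> V \<and> col v = a. h v)"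
      by (intro prod.cong refl) auto
    ultimately show ?thesis by simp
  qed
  have E_prod: "(\<Prod>a | a \<in> C \<and> K \<subseteq> a. E a ^ m) = (if K \<subseteq> L then prod e (\<Inter> K) ^ m else 1)"
    if "K \<noteq> {}" for K m
  proof -
    have "(\<Prod>a | a \<in> C \<and> K \<subseteq> a. E a ^ m) = prod e {v \<in> V. K \<subseteq> col v} ^ m"
      using group[OF that, of "\<lambda>v. e v ^ m"] by (simp add: E_def prod_power_distrib)
    moreover have "{v \<in> V. K \<subseteq> col v} = (if K \<subseteq> L then \<Inter> K else {})"
      using that LV by (auto simp: col_def)
    ultimately show ?thesis by simp
  qed
  have E8: "E a ^ 8 = 1" if "a \<in> C" for a
  proof -
    \<comment> \<open>The value at the dummy \<open>{}\<close> is chosen to make the total product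
      1, which is the condition for \<open>K = {}\<close>. A nonempty \<open>K\<close> is not
      contained in \<open>{}\<close>, so no other condition is affected.\<close>
    define g where "g a = (if a = {} then inverse (\<Prod>a\<in>C. E a ^ 8) else E a ^ 8)" for a
    let ?S = "insert {} C"
    have g0: "{} \<notin> C" by (simp add: C_def)
    have "balanced 4 ?S g"
    proof (rule balancedI)
      fix K :: "'v set set" assume K: "finite K" "card K \<le> 4"
      show "prod g {a \<in> ?S. K \<subseteq> a} = 1"
      proof (cases "K = {}")
        case True
        have "prod g C = (\<Prod>a\<in>C. E a ^ 8)"
          using g0 by (intro prod.cong) (auto simp: g_def)
        moreover have "prod g ?S = g {} * prod g C" using finC g0 by simp
        ultimately have "prod g ?S = 1" using finC Enz by (simp add: g_def)
        moreover have "{a \<in> ?S. K \<subseteq> a} = ?S" unfolding True by auto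
        ultimately show ?thesis by (simp only:)
      next
        case False
        then obtain w x y z where "K = {w, x, y, z}" using ex_insert4 K by metis
        then have "(\<Prod>a | a \<in> C \<and> K \<subseteq> a. E a ^ 8) = 1"
          using E_prod[OF False, of 8] int8[of w x y z] by (simp add: Int_assoc)
        moreover have "prod g {a \<in> ?S. K \<subseteq> a} = (\<Prod>a | a \<in> C \<and> K \<subseteq> a. E a ^ 8)"
          using False g0 by (intro prod.cong) (auto simp: g_def)
        ultimately show ?thesis by simp
      qed
    qed (use finC Enz in \<open>auto simp: g_def\<close>)
    define S where "S = {a \<in> ?S. g a \<noteq> 1}"
    have S: "finite S" "\<And>a. a \<in> S \<Longrightarrow> g a \<noteq> 1" "balanced 4 S g"
      using balanced_nontrivial[OF _ \<open>balanced 4 ?S g\<close>] finC by (simp_all add: S_def)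
    have "card S \<le> card ?S" using finC unfolding S_def by (intro card_mono) auto
    \<comment> \<open>With the dummy there are at most 23 elements, against a minimum of 32 for
      degree 4.\<close>
    then have "card S < 2 ^ Suc 4" using cardC finC g0 by simp
    then have "S = {}" using balanced_min_card[OF S] by fastforce
    then have "g a = 1" using that by (auto simp: S_def)
    then show ?thesis using that g0 by (auto simp: g_def split: if_splits)
  qed
  define f0 where "f0 = {a \<in> C. E a ^ 4 = -1}"
  \<comment> \<open>Again the empty column serves as a dummy: it makes the size even, and no
    nonempty \<open>K\<close> sees it.\<close>
  define f where "f = (if even (card f0) then f0 else insert {} f0)"
  have E4: "E a ^ 4 = (if a \<in> f0 then -1 else 1)" if "a \<in> C" for a
  proof -
    have "(E a ^ 4) ^ 2 = 1" using E8[OF that] by (simp flip: power_mult)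
    then have "E a ^ 4 = 1 \<or> E a ^ 4 = -1" by (simp only: power2_eq_1_iff)
    then show ?thesis using that by (auto simp: f0_def)
  qed
  have f0: "finite f0" "{} \<notin> f0" "f0 \<subseteq> C" using finC by (auto simp: f0_def C_def)
  have finf: "finite f" using f0 by (simp add: f_def)
  have "even_balanced 3 f"
  proof (rule balancedI)
    fix K :: "'v set set" assume K: "finite K" "card K \<le> 3"
    show "(\<Prod>a | a \<in> f \<and> K \<subseteq> a. - 1 :: complex) = 1"
    proof (cases "K = {}")
      case True
      then show ?thesis using f0 by (simp add: f_def)
    next
      case False
      then obtain x y z where "K = {x, y, z}" using ex_insert3 K by metis
      then have "(\<Prod>a | a \<in> C \<and> K \<subseteq> a. E a ^ 4) = 1"
        using E_prod[OF False, of 4] int4[of x y z] by (simp add: Int_assoc)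
      moreover have "(\<Prod>a | a \<in> C \<and> K \<subseteq> a. E a ^ 4) = (\<Prod>a | a \<in> f \<and> K \<subseteq> a. - 1)"
        using False f0 finC by (intro prod.mono_neutral_cong_right) (auto simp: f_def E4 split: if_splits)
      ultimately show ?thesis by simp
    qed
  qed (use finf in auto)
  have dvd8: "8 dvd card {a \<in> f0. y \<in> a}" for y
  proof (cases "f = {}")
    case True
    then have "f0 = {}" by (auto simp: f_def split: if_splits)
    then show ?thesis by simp
  next
    case False
    have "card f0 \<le> 22" using f0 cardC finC card_mono le_trans by blast
    then have "card f < 3 * 2 ^ 3" using f0 by (simp add: f_def)
    then have "card f = 2 * 8" "\<And>x y z. x \<in> f \<Longrightarrow> y \<in> f \<Longrightarrow> z \<in> f \<Longrightarrow> x \<ominus> y \<ominus> z \<in> f"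
      using even_balanced_flat[OF finf \<open>even_balanced 3 f\<close> False] by simp_all
    \<comment> \<open>The members of \<open>L\<close> are the coordinates on the space of columns,
      so the columns that contain \<open>y\<close> form a half of the flat.\<close>
    then have "card {a \<in> f. y \<in> a} \<in> {0, 8, 2 * 8}"
      using flat_halves_card[OF finf] by blast
    moreover have "{a \<in> f0. y \<in> a} = {a \<in> f. y \<in> a}" by (auto simp: f_def)
    ultimately have "card {a \<in> f0. y \<in> a} \<in> {0, 8, 2 * 8}" by (simp only:)
    then show ?thesis by (elim insertE emptyE) simp_all
  qed
  define \<zeta> :: complex where "\<zeta> = cis (pi / 4)"
  have \<zeta>4: "\<zeta> ^ 4 = -1" unfolding \<zeta>_def Complex.DeMoivre by simp
  have \<zeta>8: "\<zeta> ^ n = 1" if "8 dvd n" for n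
  proof -
    from that obtain k where "n = 4 * (2 * k)" by (auto simp: dvd_def)
    then show ?thesis by (simp only: power_mult \<zeta>4) simp
  qed
  have \<zeta>nz: "\<zeta> \<noteq> 0" using \<zeta>4 by auto
  \<comment> \<open>On \<open>f0\<close> the fourth power of \<open>E\<close> is -1, and dividing by
    \<zeta> restores 1. The product over the columns that contain \<open>y\<close> loses a power of
    \<zeta> whose exponent is a multiple of 8, that is, nothing.\<close>
  define E0 where "E0 a = (if a \<in> f0 then E a / \<zeta> else if a \<in> C then E a else 1)" for a
  have E0_4: "E0 a ^ 4 = 1" for a
  proof (cases "a \<in> C")
    case True
    then show ?thesis using E4[of a] \<zeta>4 by (simp add: E0_def power_divide)
  next
    case False
    then have "a \<notin> f0" using f0(3) by blast
    with False show ?thesis by (simp add: E0_def)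
  qed
  define rep where "rep a = (SOME v. v \<in> V \<and> col v = a)" for a
  have rep: "rep a \<in> V \<and> col (rep a) = a" if "a \<in> C" for a
  proof -
    from that obtain v where "v \<in> V \<and> col v = a" by (auto simp: C_def)
    then show ?thesis unfolding rep_def by (rule someI)
  qed
  \<comment> \<open>Only the product over a column matters, so its corrected value is placed on one
    representative and the other qubits get phase 1.\<close>
  define e' where "e' v = (if v = rep (col v) then E0 (col v) else 1)" for v
  have "prod e' y = prod e y" if y: "y \<in> L" for y
  proof -
    have Vy: "{v \<in> V. {y} \<subseteq> col v} = y" using y LV by (auto simp: col_def)
    have "prod e' y = (\<Prod>a | a \<in> C \<and> {y} \<subseteq> a. \<Prod>v | v \<in> V \<and> col v = a. e' v)"
      using group[of "{y}" e'] Vy by simp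
    also have "\<dots> = (\<Prod>a | a \<in> C \<and> {y} \<subseteq> a. E0 a)"
    proof (intro prod.cong refl)
      fix a assume "a \<in> {a. a \<in> C \<and> {y} \<subseteq> a}"
      then have a: "rep a \<in> V" "col (rep a) = a" using rep by auto
      have "(\<Prod>v | v \<in> V \<and> col v = a. e' v) = (\<Prod>v | v \<in> V \<and> col v = a. if v = rep a then E0 a else 1)"
        by (intro prod.cong) (auto simp: e'_def)
      also have "\<dots> = E0 a" using V a by (simp add: prod.delta)
      finally show "(\<Prod>v | v \<in> V \<and> col v = a. e' v) = E0 a" .
    qed
    also have "\<dots> = (\<Prod>a | a \<in> C \<and> {y} \<subseteq> a. E a * (if a \<in> f0 then inverse \<zeta> else 1))"
      by (intro prod.cong) (auto simp: E0_def divide_inverse)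
    also have "\<dots> = (\<Prod>a | a \<in> C \<and> {y} \<subseteq> a. E a) * (\<Prod>a | a \<in> C \<and> {y} \<subseteq> a. if a \<in> f0 then inverse \<zeta> else 1)"
      by (rule prod.distrib)
    also have "(\<Prod>a | a \<in> C \<and> {y} \<subseteq> a. if a \<in> f0 then inverse \<zeta> else 1) = (\<Prod>a | a \<in> f0 \<and> y \<in> a. inverse \<zeta>)"
      using f0 finC by (intro prod.mono_neutral_cong_right) auto
    also have "\<dots> = 1" using \<zeta>8[OF dvd8[of y]] by (simp add: power_inverse)
    also have "(\<Prod>a | a \<in> C \<and> {y} \<subseteq> a. E a) = prod e y"
      using group[of "{y}" e] Vy by (simp add: E_def)
    finally show ?thesis by simp
  qed
  moreover have "e' v ^ 4 = 1" for v by (simp add: e'_def E0_4)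
  ultimately show thesis using that by blast
qed

subsection \<open>Pauli operators\<close>

text \<open>The Pauli operator \<open>\<i>\<^sup>p\<^sup>q X\<^sup>p Z\<^sup>q\<close> is indexed by \<open>(p, q)\<close>; so \<open>(True, True)\<close> is Y.\<close>

type_synonym pauli = "bool \<times> bool"

abbreviation pI :: pauli where "pI \<equiv> (False, False)"

definition padd :: "pauli \<Rightarrow> pauli \<Rightarrow> pauli" where
  "padd a b = (fst a \<noteq> fst b, snd a \<noteq> snd b)"

definition pauli_op :: "pauli \<Rightarrow> qubit_op" where
  "pauli_op a = (\<chi> i j. if (i \<noteq> j) = fst a
    then (if fst a \<and> snd a then \<i> else 1) * (if snd a \<and> j then - 1 else 1) else 0)"

lemma sum_pauli: "(\<Sum>a\<in>UNIV. f a) = f (False, False) + f (False, True) + f (True, False) + f (True, True)"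
  for f :: "pauli \<Rightarrow> 'a::comm_monoid_add"
proof -
  have "(UNIV :: pauli set) = {(False, False), (False, True), (True, False), (True, True)}"
    by auto
  then have "sum f UNIV = sum f {(False, False), (False, True), (True, False), (True, True)}"
    by (rule arg_cong)
  then show ?thesis by (simp add: add.assoc)
qed

lemmas qubit_simps = vec_eq_iff matrix_matrix_mult_def UNIV_bool mat_def trace_def dagger_def
  transpose_def pauli_op_def

lemma pauli_op_pI: "pauli_op pI = mat 1"
  by (simp add: qubit_simps)

lemma dagger_pauli_op [simp]: "dagger (pauli_op a) = pauli_op a"
  by (cases a) (auto simp: qubit_simps)

lemma pauli_op_square: "pauli_op a ** pauli_op a = mat 1"
  by (cases a) (auto simp: qubit_simps)

lemma unitary_pauli_op: "unitary (pauli_op a)"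
  by (simp add: unitary_def pauli_op_square)

lemma dagger_dagger [simp]: "dagger (dagger A) = A"
  by (simp add: qubit_simps)

lemma unitary_dagger: "unitary A \<Longrightarrow> unitary (dagger A)"
  by (simp add: unitary_def)

lemma pauli_op_mult:
  "\<exists>c. norm c = 1 \<and> pauli_op a ** pauli_op b = mat c ** pauli_op (padd a b)"
proof -
  \<comment> \<open>As \<open>pauli_op (padd a b)\<close> squares to the identity, the triple
    product is the scalar matrix of the wanted phase, which any diagonal entry shows.\<close>
  define c where "c = (pauli_op a ** pauli_op b ** pauli_op (padd a b)) $ False $ False"
  have "norm c = 1 \<and> pauli_op a ** pauli_op b = mat c ** pauli_op (padd a b)"
    unfolding c_def by (cases a; cases b) (auto simp: qubit_simps padd_def)
  then show ?thesis by blast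
qed

lemma trace_pauli_op_mult: "trace (pauli_op a ** pauli_op b) = (if a = b then 2 else 0)"
  by (cases a; cases b) (auto simp: qubit_simps)

lemma pauli_expansion: "A $ i $ j = (\<Sum>a\<in>UNIV. trace (pauli_op a ** A) / 2 * pauli_op a $ i $ j)"
  by (cases i; cases j) (simp_all add: sum_pauli qubit_simps field_simps)

lemma trace_dagger: "trace (dagger A) = cnj (trace A)"
  by (simp add: qubit_simps)

text \<open>The matrix of conjugation by \<open>U\<close> in the Pauli basis. For unitary
  \<open>U\<close>, its restriction to the three nontrivial Paulis is the rotation of the Bloch
  sphere induced by \<open>U\<close>.\<close>

definition rotation :: "qubit_op \<Rightarrow> pauli \<Rightarrow> pauli \<Rightarrow> complex" where
  "rotation U a b = trace (pauli_op a ** (U ** pauli_op b ** dagger U)) / 2"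

lemma conj_pauli_op: "(U ** pauli_op b ** dagger U) $ i $ j =
    (\<Sum>a\<in>UNIV. rotation U a b * pauli_op a $ i $ j)"
  unfolding rotation_def by (rule pauli_expansion)

lemma dagger_conj_pauli_op: "(dagger U ** pauli_op a ** U) $ i $ j =
    (\<Sum>b\<in>UNIV. rotation U a b * pauli_op b $ i $ j)"
proof -
  have "trace (pauli_op b ** (dagger U ** pauli_op a ** U)) / 2 = rotation U a b" for b
    unfolding rotation_def
    by (metis (no_types, lifting) matrix_mul_assoc trace_mul_sym)
  then show ?thesis using pauli_expansion[of "dagger U ** pauli_op a ** U" i j] by simp
qed

text \<open>Conjugation by a unitary preserves the trace form, for which the Pauli operators are
  orthogonal with square norm 2. The entries are real because conjugates of Paulis are
  Hermitian.\<close>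

lemma rotation_orthogonal:
  assumes "unitary U"
  shows "(\<Sum>a\<in>UNIV. rotation U a b * cnj (rotation U a c)) = (if b = c then 1 else 0)"
proof -
  have real: "cnj (rotation U a c) = rotation U a c" for a
    unfolding rotation_def
    by (simp add: trace_dagger[symmetric] dagger_mult matrix_mul_assoc)
      (metis matrix_mul_assoc trace_mul_sym)
  have tr_sum: "trace (A ** B) = (\<Sum>a\<in>UNIV. f a * trace (A ** pauli_op a))"
    if "\<And>i j. B $ i $ j = (\<Sum>a\<in>UNIV. f a * pauli_op a $ i $ j)" for A B :: qubit_op and f
    by (simp add: trace_def matrix_matrix_mult_def that sum_pauli UNIV_bool algebra_simps)
  have "trace ((U ** pauli_op b ** dagger U) ** (U ** pauli_op c ** dagger U)) =
      (\<Sum>a\<in>UNIV. rotation U a c * trace ((U ** pauli_op b ** dagger U) ** pauli_op a))"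
    by (rule tr_sum) (rule conj_pauli_op)
  also have "\<dots> = 2 * (\<Sum>a\<in>UNIV. rotation U a b * rotation U a c)"
    by (simp add: rotation_def sum_distrib_left trace_mul_sym[of "U ** pauli_op b ** dagger U"] field_simps)
  also have "(U ** pauli_op b ** dagger U) ** (U ** pauli_op c ** dagger U) =
      U ** (pauli_op b ** (dagger U ** U) ** pauli_op c ** dagger U)"
    by (simp add: matrix_mul_assoc)
  also have "trace \<dots> = trace ((dagger U ** U) ** (pauli_op b ** pauli_op c))"
    using assms by (subst trace_mul_sym) (simp add: unitary_def matrix_mul_assoc[symmetric])
  finally show ?thesis
    using assms trace_pauli_op_mult[of b c] by (simp add: real unitary_def split: if_splits)
qed

lemma rotation_pI_left: "unitary U \<Longrightarrow> rotation U pI b = (if b = pI then 1 else 0)"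
  using trace_pauli_op_mult[of pI b] trace_mul_sym[of "U ** pauli_op b" "dagger U"]
  by (simp add: rotation_def pauli_op_pI matrix_mul_assoc unitary_def split: if_splits)

lemma rotation_pI_right: "unitary U \<Longrightarrow> rotation U a pI = (if a = pI then 1 else 0)"
  using trace_pauli_op_mult[of a pI]
  by (simp add: rotation_def pauli_op_pI unitary_def split: if_splits)

subsection \<open>Local operators\<close>

lemma prod_sum_bool:
  fixes f :: "'v \<Rightarrow> bool \<Rightarrow> complex"
  assumes "finite V"
  shows "(\<Prod>u\<in>V. f u False + f u True) = (\<Sum>z\<in>Pow V. \<Prod>u\<in>V. f u (u \<in> z))"
proof -
  have "(\<Prod>u\<in>V. f u False + f u True) = (\<Prod>u\<in>V. f u True + f u False)"
    by (simp add: add.commute)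
  also have "\<dots> = (\<Sum>X\<in>Pow V. (\<Prod>x\<in>X. f x True) * (\<Prod>x\<in>V-X. f x False))"
    using assms by (rule prod_add)
  also have "\<dots> = (\<Sum>z\<in>Pow V. \<Prod>u\<in>V. f u (u \<in> z))"
  proof (rule sum.cong)
    fix z assume z: "z \<in> Pow V"
    then have "(\<Prod>u\<in>V. f u (u \<in> z)) = (\<Prod>u\<in>V - z. f u (u \<in> z)) * (\<Prod>u\<in>z. f u (u \<in> z))"
      using assms by (intro prod.subset_diff) auto
    then show "(\<Prod>x\<in>z. f x True) * (\<Prod>x\<in>V-z. f x False) = (\<Prod>u\<in>V. f u (u \<in> z))"
      by (simp add: mult.commute)
  qed simp
  finally show ?thesis .
qed

lemma tensor_entry_mult:
  assumes "finite V"
  shows "(\<Sum>z\<in>Pow V. tensor_entry V A y z * tensor_entry V B z x) =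
    tensor_entry V (\<lambda>u. A u ** B u) y x"
  using prod_sum_bool[OF assms, of "\<lambda>u b. A u $ (u \<in> y) $ b * B u $ b $ (u \<in> x)"]
  by (simp add: tensor_entry_def prod.distrib matrix_matrix_mult_def UNIV_bool add.commute)

lemma apply_local_comp:
  assumes "finite V"
  shows "apply_local V A (apply_local V B \<psi>) = apply_local V (\<lambda>u. A u ** B u) \<psi>"
proof
  fix y
  show "apply_local V A (apply_local V B \<psi>) y = apply_local V (\<lambda>u. A u ** B u) \<psi> y"
  proof (cases "y \<subseteq> V")
    case True
    have "apply_local V A (apply_local V B \<psi>) y =
        (\<Sum>z\<in>Pow V. tensor_entry V A y z * (\<Sum>x\<in>Pow V. tensor_entry V B z x * \<psi> x))"
      using True by (simp add: apply_local_def)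
    also have "\<dots> = (\<Sum>z\<in>Pow V. \<Sum>x\<in>Pow V. tensor_entry V A y z * tensor_entry V B z x * \<psi> x)"
      by (simp add: sum_distrib_left mult.assoc)
    also have "\<dots> = (\<Sum>x\<in>Pow V. (\<Sum>z\<in>Pow V. tensor_entry V A y z * tensor_entry V B z x) * \<psi> x)"
      by (subst sum.swap) (simp add: sum_distrib_right)
    finally show ?thesis
      using True by (simp add: tensor_entry_mult assms apply_local_def)
  qed (simp add: apply_local_def)
qed

lemma tensor_entry_cong: "(\<And>u. u \<in> V \<Longrightarrow> A u = B u) \<Longrightarrow> tensor_entry V A = tensor_entry V B"
  by (simp add: tensor_entry_def fun_eq_iff)

lemma apply_local_cong: "(\<And>u. u \<in> V \<Longrightarrow> A u = B u) \<Longrightarrow> apply_local V A = apply_local V B"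
  by (simp add: apply_local_def fun_eq_iff tensor_entry_cong[of V A B])

lemma tensor_entry_diagonal:
  assumes "finite V" "y \<subseteq> V" "x \<subseteq> V" "\<And>u. u \<in> V \<Longrightarrow> A u $ True $ False = 0 \<and> A u $ False $ True = 0"
  shows "tensor_entry V A y x = (if x = y then \<Prod>u\<in>V. A u $ (u \<in> y) $ (u \<in> y) else 0)"
proof (cases "x = y")
  case False
  then obtain u where "u \<in> V" "(u \<in> x) \<noteq> (u \<in> y)" using assms by blast
  then have "A u $ (u \<in> y) $ (u \<in> x) = 0" using assms(4)[of u] by (cases "u \<in> x") auto
  with \<open>u \<in> V\<close> False assms(1) show ?thesis by (auto simp: tensor_entry_def)
qed (simp add: tensor_entry_def)

lemma apply_local_diagonal:
  assumes "finite V" "\<And>u. u \<in> V \<Longrightarrow> A u $ True $ False = 0 \<and> A u $ False $ True = 0"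
  shows "apply_local V A \<psi> y = (if y \<subseteq> V then (\<Prod>u\<in>V. A u $ (u \<in> y) $ (u \<in> y)) * \<psi> y else 0)"
proof (cases "y \<subseteq> V")
  case True
  have "(\<Sum>x\<in>Pow V. tensor_entry V A y x * \<psi> x) =
      (\<Sum>x\<in>Pow V. if x = y then (\<Prod>u\<in>V. A u $ (u \<in> y) $ (u \<in> y)) * \<psi> y else 0)"
    using tensor_entry_diagonal[OF assms(1) True _ assms(2)] by (intro sum.cong) auto
  then show ?thesis using True assms(1) by (simp add: apply_local_def)
qed (simp add: apply_local_def)

text \<open>States are functions on all sets and operators are compared through equality of such
  functions, so the convention about sets outside \<open>Pow V\<close> has to be carried along; see
  \<open>apply_local_id\<close>.\<close>

definition supported :: "'v set \<Rightarrow> ('v set \<Rightarrow> complex) \<Rightarrow> bool" where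
  "supported V \<psi> \<longleftrightarrow> (\<forall>x. \<not> x \<subseteq> V \<longrightarrow> \<psi> x = 0)"

lemma supported_apply_local [simp]: "supported V (apply_local V A \<psi>)"
  by (simp add: supported_def apply_local_def)

lemma supported_graph_state [simp]: "supported V (graph_state V E)"
  by (simp add: supported_def graph_state_def)

lemma apply_local_id:
  assumes "finite V" "supported V \<psi>" "\<And>u. u \<in> V \<Longrightarrow> A u = mat 1"
  shows "apply_local V A \<psi> = \<psi>"
  using assms by (auto simp: fun_eq_iff apply_local_diagonal mat_def supported_def)

definition inner_state :: "'v set \<Rightarrow> ('v set \<Rightarrow> complex) \<Rightarrow> ('v set \<Rightarrow> complex) \<Rightarrow> complex" where
  "inner_state V \<phi> \<psi> = (\<Sum>x\<in>Pow V. cnj (\<phi> x) * \<psi> x)"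

lemma inner_state_adjoint:
  "inner_state V \<phi> (apply_local V A \<psi>) = inner_state V (apply_local V (\<lambda>u. dagger (A u)) \<phi>) \<psi>"
proof -
  have eq: "tensor_entry V (\<lambda>u. dagger (A u)) x y = cnj (tensor_entry V A y x)" for x y
    by (simp add: tensor_entry_def dagger_def transpose_def)
  have "inner_state V \<phi> (apply_local V A \<psi>) =
      (\<Sum>y\<in>Pow V. \<Sum>x\<in>Pow V. cnj (\<phi> y) * tensor_entry V A y x * \<psi> x)"
    by (simp add: inner_state_def apply_local_def sum_distrib_left mult.assoc)
  also have "\<dots> = (\<Sum>x\<in>Pow V. \<Sum>y\<in>Pow V. cnj (\<phi> y) * tensor_entry V A y x * \<psi> x)"
    by (rule sum.swap)
  also have "\<dots> = inner_state V (apply_local V (\<lambda>u. dagger (A u)) \<phi>) \<psi>"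
    by (simp add: inner_state_def apply_local_def eq sum_distrib_left sum_distrib_right mult_ac)
  finally show ?thesis .
qed

lemma inner_state_unitary:
  assumes "finite V" "\<And>u. u \<in> V \<Longrightarrow> unitary (U u)" "supported V \<psi>"
  shows "inner_state V (apply_local V U \<phi>) (apply_local V U \<psi>) = inner_state V \<phi> \<psi>"
proof -
  have "inner_state V (apply_local V U \<phi>) (apply_local V U \<psi>) =
      inner_state V \<phi> (apply_local V (\<lambda>u. dagger (U u)) (apply_local V U \<psi>))"
    using inner_state_adjoint[of V \<phi> "\<lambda>u. dagger (U u)"] by simp
  also have "apply_local V (\<lambda>u. dagger (U u)) (apply_local V U \<psi>) = \<psi>"
    using assms by (simp add: apply_local_comp) (intro apply_local_id, auto simp: unitary_def)
  finally show ?thesis .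
qed

lemma cnj_inner_state: "cnj (inner_state V \<phi> \<psi>) = inner_state V \<psi> \<phi>"
  by (simp add: inner_state_def mult.commute)

lemma apply_local_scale:
  "apply_local V (\<lambda>u. mat (c u) ** A u) \<psi> = (\<lambda>x. (\<Prod>u\<in>V. c u) * apply_local V A \<psi> x)"
proof -
  have "(mat k ** B) $ i $ j = k * B $ i $ j" for k and B :: qubit_op and i j
    by (cases i) (simp_all add: qubit_simps)
  then have "tensor_entry V (\<lambda>u. mat (c u) ** A u) y x = (\<Prod>u\<in>V. c u) * tensor_entry V A y x" for x y
    by (simp add: tensor_entry_def prod.distrib)
  then show ?thesis by (simp add: apply_local_def fun_eq_iff sum_distrib_left mult.assoc)
qed

lemma apply_local_scalar:
  "apply_local V A (\<lambda>x. c * \<psi> x) = (\<lambda>x. c * apply_local V A \<psi> x)"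
  by (simp add: apply_local_def fun_eq_iff sum_distrib_left mult_ac)

subsection \<open>Signs\<close>

text \<open>The eigenvalue of the product of Z over \<open>b\<close> at the basis vector
  \<open>x\<close>; equivalently, the character of the group of finite sets under \<ominus> that
  belongs to a finite \<open>b\<close>.\<close>

definition parity_sign :: "'v set \<Rightarrow> 'v set \<Rightarrow> complex" where
  "parity_sign b x = (- 1) ^ card (b \<inter> x)"

lemma parity_sign_sdiff:
  assumes "finite b"
  shows "parity_sign b (x \<ominus> y) = parity_sign b x * parity_sign b y"
proof -
  have "card ((b \<inter> x) \<ominus> (b \<inter> y)) + 2 * card ((b \<inter> x) \<inter> (b \<inter> y)) = card (b \<inter> x) + card (b \<inter> y)"
    using assms by (intro card_sdiff_add) auto
  moreover have "(b \<inter> x) \<ominus> (b \<inter> y) = b \<inter> (x \<ominus> y)" by (auto simp: set_eq_iff)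
  ultimately have "(-1 :: complex) ^ (card (b \<inter> (x \<ominus> y)) + 2 * card ((b \<inter> x) \<inter> (b \<inter> y))) =
      (-1) ^ (card (b \<inter> x) + card (b \<inter> y))" by simp
  then show ?thesis by (simp add: parity_sign_def power_add)
qed

lemma parity_sign_commute: "parity_sign b x = parity_sign x b"
  by (simp add: parity_sign_def Int_commute)

lemma parity_sign_square [simp]: "parity_sign b x * parity_sign b x = 1"
  by (simp add: parity_sign_def flip: power_add)

lemma parity_sign_power2 [simp]: "parity_sign b x ^ 2 = 1"
  by (simp add: power2_eq_square)

lemma parity_sign_empty [simp]: "parity_sign b {} = 1"
  by (simp add: parity_sign_def)

lemma parity_sign_nonzero [simp]: "parity_sign b x \<noteq> 0"
  by (simp add: parity_sign_def)

lemma norm_parity_sign [simp]: "norm (parity_sign b x) = 1"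
  by (simp add: parity_sign_def norm_power)

lemma parity_sign_prod:
  assumes "finite V" "b \<subseteq> V"
  shows "parity_sign b x = (\<Prod>u\<in>V. if u \<in> b \<and> u \<in> x then - 1 else 1)"
proof -
  have "(\<Prod>u\<in>V. if u \<in> b \<and> u \<in> x then - 1 else 1 :: complex) = (\<Prod>u\<in>b \<inter> x. - 1)"
    using assms by (intro prod.mono_neutral_cong_right) auto
  then show ?thesis by (simp add: parity_sign_def)
qed

lemma sum_parity_sign:
  assumes "finite V" "t \<subseteq> V"
  shows "(\<Sum>b\<in>Pow V. parity_sign b t) = (if t = {} then 2 ^ card V else 0)"
proof -
  have "(\<Sum>b\<in>Pow V. parity_sign b t) = (\<Sum>b\<in>Pow V. \<Prod>u\<in>V. if u \<in> b \<and> u \<in> t then - 1 else 1)"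
    using assms by (intro sum.cong) (auto simp: parity_sign_prod)
  also have "\<dots> = (\<Prod>u\<in>V. 1 + (if u \<in> t then - 1 else 1))"
    using prod_sum_bool[OF assms(1), of "\<lambda>u b. if b \<and> u \<in> t then - 1 else 1"] by simp
  also have "\<dots> = (if t = {} then 2 ^ card V else 0)"
    using assms by (auto simp: prod_zero_iff)
  finally show ?thesis .
qed

subsection \<open>Pauli expectations and stabilizer states\<close>

definition xpart :: "'v set \<Rightarrow> ('v \<Rightarrow> pauli) \<Rightarrow> 'v set" where
  "xpart V s = {u \<in> V. fst (s u)}"

definition zpart :: "'v set \<Rightarrow> ('v \<Rightarrow> pauli) \<Rightarrow> 'v set" where
  "zpart V s = {u \<in> V. snd (s u)}"

abbreviation apply_pauli :: "'v set \<Rightarrow> ('v \<Rightarrow> pauli) \<Rightarrow> ('v set \<Rightarrow> complex) \<Rightarrow> 'v set \<Rightarrow> complex" where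
  "apply_pauli V s \<equiv> apply_local V (\<lambda>u. pauli_op (s u))"

definition expect :: "'v set \<Rightarrow> ('v set \<Rightarrow> complex) \<Rightarrow> ('v \<Rightarrow> pauli) \<Rightarrow> complex" where
  "expect V \<psi> s = inner_state V \<psi> (apply_pauli V s \<psi>)"

lemma xpart_subset: "xpart V s \<subseteq> V" and zpart_subset: "zpart V s \<subseteq> V"
  by (auto simp: xpart_def zpart_def)

lemma apply_pauli_eq:
  assumes V: "finite V"
  obtains c where "norm c = 1"
    "\<And>\<psi> y. y \<subseteq> V \<Longrightarrow> apply_pauli V s \<psi> y = c * parity_sign (zpart V s) y * \<psi> (y \<ominus> xpart V s)"
proof -
  define k where "k = (\<Prod>u\<in>V. if fst (s u) \<and> snd (s u) then \<i> else 1)"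
  \<comment> \<open>\<open>k\<close> collects one factor \<i> for each Y. The sign comes from
    evaluating the Z part at \<open>y\<close> instead of at the source
    \<open>y \<ominus> xpart V s\<close>.\<close>
  define c where "c = k * parity_sign (zpart V s) (xpart V s)"
  have "norm k = 1" by (simp add: k_def prod_norm[symmetric] if_distrib cong: if_cong)
  then have "norm c = 1" by (simp add: c_def norm_mult)
  moreover have "apply_pauli V s \<psi> y = c * parity_sign (zpart V s) y * \<psi> (y \<ominus> xpart V s)"
    if y: "y \<subseteq> V" for \<psi> y
  proof -
    let ?x = "y \<ominus> xpart V s"
    have fin: "finite (zpart V s)" using V zpart_subset finite_subset by metis
    have "tensor_entry V (\<lambda>u. pauli_op (s u)) y x = (if x = ?x then k * parity_sign (zpart V s) ?x else 0)"
      if x: "x \<subseteq> V" for x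
    proof (cases "x = ?x")
      case True
      have "tensor_entry V (\<lambda>u. pauli_op (s u)) y x =
          (\<Prod>u\<in>V. (if fst (s u) \<and> snd (s u) then \<i> else 1) *
            (if u \<in> zpart V s \<and> u \<in> ?x then - 1 else 1))"
        unfolding tensor_entry_def
        by (intro prod.cong) (auto simp: True pauli_op_def xpart_def zpart_def)
      also have "\<dots> = k * parity_sign (zpart V s) ?x"
        by (simp only: prod.distrib k_def parity_sign_prod[OF V zpart_subset])
      finally show ?thesis using True by simp
    next
      case False
      then obtain u where u: "(u \<in> x) \<noteq> (u \<in> ?x)" by blast
      then have "u \<in> V" using x y xpart_subset by (auto simp: xpart_def)
      moreover have "pauli_op (s u) $ (u \<in> y) $ (u \<in> x) = 0"
        using u \<open>u \<in> V\<close> by (auto simp: pauli_op_def xpart_def)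
      ultimately show ?thesis using V False by (auto simp: tensor_entry_def)
    qed
    then have "apply_pauli V s \<psi> y =
        (\<Sum>x\<in>Pow V. if x = ?x then k * parity_sign (zpart V s) ?x * \<psi> ?x else 0)"
      using y by (auto simp: apply_local_def intro!: sum.cong)
    also have "\<dots> = k * parity_sign (zpart V s) ?x * \<psi> ?x"
      using V sdiff_subset[OF y xpart_subset] by simp
    finally show ?thesis by (simp add: c_def parity_sign_sdiff[OF fin])
  qed
  ultimately show thesis using that by blast
qed

text \<open>The equality case of the Cauchy--Schwarz inequality: the squared distance between the
  Pauli image and the multiple of \<psi> expands to one minus the squared modulus of the
  expectation.\<close>

lemma unitary_expect_1:
  assumes "finite V" "supported V \<psi>" "inner_state V \<psi> \<psi> = 1" "norm (expect V \<psi> s) = 1"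
  shows "apply_pauli V s \<psi> = (\<lambda>x. expect V \<psi> s * \<psi> x)"
proof
  fix x
  let ?c = "expect V \<psi> s" and ?\<phi> = "apply_pauli V s \<psi>"
  have "cnj (z - c * w) * (z - c * w) =
      cnj z * z - c * (cnj z * w) - cnj c * (cnj w * z) + cnj c * c * (cnj w * w)" for z w c
    by (simp add: algebra_simps)
  then have "(\<Sum>x\<in>Pow V. cnj (?\<phi> x - ?c * \<psi> x) * (?\<phi> x - ?c * \<psi> x)) =
      inner_state V ?\<phi> ?\<phi> - ?c * inner_state V ?\<phi> \<psi> - cnj ?c * inner_state V \<psi> ?\<phi> +
      cnj ?c * ?c * inner_state V \<psi> \<psi>"
    by (simp only: inner_state_def sum.distrib sum_subtractf sum_distrib_left)
  also have "inner_state V ?\<phi> ?\<phi> = 1"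
    using inner_state_unitary[OF assms(1) unitary_pauli_op assms(2)] assms(3) by simp
  also have "inner_state V ?\<phi> \<psi> = cnj ?c"
    by (simp add: expect_def cnj_inner_state)
  also have "inner_state V \<psi> ?\<phi> = ?c" by (simp add: expect_def)
  also have "cnj ?c * ?c = 1"
    using complex_norm_square[of ?c] assms(4) by (simp add: mult.commute)
  finally have "(\<Sum>x\<in>Pow V. cnj (?\<phi> x - ?c * \<psi> x) * (?\<phi> x - ?c * \<psi> x)) = 0"
    using assms(3) \<open>cnj ?c * ?c = 1\<close> by (simp add: mult.commute)
  then have "complex_of_real (\<Sum>x\<in>Pow V. (norm (?\<phi> x - ?c * \<psi> x))\<^sup>2) = 0"
  proof -
    have "cnj z * z = complex_of_real ((norm z)\<^sup>2)" for z
      by (simp only: complex_norm_square mult.commute)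
    with \<open>_ = 0\<close> show ?thesis by (simp only: of_real_sum)
  qed
  then have "(\<Sum>x\<in>Pow V. (norm (?\<phi> x - ?c * \<psi> x))\<^sup>2) = 0"
    by (simp only: of_real_eq_0_iff)
  then have "\<forall>x\<in>Pow V. (norm (?\<phi> x - ?c * \<psi> x))\<^sup>2 = 0"
    using assms(1) by (subst (asm) sum_nonneg_eq_0_iff) auto
  then show "?\<phi> x = ?c * \<psi> x"
    using assms(2) supported_apply_local[of V "\<lambda>u. pauli_op (s u)" \<psi>]
    by (cases "x \<subseteq> V") (auto simp: supported_def)
qed

text \<open>Phrased through expectations, which behave well under local operators. The stabilizer
  group is recovered from it: modulus 1 forces an eigenvector by \<open>unitary_expect_1\<close>,
  and eigenvectors give closure under products in \<open>expect_padd\<close>.\<close>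

definition stabilizer_state :: "'v set \<Rightarrow> ('v set \<Rightarrow> complex) \<Rightarrow> bool" where
  "stabilizer_state V \<psi> \<longleftrightarrow> finite V \<and> supported V \<psi> \<and> inner_state V \<psi> \<psi> = 1 \<and>
    (\<forall>s. norm (expect V \<psi> s) = 0 \<or> norm (expect V \<psi> s) = 1)"

lemma stabilizer_stateD:
  assumes "stabilizer_state V \<psi>"
  shows "finite V" "supported V \<psi>" "inner_state V \<psi> \<psi> = 1"
    "expect V \<psi> s \<noteq> 0 \<Longrightarrow> norm (expect V \<psi> s) = 1"
  using assms norm_eq_zero unfolding stabilizer_state_def by blast+

lemma inner_state_scalar: "inner_state V \<phi> (\<lambda>x. c * \<psi> x) = c * inner_state V \<phi> \<psi>"
  by (simp add: inner_state_def sum_distrib_left mult_ac)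

lemma expect_padd:
  assumes "stabilizer_state V \<psi>" "expect V \<psi> s \<noteq> 0" "expect V \<psi> t \<noteq> 0"
  shows "expect V \<psi> (\<lambda>u. padd (s u) (t u)) \<noteq> 0"
proof -
  note \<psi> = stabilizer_stateD[OF assms(1)]
  obtain c where c: "\<And>u. norm (c u) = 1"
    "\<And>u. pauli_op (s u) ** pauli_op (t u) = mat (c u) ** pauli_op (padd (s u) (t u))"
  proof -
    have "\<forall>u. \<exists>c. norm c = 1 \<and> pauli_op (s u) ** pauli_op (t u) = mat c ** pauli_op (padd (s u) (t u))"
      using pauli_op_mult by blast
    then show thesis using that by metis
  qed
  have "apply_pauli V s (apply_pauli V t \<psi>) =
      (\<lambda>x. (\<Prod>u\<in>V. c u) * apply_pauli V (\<lambda>u. padd (s u) (t u)) \<psi> x)"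
    by (simp add: apply_local_comp \<psi>(1) c(2) apply_local_scale)
  moreover have "apply_pauli V s (apply_pauli V t \<psi>) = (\<lambda>x. expect V \<psi> t * (expect V \<psi> s * \<psi> x))"
    using unitary_expect_1[OF \<psi>(1-3)] \<psi>(4) assms(2,3) by (simp add: apply_local_scalar)
  ultimately have "inner_state V \<psi> (\<lambda>x. expect V \<psi> t * expect V \<psi> s * \<psi> x) =
      inner_state V \<psi> (\<lambda>x. (\<Prod>u\<in>V. c u) * apply_pauli V (\<lambda>u. padd (s u) (t u)) \<psi> x)"
    by (simp add: mult.assoc)
  then have "expect V \<psi> t * expect V \<psi> s * inner_state V \<psi> \<psi> =
      (\<Prod>u\<in>V. c u) * expect V \<psi> (\<lambda>u. padd (s u) (t u))"
    unfolding inner_state_scalar by (simp only: expect_def)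
  then show ?thesis using \<psi>(3) assms(2,3) by auto
qed

text \<open>The eigenvector equation of a stabilizer, read in amplitudes. It is the source of the
  characters \<omega> in the quadratic condition on diagonal phases.\<close>

lemma stabilizer_shift:
  assumes "stabilizer_state V \<psi>" "expect V \<psi> s \<noteq> 0"
  obtains c where "c \<noteq> 0"
    "\<And>y. y \<subseteq> V \<Longrightarrow> \<psi> (y \<ominus> xpart V s) = c * parity_sign (zpart V s) y * \<psi> y"
proof -
  note \<psi> = stabilizer_stateD[OF assms(1)]
  obtain d where d: "norm d = 1" "\<And>\<psi> y. y \<subseteq> V \<Longrightarrow>
      apply_pauli V s \<psi> y = d * parity_sign (zpart V s) y * \<psi> (y \<ominus> xpart V s)"
    using apply_pauli_eq[OF \<psi>(1), of s] by metis
  have "\<psi> (y \<ominus> xpart V s) = expect V \<psi> s / d * parity_sign (zpart V s) y * \<psi> y" if "y \<subseteq> V" for y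
  proof -
    have "d * parity_sign (zpart V s) y * \<psi> (y \<ominus> xpart V s) = expect V \<psi> s * \<psi> y"
      using d(2)[OF that, of \<psi>] unitary_expect_1[OF \<psi>(1-3)] \<psi>(4) assms(2) by simp
    then have "d * (parity_sign (zpart V s) y * parity_sign (zpart V s) y) * \<psi> (y \<ominus> xpart V s) =
        expect V \<psi> s * parity_sign (zpart V s) y * \<psi> y"
      by (metis (no_types, opaque_lifting) mult.assoc mult.commute)
    moreover have "d \<noteq> 0" using d(1) by auto
    ultimately show ?thesis by (simp add: field_simps)
  qed
  moreover have "expect V \<psi> s / d \<noteq> 0" using d(1) assms(2) by auto
  ultimately show thesis using that by blast
qed

text \<open>
  By Fourier inversion, \<open>\<psi> x * cnj (\<psi> y)\<close> is a combination of the expectations of the Pauli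
  operators that map the basis vector \<open>y\<close> to \<open>x\<close> up to a phase.
\<close>

lemma stabilizer_connecting:
  assumes "stabilizer_state V \<psi>" "\<psi> x \<noteq> 0" "\<psi> y \<noteq> 0"
  obtains s where "expect V \<psi> s \<noteq> 0" "xpart V s = x \<ominus> y"
proof (rule ccontr)
  assume "\<not> thesis"
  with that have zero: "expect V \<psi> s = 0" if "xpart V s = x \<ominus> y" for s using that by blast
  note \<psi> = stabilizer_stateD[OF assms(1)]
  have xy: "x \<subseteq> V" "y \<subseteq> V" using \<psi>(2) assms by (auto simp: supported_def)
  define a where "a = x \<ominus> y"
  have a: "a \<subseteq> V" using xy by (simp add: a_def sdiff_subset)
  have sum0: "(\<Sum>z\<in>Pow V. parity_sign b z * (cnj (\<psi> z) * \<psi> (z \<ominus> a))) = 0" if b: "b \<subseteq> V" for b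
  proof -
    define s where "s u = (u \<in> a, u \<in> b)" for u
    have s: "xpart V s = a" "zpart V s = b" using a b by (auto simp: xpart_def zpart_def s_def)
    obtain d where d: "norm d = 1" "\<And>\<psi> y. y \<subseteq> V \<Longrightarrow>
        apply_pauli V s \<psi> y = d * parity_sign b y * \<psi> (y \<ominus> a)"
      using apply_pauli_eq[OF \<psi>(1), of s] s by metis
    have "expect V \<psi> s = (\<Sum>z\<in>Pow V. d * (parity_sign b z * (cnj (\<psi> z) * \<psi> (z \<ominus> a))))"
      unfolding expect_def inner_state_def by (intro sum.cong) (simp_all add: d(2) mult_ac)
    also have "\<dots> = d * (\<Sum>z\<in>Pow V. parity_sign b z * (cnj (\<psi> z) * \<psi> (z \<ominus> a)))"
      by (simp only: sum_distrib_left)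
    finally show ?thesis using zero[of s] s d(1) by (auto simp: a_def)
  qed
  \<comment> \<open>Weighting the vanishing sums with the character at \<open>x\<close> and summing
    over \<open>b\<close> isolates the term \<open>z = x\<close>, which is a nonzero multiple of
    \<open>cnj (\<psi> x) * \<psi> y\<close>.\<close>
  have "(\<Sum>b\<in>Pow V. parity_sign b x * (\<Sum>z\<in>Pow V. parity_sign b z * (cnj (\<psi> z) * \<psi> (z \<ominus> a)))) =
      (\<Sum>b\<in>Pow V. \<Sum>z\<in>Pow V. parity_sign b (z \<ominus> x) * (cnj (\<psi> z) * \<psi> (z \<ominus> a)))"
  proof (rule sum.cong)
    fix b assume "b \<in> Pow V"
    then have "finite b" using \<psi>(1) finite_subset by auto
    then show "parity_sign b x * (\<Sum>z\<in>Pow V. parity_sign b z * (cnj (\<psi> z) * \<psi> (z \<ominus> a))) =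
        (\<Sum>z\<in>Pow V. parity_sign b (z \<ominus> x) * (cnj (\<psi> z) * \<psi> (z \<ominus> a)))"
      by (simp add: parity_sign_sdiff sum_distrib_left mult_ac)
  qed simp
  also have "\<dots> = (\<Sum>z\<in>Pow V. (\<Sum>b\<in>Pow V. parity_sign b (z \<ominus> x)) * (cnj (\<psi> z) * \<psi> (z \<ominus> a)))"
    by (subst sum.swap) (simp add: sum_distrib_right)
  also have "\<dots> = (\<Sum>z\<in>Pow V. if z = x then 2 ^ card V * (cnj (\<psi> x) * \<psi> (x \<ominus> a)) else 0)"
  proof (rule sum.cong)
    fix z assume "z \<in> Pow V"
    then have "z \<ominus> x \<subseteq> V" using xy sdiff_subset by auto
    moreover have "z \<ominus> x = {} \<longleftrightarrow> z = x" by (metis sdiff_cancel(2) sdiff_empty(2) sdiff_self)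
    ultimately show "(\<Sum>b\<in>Pow V. parity_sign b (z \<ominus> x)) * (cnj (\<psi> z) * \<psi> (z \<ominus> a)) =
        (if z = x then 2 ^ card V * (cnj (\<psi> x) * \<psi> (x \<ominus> a)) else 0)"
      using sum_parity_sign[OF \<psi>(1)] by simp
  qed simp
  also have "\<dots> = 2 ^ card V * (cnj (\<psi> x) * \<psi> y)"
    using xy \<psi>(1) by (simp add: a_def)
  finally show False using sum0 assms by simp
qed

section \<open>Clifford operators preserve stabilizer states\<close>

lemma sqrt2_sq: "complex_of_real (sqrt 2) * complex_of_real (sqrt 2) = 2"
  by (simp flip: of_real_mult)

text \<open>On indices, the Hadamard gate exchanges the two components and the phase gate adds the
  first to the second; scalars act trivially and products compose.\<close>

lemma clifford_conj_pauli:
  assumes "clifford C"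
  shows "\<exists>b c. norm c = 1 \<and> dagger C ** pauli_op a ** C = mat c ** pauli_op b"
  using assms
proof (induction arbitrary: a rule: clifford.induct)
  case hadamard
  have "dagger hadamard ** pauli_op a ** hadamard =
      mat (if fst a \<and> snd a then - 1 else 1) ** pauli_op (snd a, fst a)"
    by (cases a) (auto simp: qubit_simps hadamard_def sqrt2_sq field_simps)
  then show ?case by (intro exI[of _ "(snd a, fst a)"] exI[of _ "if fst a \<and> snd a then - 1 else 1"]) simp
next
  case phase_gate
  have "dagger phase_gate ** pauli_op a ** phase_gate =
      mat (if fst a \<and> \<not> snd a then - 1 else 1) ** pauli_op (fst a, snd a \<noteq> fst a)"
    by (cases a) (auto simp: qubit_simps phase_gate_def)
  then show ?case
    by (intro exI[of _ "(fst a, snd a \<noteq> fst a)"] exI[of _ "if fst a \<and> \<not> snd a then - 1 else 1"]) simp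
next
  case (global_phase c)
  have "cnj c * c = 1" using complex_norm_square[of c] global_phase by (simp add: mult.commute)
  then have "dagger (mat c) ** pauli_op a ** mat c = mat 1 ** pauli_op a"
    by (cases a) (auto simp: qubit_simps algebra_simps)
  then show ?case by (metis norm_one)
next
  case (mult A B)
  obtain b c where 1: "norm c = 1" "dagger A ** pauli_op a ** A = mat c ** pauli_op b"
    using mult.IH(1) by blast
  obtain b' c' where 2: "norm c' = 1" "dagger B ** pauli_op b ** B = mat c' ** pauli_op b'"
    using mult.IH(2) by blast
  have comm: "M ** mat c = mat c ** M" for M :: qubit_op
    by (simp add: qubit_simps mult.commute)
  have "dagger (A ** B) ** pauli_op a ** (A ** B) = dagger B ** (dagger A ** pauli_op a ** A) ** B"
    by (simp add: dagger_mult matrix_mul_assoc)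
  also have "\<dots> = mat c ** (dagger B ** pauli_op b ** B)"
    unfolding 1 by (simp add: matrix_mul_assoc comm)
  also have "\<dots> = mat (c * c') ** pauli_op b'"
    unfolding 2 by (auto simp: qubit_simps)
  finally show ?case using 1(1) 2(1) by (metis mult.right_neutral norm_mult)
qed

lemma stabilizer_state_clifford:
  assumes "stabilizer_state V \<psi>" "\<And>u. u \<in> V \<Longrightarrow> clifford (C u)"
  shows "stabilizer_state V (apply_local V C \<psi>)"
proof -
  note \<psi> = stabilizer_stateD[OF assms(1)]
  have "norm (expect V (apply_local V C \<psi>) s) = 0 \<or> norm (expect V (apply_local V C \<psi>) s) = 1" for s
  proof -
    have "\<forall>u\<in>V. \<exists>b c. norm c = 1 \<and> dagger (C u) ** pauli_op (s u) ** C u = mat c ** pauli_op b"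
      using clifford_conj_pauli assms(2) by blast
    then obtain t c where tc: "\<And>u. u \<in> V \<Longrightarrow> norm (c u) = 1"
      "\<And>u. u \<in> V \<Longrightarrow> dagger (C u) ** pauli_op (s u) ** C u = mat (c u) ** pauli_op (t u)"
      by metis
    have "expect V (apply_local V C \<psi>) s =
        inner_state V \<psi> (apply_local V (\<lambda>u. dagger (C u) ** pauli_op (s u) ** C u) \<psi>)"
      unfolding expect_def using inner_state_adjoint[of V \<psi> "\<lambda>u. dagger (C u)" "apply_pauli V s (apply_local V C \<psi>)"]
      by (simp add: apply_local_comp \<psi>(1) matrix_mul_assoc)
    also have "apply_local V (\<lambda>u. dagger (C u) ** pauli_op (s u) ** C u) \<psi> =
        (\<lambda>x. (\<Prod>u\<in>V. c u) * apply_pauli V t \<psi> x)"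
      unfolding apply_local_scale[symmetric] using tc(2) by (intro fun_cong[OF apply_local_cong]) blast
    also have "inner_state V \<psi> \<dots> = (\<Prod>u\<in>V. c u) * expect V \<psi> t"
      by (simp add: expect_def inner_state_scalar)
    finally have "norm (expect V (apply_local V C \<psi>) s) = norm (expect V \<psi> t)"
      using tc(1) by (simp add: norm_mult prod_norm[symmetric])
    then show ?thesis using \<psi>(4)[of t] by (metis norm_zero)
  qed
  then show ?thesis
    using \<psi> inner_state_unitary[of V C \<psi> \<psi>] assms(2) clifford_unitary
    by (simp add: stabilizer_state_def)
qed

subsection \<open>Graph states\<close>

definition adj :: "'v set set \<Rightarrow> 'v \<Rightarrow> 'v set" where
  "adj E v = {w. {v, w} \<in> E}"

lemma simple_graph_finite_edges: "simple_graph V E \<Longrightarrow> finite E"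
  by (rule finite_subset[of E "Pow V"]) (auto simp: simple_graph_def)

lemma adj_subset: "simple_graph V E \<Longrightarrow> adj E v \<subseteq> V"
  by (auto simp: simple_graph_def adj_def)

lemma not_in_adj: "simple_graph V E \<Longrightarrow> v \<notin> adj E v"
  by (auto simp: simple_graph_def adj_def)

lemma graph_state_insert:
  assumes G: "simple_graph V E" and v: "v \<in> V" "v \<notin> y" and y: "y \<subseteq> V"
  shows "graph_state V E (insert v y) = parity_sign (adj E v) y * graph_state V E y"
proof -
  have fin: "finite E" by (rule simple_graph_finite_edges[OF G])
  have "induced_edges E (insert v y) = induced_edges E y \<union> (\<lambda>w. {v, w}) ` (adj E v \<inter> y)"
  proof (intro equalityI subsetI)
    fix e assume e: "e \<in> induced_edges E (insert v y)"
    then have eE: "e \<in> E" "e \<subseteq> insert v y" "card e = 2"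
      using G by (auto simp: induced_edges_def simple_graph_def)
    show "e \<in> induced_edges E y \<union> (\<lambda>w. {v, w}) ` (adj E v \<inter> y)"
    proof (cases "v \<in> e")
      case False
      then show ?thesis using eE by (auto simp: induced_edges_def)
    next
      case True
      then obtain w where "e = {v, w}" "w \<noteq> v"
        using eE(3) by (metis card_2_iff doubleton_eq_iff insert_iff singletonD)
      then show ?thesis using eE by (auto simp: adj_def)
    qed
  qed (auto simp: induced_edges_def adj_def)
  moreover have "induced_edges E y \<inter> (\<lambda>w. {v, w}) ` (adj E v \<inter> y) = {}"
    using v by (auto simp: induced_edges_def)
  moreover have "finite (adj E v \<inter> y)" "finite (induced_edges E y)"
    using fin G y finite_subset by (auto simp: simple_graph_def induced_edges_def)
  moreover have "card ((\<lambda>w. {v, w}) ` (adj E v \<inter> y)) = card (adj E v \<inter> y)"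
    by (intro card_image) (auto simp: inj_on_def doubleton_eq_iff)
  ultimately have "card (induced_edges E (insert v y)) = card (induced_edges E y) + card (adj E v \<inter> y)"
    by (simp add: card_Un_disjoint)
  then show ?thesis
    using v y by (simp add: graph_state_def parity_sign_def power_add)
qed

text \<open>The amplitude form of the vertex stabilizer, X at \<open>v\<close> and Z on its
  neighbours. As \<open>v\<close> is not its own neighbour, the sign does not depend on whether
  \<open>v\<close> is in \<open>y\<close>, and one formula serves both directions.\<close>

lemma graph_state_flip:
  assumes G: "simple_graph V E" and v: "v \<in> V" and y: "y \<subseteq> V"
  shows "graph_state V E (y \<ominus> {v}) = parity_sign (adj E v) y * graph_state V E y"
proof (cases "v \<in> y")
  case False
  then have "y \<ominus> {v} = insert v y" by (auto simp: set_eq_iff)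
  then show ?thesis using graph_state_insert[OF G v False y] by simp
next
  case True
  let ?z = "y - {v}"
  have z: "y \<ominus> {v} = ?z" "insert v ?z = y" using True by (auto simp: set_eq_iff)
  have "adj E v \<inter> ?z = adj E v \<inter> y" using not_in_adj[OF G, of v] by auto
  then have "parity_sign (adj E v) ?z = parity_sign (adj E v) y" by (simp add: parity_sign_def)
  moreover have "graph_state V E y = parity_sign (adj E v) ?z * graph_state V E ?z"
    using graph_state_insert[OF G v, of ?z] y z by auto
  ultimately show ?thesis using z by (simp flip: mult.assoc)
qed

text \<open>Products of vertex stabilizers: \<open>b\<close> accumulates the symmetric difference of
  the neighbourhoods of the members of \<open>a\<close>, and \<open>k\<close> the signs from
  reordering.\<close>

lemma graph_state_shift:
  assumes G: "simple_graph V E" and a: "a \<subseteq> V"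
  shows "\<exists>b k. b \<subseteq> V \<and> norm k = 1 \<and>
    (\<forall>y\<subseteq>V. graph_state V E (y \<ominus> a) = k * parity_sign b y * graph_state V E y)"
proof -
  have V: "finite V" using G by (simp add: simple_graph_def)
  then have "finite a" using a finite_subset by blast
  then show ?thesis using a
  proof (induction a)
    case empty
    show ?case by (intro exI[of _ "{}"] exI[of _ 1]) (simp add: parity_sign_def)
  next
    case (insert v a)
    then obtain b k where b: "b \<subseteq> V" "norm k = 1"
      "\<And>y. y \<subseteq> V \<Longrightarrow> graph_state V E (y \<ominus> a) = k * parity_sign b y * graph_state V E y"
      by auto
    have "graph_state V E (y \<ominus> insert v a) =
        k * parity_sign (adj E v) a * parity_sign (b \<ominus> adj E v) y * graph_state V E y" if y: "y \<subseteq> V" for y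
    proof -
      have "finite y" "finite (adj E v)" using y V adj_subset[OF G] finite_subset by blast+
      moreover have "y \<ominus> insert v a = (y \<ominus> a) \<ominus> {v}" using insert by (auto simp: set_eq_iff)
      moreover have "graph_state V E ((y \<ominus> a) \<ominus> {v}) =
          parity_sign (adj E v) (y \<ominus> a) * graph_state V E (y \<ominus> a)"
        using graph_state_flip[OF G, of v "y \<ominus> a"] insert.prems y sdiff_subset by blast
      moreover have "parity_sign (b \<ominus> adj E v) y = parity_sign b y * parity_sign (adj E v) y"
        using parity_sign_sdiff[OF \<open>finite y\<close>] by (simp add: parity_sign_commute)
      ultimately show ?thesis using b(3)[OF y] by (simp add: parity_sign_sdiff)
    qed
    moreover have "b \<ominus> adj E v \<subseteq> V" using b adj_subset[OF G] by (intro sdiff_subset)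
    moreover have "norm (k * parity_sign (adj E v) a) = 1" using b by (simp add: norm_mult)
    ultimately show ?case by blast
  qed
qed

lemma cnj_graph_state: "y \<subseteq> V \<Longrightarrow> cnj (graph_state V E y) * graph_state V E y = 1 / 2 ^ card V"
proof -
  assume "y \<subseteq> V"
  have "(complex_of_real (sqrt (2 ^ card V)))\<^sup>2 = 2 ^ card V"
  proof -
    have "(complex_of_real (sqrt (2 ^ card V)))\<^sup>2 = complex_of_real ((sqrt (2 ^ card V))\<^sup>2)"
      by (simp only: of_real_power)
    then show ?thesis by simp
  qed
  then show ?thesis
    using \<open>y \<subseteq> V\<close> by (simp add: graph_state_def power2_eq_square flip: power_add)
qed

text \<open>After shifting, the expectation is the average of the character of
  \<open>zpart V s \<ominus> b\<close>. So each X part is completed to a stabilizer by exactly one Z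
  part.\<close>

lemma norm_expect_graph_state:
  assumes G: "simple_graph V E" and b: "b \<subseteq> V" "norm k = 1"
    and shift: "\<And>y. y \<subseteq> V \<Longrightarrow> graph_state V E (y \<ominus> xpart V s) = k * parity_sign b y * graph_state V E y"
  shows "norm (expect V (graph_state V E) s) = (if zpart V s = b then 1 else 0)"
proof -
  let ?g = "graph_state V E"
  have V: "finite V" using G by (simp add: simple_graph_def)
  obtain d where d: "norm d = 1" "\<And>\<psi> y. y \<subseteq> V \<Longrightarrow>
      apply_pauli V s \<psi> y = d * parity_sign (zpart V s) y * \<psi> (y \<ominus> xpart V s)"
    using apply_pauli_eq[OF V, of s] by metis
  have summand: "cnj (?g y) * apply_pauli V s ?g y = d * k / 2 ^ card V * parity_sign y (zpart V s \<ominus> b)"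
    if y: "y \<subseteq> V" for y
  proof -
    have fin: "finite y" using y V finite_subset by blast
    have "cnj (?g y) * apply_pauli V s ?g y =
        d * k * (parity_sign (zpart V s) y * parity_sign b y) * (cnj (?g y) * ?g y)"
      by (simp add: d(2)[OF y] shift[OF y] mult_ac)
    also have "parity_sign (zpart V s) y * parity_sign b y = parity_sign y (zpart V s \<ominus> b)"
      by (simp add: parity_sign_sdiff[OF fin] parity_sign_commute[of _ y])
    finally show ?thesis by (simp add: cnj_graph_state[OF y])
  qed
  have sub: "zpart V s \<ominus> b \<subseteq> V" using zpart_subset b by (intro sdiff_subset)
  have iff: "zpart V s \<ominus> b = {} \<longleftrightarrow> zpart V s = b"
    by (metis sdiff_cancel(2) sdiff_empty(2) sdiff_self)
  have "expect V ?g s = (\<Sum>y\<in>Pow V. d * k / 2 ^ card V * parity_sign y (zpart V s \<ominus> b))"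
    unfolding expect_def inner_state_def by (intro sum.cong) (simp_all add: summand)
  also have "\<dots> = d * k / 2 ^ card V * (if zpart V s = b then 2 ^ card V else 0)"
    unfolding sum_distrib_left[symmetric] sum_parity_sign[OF V sub] iff by simp
  finally show ?thesis using d(1) b(2) by (simp add: norm_mult norm_divide norm_power)
qed

lemma stabilizer_state_graph_state:
  assumes G: "simple_graph V E"
  shows "stabilizer_state V (graph_state V E)"
proof -
  have V: "finite V" using G by (simp add: simple_graph_def)
  have "inner_state V (graph_state V E) (graph_state V E) = (\<Sum>y\<in>Pow V. 1 / 2 ^ card V)"
    unfolding inner_state_def by (intro sum.cong) (simp_all add: cnj_graph_state)
  also have "\<dots> = 1" using V by (simp add: card_Pow)
  finally have "inner_state V (graph_state V E) (graph_state V E) = 1" .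
  moreover have "norm (expect V (graph_state V E) s) = 0 \<or> norm (expect V (graph_state V E) s) = 1" for s
    using graph_state_shift[OF G xpart_subset[of V s]] norm_expect_graph_state[OF G, of _ _ s] by fastforce
  ultimately show ?thesis using V by (simp add: stabilizer_state_def)
qed

lemma expect_graph_state_inj:
  assumes G: "simple_graph V E" and "expect V (graph_state V E) s \<noteq> 0"
    "expect V (graph_state V E) t \<noteq> 0" and x: "xpart V s = xpart V t" and u: "u \<in> V"
  shows "s u = t u"
proof -
  obtain b k where b: "b \<subseteq> V" "norm k = 1"
      "\<And>y. y \<subseteq> V \<Longrightarrow> graph_state V E (y \<ominus> xpart V s) = k * parity_sign b y * graph_state V E y"
    using graph_state_shift[OF G xpart_subset[of V s]] by blast
  have "zpart V s = b" "zpart V t = b"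
    using norm_expect_graph_state[OF G b(1,2), of s] norm_expect_graph_state[OF G b(1,2), of t] b(3) x
      assms(2,3) by (auto split: if_splits)
  then have "zpart V s = zpart V t" by simp
  with x u show ?thesis by (auto simp: xpart_def zpart_def set_eq_iff intro: prod_eqI)
qed

lemma expect_graph_state_vertex:
  assumes G: "simple_graph V E" and v: "v \<in> V" and x: "xpart V s = {v}"
  shows "expect V (graph_state V E) s \<noteq> 0 \<longleftrightarrow> zpart V s = adj E v"
  using norm_expect_graph_state[OF G adj_subset[OF G, of v], of 1 s] graph_state_flip[OF G v] x
  by (auto split: if_splits)

subsection \<open>Pauli expectations under local unitaries\<close>

text \<open>The default \<open>pI\<close> gives each Pauli product supported on \<open>W\<close> a
  single representative and makes the set finite over any vertex type.\<close>

definition paulis :: "'v set \<Rightarrow> ('v \<Rightarrow> pauli) set" where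
  "paulis W = {s. \<forall>u. u \<notin> W \<longrightarrow> s u = pI}"

lemma paulis_empty [simp]: "paulis {} = {\<lambda>_. pI}"
  by (auto simp: paulis_def)

lemma paulis_mono: "W \<subseteq> W' \<Longrightarrow> paulis W \<subseteq> paulis W'"
  by (auto simp: paulis_def)

lemma bij_betw_paulis_insert:
  assumes "u \<notin> W"
  shows "bij_betw (\<lambda>(s, a). s(u := a)) (paulis W \<times> UNIV) (paulis (insert u W))"
proof (rule bij_betw_byWitness[where f' = "\<lambda>s. (s(u := pI), s u)"])
  show "\<forall>p\<in>paulis W \<times> UNIV. ((case p of (s, a) \<Rightarrow> s(u := a))(u := pI), (case p of (s, a) \<Rightarrow> s(u := a)) u) = p"
    using assms by (auto simp: paulis_def fun_eq_iff)
qed (auto simp: paulis_def)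

lemma finite_paulis: "finite W \<Longrightarrow> finite (paulis W)"
proof (induction W rule: finite_induct)
  case (insert u W)
  then show ?case using bij_betw_finite[OF bij_betw_paulis_insert[of u W]] by simp
qed simp

lemma sum_paulis_insert:
  fixes h :: "('v \<Rightarrow> pauli) \<Rightarrow> complex"
  assumes "u \<notin> W"
  shows "(\<Sum>s\<in>paulis (insert u W). h s) = (\<Sum>s\<in>paulis W. \<Sum>a\<in>UNIV. h (s(u := a)))"
  using sum.reindex_bij_betw[OF bij_betw_paulis_insert[OF assms], of h]
  by (simp add: sum.cartesian_product case_prod_unfold)

lemma prod_sum_paulis:
  fixes f :: "'v \<Rightarrow> pauli \<Rightarrow> complex"
  assumes "finite W"
  shows "(\<Sum>s\<in>paulis W. \<Prod>u\<in>W. f u (s u)) = (\<Prod>u\<in>W. \<Sum>a\<in>UNIV. f u a)"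
  using assms
proof (induction W rule: finite_induct)
  case (insert u W)
  have "(\<Sum>s\<in>paulis (insert u W). \<Prod>w\<in>insert u W. f w (s w)) =
      (\<Sum>s\<in>paulis W. \<Sum>a\<in>UNIV. f u a * (\<Prod>w\<in>W. f w (s w)))"
  proof -
    have "(\<Prod>w\<in>W. f w ((s(u := a)) w)) = (\<Prod>w\<in>W. f w (s w))" for s :: "'v \<Rightarrow> pauli" and a
      using insert by (intro prod.cong) auto
    then show ?thesis using insert by (simp add: sum_paulis_insert del: fun_upd_apply) simp
  qed
  also have "\<dots> = (\<Sum>a\<in>UNIV. f u a) * (\<Sum>s\<in>paulis W. \<Prod>w\<in>W. f w (s w))"
    by (simp add: sum_product sum.swap[of _ "paulis W"])
  finally show ?case using insert by simp
qed simp

lemma apply_local_expansion: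
  assumes V: "finite V"
    and A: "\<And>u i j. u \<in> V \<Longrightarrow> A u $ i $ j = (\<Sum>a\<in>UNIV. r u a * pauli_op a $ i $ j)"
  shows "inner_state V \<phi> (apply_local V A \<psi>) =
    (\<Sum>t\<in>paulis V. (\<Prod>u\<in>V. r u (t u)) * inner_state V \<phi> (apply_pauli V t \<psi>))"
proof -
  have tensor: "tensor_entry V A y x =
      (\<Sum>t\<in>paulis V. (\<Prod>u\<in>V. r u (t u)) * tensor_entry V (\<lambda>u. pauli_op (t u)) y x)" for x y
    using prod_sum_paulis[OF V, of "\<lambda>u a. r u a * pauli_op a $ (u \<in> y) $ (u \<in> x)"] A
    by (simp add: tensor_entry_def prod.distrib)
  have "inner_state V \<phi> (apply_local V A \<psi>) = (\<Sum>y\<in>Pow V. \<Sum>x\<in>Pow V. \<Sum>t\<in>paulis V.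
      (\<Prod>u\<in>V. r u (t u)) * (cnj (\<phi> y) * (tensor_entry V (\<lambda>u. pauli_op (t u)) y x * \<psi> x)))"
    by (simp add: inner_state_def apply_local_def tensor sum_distrib_left sum_distrib_right mult_ac)
  also have "\<dots> = (\<Sum>y\<in>Pow V. \<Sum>t\<in>paulis V. \<Sum>x\<in>Pow V.
      (\<Prod>u\<in>V. r u (t u)) * (cnj (\<phi> y) * (tensor_entry V (\<lambda>u. pauli_op (t u)) y x * \<psi> x)))"
    by (intro sum.cong refl sum.swap)
  also have "\<dots> = (\<Sum>t\<in>paulis V. \<Sum>y\<in>Pow V. \<Sum>x\<in>Pow V.
      (\<Prod>u\<in>V. r u (t u)) * (cnj (\<phi> y) * (tensor_entry V (\<lambda>u. pauli_op (t u)) y x * \<psi> x)))"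
    by (rule sum.swap)
  finally show ?thesis
    by (simp add: inner_state_def apply_local_def sum_distrib_left)
qed

text \<open>The expectations transform by the tensor product of the rotations. Sites where
  \<open>s\<close> is \<open>pI\<close> contribute only \<open>pI\<close>, so the expectations
  supported on \<open>W\<close> transform among themselves: this is the passage to the reduced state
  on \<open>W\<close>.\<close>

lemma expect_apply_local:
  assumes V: "finite V" and U: "\<And>u. u \<in> V \<Longrightarrow> unitary (U u)" and W: "W \<subseteq> V" and s: "s \<in> paulis W"
  shows "expect V (apply_local V U \<psi>) s =
    (\<Sum>t\<in>paulis W. (\<Prod>u\<in>W. rotation (U u) (s u) (t u)) * expect V \<psi> t)"
proof -
  have "expect V (apply_local V U \<psi>) s =
      inner_state V \<psi> (apply_local V (\<lambda>u. dagger (U u) ** pauli_op (s u) ** U u) \<psi>)"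
    unfolding expect_def
    using inner_state_adjoint[of V \<psi> "\<lambda>u. dagger (U u)" "apply_pauli V s (apply_local V U \<psi>)"]
    by (simp add: apply_local_comp V matrix_mul_assoc)
  also have "\<dots> = (\<Sum>t\<in>paulis V. (\<Prod>u\<in>V. rotation (U u) (s u) (t u)) * expect V \<psi> t)"
    unfolding expect_def by (intro apply_local_expansion V dagger_conj_pauli_op)
  also have "\<dots> = (\<Sum>t\<in>paulis W. (\<Prod>u\<in>W. rotation (U u) (s u) (t u)) * expect V \<psi> t)"
  proof (rule sum.mono_neutral_cong_right)
    show "finite (paulis V)" by (rule finite_paulis[OF V])
    show "paulis W \<subseteq> paulis V" by (rule paulis_mono[OF W])
    show "\<forall>t\<in>paulis V - paulis W. (\<Prod>u\<in>V. rotation (U u) (s u) (t u)) * expect V \<psi> t = 0"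
    proof
      fix t assume "t \<in> paulis V - paulis W"
      then obtain u where u: "u \<in> V" "u \<notin> W" "t u \<noteq> pI" by (auto simp: paulis_def)
      then have "rotation (U u) (s u) (t u) = 0"
        using s rotation_pI_left[OF U] by (auto simp: paulis_def)
      with u V show "(\<Prod>u\<in>V. rotation (U u) (s u) (t u)) * expect V \<psi> t = 0"
        by (auto simp: prod_zero_iff)
    qed
    fix t assume t: "t \<in> paulis W"
    have "(\<Prod>u\<in>V. rotation (U u) (s u) (t u)) = (\<Prod>u\<in>W. rotation (U u) (s u) (t u))"
      using V W s t rotation_pI_left[OF U] by (intro prod.mono_neutral_right) (auto simp: paulis_def)
    then show "(\<Prod>u\<in>V. rotation (U u) (s u) (t u)) * expect V \<psi> t =
      (\<Prod>u\<in>W. rotation (U u) (s u) (t u)) * expect V \<psi> t" by simp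
  qed
  finally show ?thesis .
qed

text \<open>\<open>K\<close> is a tensor product of orthogonal matrices, hence preserves inner
  products. This is what allows Gram matrices of slices to be compared.\<close>

lemma rotation_parseval:
  assumes W: "finite W" and U: "\<And>u. u \<in> W \<Longrightarrow> unitary (U u)"
  defines "K \<equiv> \<lambda>s t. \<Prod>u\<in>W. rotation (U u) (s u) (t u)"
  shows "(\<Sum>s\<in>paulis W. (\<Sum>t\<in>paulis W. K s t * f t) * cnj (\<Sum>t\<in>paulis W. K s t * g t)) =
    (\<Sum>t\<in>paulis W. f t * cnj (g t))"
proof -
  have orth: "(\<Sum>s\<in>paulis W. K s t * cnj (K s t')) = (if t = t' then 1 else 0)"
    if t: "t \<in> paulis W" "t' \<in> paulis W" for t t'
  proof -
    have "(\<Sum>s\<in>paulis W. K s t * cnj (K s t')) =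
        (\<Prod>u\<in>W. \<Sum>a\<in>UNIV. rotation (U u) a (t u) * cnj (rotation (U u) a (t' u)))"
      unfolding K_def prod_sum_paulis[OF W, symmetric] by (simp add: prod.distrib)
    also have "\<dots> = (\<Prod>u\<in>W. if t u = t' u then 1 else 0)"
      by (intro prod.cong refl rotation_orthogonal U)
    also have "\<dots> = (if t = t' then 1 else 0)"
    proof (cases "t = t'")
      case False
      then obtain u where "t u \<noteq> t' u" by blast
      have "u \<in> W"
      proof (rule ccontr)
        assume "u \<notin> W"
        then have "t u = pI" "t' u = pI" using t by (simp_all add: paulis_def)
        with \<open>t u \<noteq> t' u\<close> show False by simp
      qed
      with \<open>t u \<noteq> t' u\<close> W False show ?thesis by (auto simp: prod_zero_iff)
    qed simp
    finally show ?thesis .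
  qed
  have "(\<Sum>s\<in>paulis W. (\<Sum>t\<in>paulis W. K s t * f t) * cnj (\<Sum>t\<in>paulis W. K s t * g t)) =
      (\<Sum>s\<in>paulis W. \<Sum>t\<in>paulis W. \<Sum>t'\<in>paulis W. f t * cnj (g t') * (K s t * cnj (K s t')))"
    by (simp add: sum_product mult_ac)
  also have "\<dots> = (\<Sum>t\<in>paulis W. \<Sum>t'\<in>paulis W. \<Sum>s\<in>paulis W. f t * cnj (g t') * (K s t * cnj (K s t')))"
    by (subst sum.swap) (intro sum.cong refl sum.swap)
  also have "\<dots> = (\<Sum>t\<in>paulis W. \<Sum>t'\<in>paulis W. if t' = t then f t * cnj (g t) else 0)"
    by (intro sum.cong refl) (simp add: orth flip: sum_distrib_left)
  finally show ?thesis using finite_paulis[OF W] by simp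
qed

lemma rotation_isometry:
  assumes W: "finite W" and U: "\<And>u. u \<in> W \<Longrightarrow> unitary (U u)"
  shows "(\<Sum>s\<in>paulis W. (norm (\<Sum>t\<in>paulis W. (\<Prod>u\<in>W. rotation (U u) (s u) (t u)) * f t))\<^sup>2) =
    (\<Sum>t\<in>paulis W. (norm (f t))\<^sup>2)"
proof -
  have "complex_of_real (\<Sum>s\<in>paulis W. (norm (\<Sum>t\<in>paulis W. (\<Prod>u\<in>W. rotation (U u) (s u) (t u)) * f t))\<^sup>2) =
      complex_of_real (\<Sum>t\<in>paulis W. (norm (f t))\<^sup>2)"
    unfolding of_real_sum complex_norm_square by (rule rotation_parseval[OF assms])
  then show ?thesis by (simp only: of_real_eq_iff)
qed

subsection \<open>Images of the Pauli axes\<close>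

lemma padd_eq_pI [simp]: "padd a b = pI \<longleftrightarrow> a = b"
  by (cases a; cases b) (auto simp: padd_def)

lemma padd_simps [simp]: "padd a a = pI" "padd a pI = a"
  by (auto simp: padd_def)

lemma padd_third: "a \<noteq> pI \<Longrightarrow> b \<noteq> pI \<Longrightarrow> c \<noteq> pI \<Longrightarrow> a \<noteq> b \<Longrightarrow> c \<noteq> a \<Longrightarrow> c \<noteq> b \<Longrightarrow> padd a b = c"
  by (cases a; cases b; cases c) (auto simp: padd_def)

lemma ex_third_pauli: "i \<noteq> pI \<Longrightarrow> \<exists>j. j \<noteq> pI \<and> j \<noteq> i"
  by (metis prod.inject)

lemma padd_paulis: "s \<in> paulis W \<Longrightarrow> t \<in> paulis W \<Longrightarrow> (\<lambda>u. padd (s u) (t u)) \<in> paulis W"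
  by (simp add: paulis_def)

lemma padd_fun_upd: "(\<lambda>u. padd ((s(v := i)) u) ((t(v := j)) u)) = (\<lambda>u. padd (s u) (t u))(v := padd i j)"
  by (simp add: fun_eq_iff)

lemma rotation_dagger: "rotation (dagger U) i j = rotation U j i"
  unfolding rotation_def dagger_dagger by (metis (no_types, lifting) matrix_mul_assoc trace_mul_sym)

lemma ex_rotation_column: "unitary U \<Longrightarrow> \<exists>k. rotation U k i \<noteq> 0"
proof (rule ccontr)
  assume "unitary U" "\<nexists>k. rotation U k i \<noteq> 0"
  then have "rotation U k i = 0" for k by blast
  then have "(\<Sum>a\<in>UNIV. rotation U a i * cnj (rotation U a i)) = 0" by (simp only: mult_zero_left sum.neutral_const)
  then show False using rotation_orthogonal[OF \<open>unitary U\<close>, of i i] by simp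
qed

lemma ex_rotation_row: "unitary U \<Longrightarrow> \<exists>i. rotation U j i \<noteq> 0"
  using ex_rotation_column[OF unitary_dagger, of U j] by (simp add: rotation_dagger)

lemma sum_single:
  fixes f :: "pauli \<Rightarrow> complex"
  assumes "\<And>j. j \<noteq> i \<Longrightarrow> f j = 0"
  shows "sum f UNIV = f i"
  using sum.mono_neutral_right[of UNIV "{i}" f] assms by simp

definition preserves_axis :: "qubit_op \<Rightarrow> bool" where
  "preserves_axis U \<longleftrightarrow> (\<exists>i j. i \<noteq> pI \<and> j \<noteq> pI \<and> (\<forall>k. k \<noteq> j \<longrightarrow> rotation U k i = 0))"

lemma preserves_axisI:
  assumes U: "unitary U" and i: "i \<noteq> pI"
    and 1: "\<And>j k. j \<noteq> pI \<Longrightarrow> k \<noteq> pI \<Longrightarrow> j \<noteq> k \<Longrightarrow> rotation U j i \<noteq> 0 \<Longrightarrow> rotation U k i = 0"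
  shows "preserves_axis U"
proof -
  obtain j where j: "rotation U j i \<noteq> 0" using ex_rotation_column[OF U] by blast
  then have "j \<noteq> pI" using rotation_pI_left[OF U, of i] i by auto
  moreover have "rotation U k i = 0" if "k \<noteq> j" for k
    using 1[of j k] j \<open>j \<noteq> pI\<close> that rotation_pI_left[OF U, of i] i by (cases "k = pI") auto
  ultimately show ?thesis using i unfolding preserves_axis_def by blast
qed

section \<open>Single sites and slices of the expectation tensor\<close>

lemma expect_identity: "stabilizer_state V \<psi> \<Longrightarrow> expect V \<psi> (\<lambda>_. pI) = 1"
  using apply_local_id[of V \<psi> "\<lambda>_. pauli_op pI"]
  by (simp add: stabilizer_state_def expect_def pauli_op_pI)

lemma graph_single_site:
  assumes G: "simple_graph V E" and v: "v \<in> V" and ij: "i \<noteq> pI" "j \<noteq> pI"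
    and c: "expect V (graph_state V E) ((\<lambda>_. pI)(v := i)) \<noteq> 0"
      "expect V (graph_state V E) ((\<lambda>_. pI)(v := j)) \<noteq> 0"
  shows "i = j"
proof -
  have x: "fst k" if "k \<noteq> pI" "expect V (graph_state V E) ((\<lambda>_. pI)(v := k)) \<noteq> 0" for k
  proof (rule ccontr)
    assume "\<not> fst k"
    then have "xpart V ((\<lambda>_. pI)(v := k)) = xpart V (\<lambda>_. pI)" by (auto simp: xpart_def)
    then have "((\<lambda>_. pI)(v := k)) v = pI"
      using expect_graph_state_inj[OF G that(2) _ _ v, of "\<lambda>_. pI"]
        expect_identity[OF stabilizer_state_graph_state[OF G]] by simp
    with that show False by simp
  qed
  then have "xpart V ((\<lambda>_. pI)(v := i)) = xpart V ((\<lambda>_. pI)(v := j))"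
    using x[OF ij(1) c(1)] x[OF ij(2) c(2)] by (auto simp: xpart_def)
  then show ?thesis using expect_graph_state_inj[OF G c _ v] by simp
qed

text \<open>The tensor is cut into slices by the Pauli at \<open>v\<close>: the rotation of
  \<open>U v\<close> mixes the slices, and one common orthogonal map on \<open>W\<close> acts inside
  each of them, invisible to their inner products.\<close>

lemma expect_site:
  assumes V: "finite V" and U: "\<forall>u\<in>V. unitary (U u)" and W: "W \<subseteq> V"
    and v: "v \<in> V" "v \<notin> W" and s: "s \<in> paulis W"
  shows "expect V (apply_local V U \<psi>) (s(v := j)) =
    (\<Sum>t\<in>paulis W. (\<Prod>u\<in>W. rotation (U u) (s u) (t u)) *
      (\<Sum>i\<in>UNIV. rotation (U v) j i * expect V \<psi> (t(v := i))))"
proof -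
  have fin: "finite W" using V W finite_subset by blast
  have prod: "(\<Prod>u\<in>W. rotation (U u) ((s(v := j)) u) ((t(v := i)) u)) =
      (\<Prod>u\<in>W. rotation (U u) (s u) (t u))" for t i
    using v by (intro prod.cong) auto
  have "expect V (apply_local V U \<psi>) (s(v := j)) =
      (\<Sum>t\<in>paulis (insert v W). (\<Prod>u\<in>insert v W. rotation (U u) ((s(v := j)) u) (t u)) * expect V \<psi> t)"
    using s W v by (intro expect_apply_local V bspec[OF U]) (auto simp: paulis_def)
  also have "\<dots> = (\<Sum>t\<in>paulis W. \<Sum>i\<in>UNIV. (\<Prod>u\<in>W. rotation (U u) (s u) (t u)) *
      (rotation (U v) j i * expect V \<psi> (t(v := i))))"
    unfolding sum_paulis_insert[OF v(2)] prod.insert[OF fin v(2)] prod by (simp add: mult_ac)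
  finally show ?thesis by (simp only: sum_distrib_left)
qed

lemma expect_two_sites:
  assumes V: "finite V" and U: "\<forall>u\<in>V. unitary (U u)" and W: "W \<subseteq> V"
    and v: "v \<in> V" "v \<notin> W" and w: "w \<in> V" "w \<notin> W" "w \<noteq> v" and s: "s \<in> paulis W"
  shows "expect V (apply_local V U \<psi>) (s(w := k, v := j)) =
    (\<Sum>t\<in>paulis W. (\<Prod>u\<in>W. rotation (U u) (s u) (t u)) *
      (\<Sum>l\<in>UNIV. \<Sum>i\<in>UNIV. rotation (U w) k l * rotation (U v) j i * expect V \<psi> (t(w := l, v := i))))"
proof -
  have fin: "finite W" using V W finite_subset by blast
  have prod: "(\<Prod>u\<in>W. rotation (U u) ((s(w := k)) u) ((t(w := l)) u)) =
      (\<Prod>u\<in>W. rotation (U u) (s u) (t u))" for t l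
    using w by (intro prod.cong) auto
  have "expect V (apply_local V U \<psi>) (s(w := k, v := j)) =
      (\<Sum>t\<in>paulis (insert w W). (\<Prod>u\<in>insert w W. rotation (U u) ((s(w := k)) u) (t u)) *
        (\<Sum>i\<in>UNIV. rotation (U v) j i * expect V \<psi> (t(v := i))))"
    using s W v w by (intro expect_site V U) (auto simp: paulis_def)
  also have "\<dots> = (\<Sum>t\<in>paulis W. \<Sum>l\<in>UNIV. (\<Prod>u\<in>W. rotation (U u) (s u) (t u)) *
      (\<Sum>i\<in>UNIV. rotation (U w) k l * rotation (U v) j i * expect V \<psi> (t(w := l, v := i))))"
    unfolding sum_paulis_insert[OF w(2)] prod.insert[OF fin w(2)] prod
    by (simp add: sum_distrib_left mult_ac)
  finally show ?thesis by (simp only: sum_distrib_left)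
qed

text \<open>
  Up to signs, exactly three stabilizers supported on \<open>insert v W\<close> act on \<open>v\<close>; they have full
  support and differ from each other on every site.
\<close>

definition minimal_triple :: "'v set \<Rightarrow> ('v set \<Rightarrow> complex) \<Rightarrow> 'v \<Rightarrow> 'v set \<Rightarrow> bool" where
  "minimal_triple V \<psi> v W \<longleftrightarrow> W \<subseteq> V \<and> v \<notin> W \<and>
    (\<forall>i. i \<noteq> pI \<longrightarrow> (\<exists>s\<in>paulis W. expect V \<psi> (s(v := i)) \<noteq> 0)) \<and>
    (\<forall>u\<in>W. \<forall>s\<in>paulis (W - {u}). \<forall>i. i \<noteq> pI \<longrightarrow> expect V \<psi> (s(v := i)) = 0)"

lemma minimal_triple_ex:
  "minimal_triple V \<psi> v W \<Longrightarrow> i \<noteq> pI \<Longrightarrow> \<exists>s\<in>paulis W. expect V \<psi> (s(v := i)) \<noteq> 0"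
  unfolding minimal_triple_def by blast

lemma minimal_triple_full:
  assumes "minimal_triple V \<psi> v W" "s \<in> paulis W" "i \<noteq> pI" "expect V \<psi> (s(v := i)) \<noteq> 0" "u \<in> W"
  shows "s u \<noteq> pI"
proof
  assume "s u = pI"
  then have "s \<in> paulis (W - {u})" using assms(2) by (auto simp: paulis_def)
  then show False using assms unfolding minimal_triple_def by blast
qed

text \<open>If they agreed at \<open>u\<close>, their product would be a stabilizer that is trivial
  at \<open>u\<close> but not at \<open>v\<close>.\<close>

lemma minimal_triple_distinct:
  assumes \<psi>: "stabilizer_state V \<psi>" and M: "minimal_triple V \<psi> v W"
    and s: "s \<in> paulis W" "expect V \<psi> (s(v := i)) \<noteq> 0"
    and t: "t \<in> paulis W" "expect V \<psi> (t(v := j)) \<noteq> 0"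
    and ij: "i \<noteq> j" and u: "u \<in> W"
  shows "s u \<noteq> t u"
proof -
  have "expect V \<psi> ((\<lambda>u. padd (s u) (t u))(v := padd i j)) \<noteq> 0"
    using expect_padd[OF \<psi> s(2) t(2)] unfolding padd_fun_upd .
  then have "padd (s u) (t u) \<noteq> pI"
    using minimal_triple_full[OF M padd_paulis[OF s(1) t(1)], of "padd i j" u] ij u by simp
  then show ?thesis by simp
qed

text \<open>Suppose \<open>s\<close> and \<open>t\<close> differ at \<open>u\<close>, and let
  \<open>r\<close> carry another label at \<open>v\<close>. All three are nontrivial and different
  at \<open>u\<close>, so the product of \<open>s\<close> and \<open>t\<close>, trivial at
  \<open>v\<close>, agrees with \<open>r\<close> at \<open>u\<close>. This contradicts
  \<open>minimal_triple_distinct\<close>.\<close>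

lemma minimal_triple_unique:
  assumes \<psi>: "stabilizer_state V \<psi>" and M: "minimal_triple V \<psi> v W"
    and s: "s \<in> paulis W" "expect V \<psi> (s(v := i)) \<noteq> 0"
    and t: "t \<in> paulis W" "expect V \<psi> (t(v := i)) \<noteq> 0"
    and i: "i \<noteq> pI"
  shows "s = t"
proof (rule ccontr)
  assume "s \<noteq> t"
  then obtain u where u: "s u \<noteq> t u" by blast
  then have uW: "u \<in> W" using s(1) t(1) by (cases "u \<in> W") (simp_all add: paulis_def)
  obtain j where j: "j \<noteq> pI" "j \<noteq> i" using ex_third_pauli[OF i] by blast
  then obtain r where r: "r \<in> paulis W" "expect V \<psi> (r(v := j)) \<noteq> 0"
    using M unfolding minimal_triple_def by blast
  have "s u \<noteq> pI" "t u \<noteq> pI" "r u \<noteq> pI"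
    using minimal_triple_full[OF M] s t r i j uW by blast+
  moreover have "r u \<noteq> s u" "r u \<noteq> t u"
    using minimal_triple_distinct[OF \<psi> M] s t r j uW by blast+
  ultimately have ru: "padd (s u) (t u) = r u" using padd_third u by metis
  let ?st = "\<lambda>u. padd (s u) (t u)"
  have "expect V \<psi> (?st(v := pI)) \<noteq> 0"
    using expect_padd[OF \<psi> s(2) t(2)] unfolding padd_fun_upd by simp
  then have "r u \<noteq> ?st u"
    using minimal_triple_distinct[OF \<psi> M r padd_paulis[OF s(1) t(1)] _ j(1) uW] by blast
  with ru show False by simp
qed

text \<open>A stabilizer on \<open>v\<close> alone makes the nontrivial part of the reduced state at
  \<open>v\<close> a multiple of one Pauli, in both graphs. The rotation has to carry one axis to
  the other.\<close>

lemma axis_of_single_site: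
  assumes G: "simple_graph V E1" "simple_graph V E2"
    and U: "\<forall>u\<in>V. unitary (U u)"
    and eq: "graph_state V E2 = apply_local V U (graph_state V E1)" and v: "v \<in> V"
    and l: "l \<noteq> pI" "expect V (graph_state V E2) ((\<lambda>_. pI)(v := l)) \<noteq> 0"
  shows "preserves_axis (U v)"
proof -
  let ?c1 = "\<lambda>i. expect V (graph_state V E1) ((\<lambda>_. pI)(v := i))"
  let ?c2 = "\<lambda>i. expect V (graph_state V E2) ((\<lambda>_. pI)(v := i))"
  have V: "finite V" using G by (simp add: simple_graph_def)
  have site: "?c2 j = (\<Sum>i\<in>UNIV. rotation (U v) j i * ?c1 i)" for j
    using expect_site[OF V U empty_subsetI v, where s = "\<lambda>_. pI" and \<psi> = "graph_state V E1" and j = j] eq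
    by (simp add: fun_upd_def)
  obtain i where i: "rotation (U v) l i \<noteq> 0" "?c1 i \<noteq> 0"
    using l(2) site[of l] by (metis (no_types, lifting) mult_eq_0_iff sum.not_neutral_contains_not_neutral)
  have ipI: "i \<noteq> pI" using i(1) rotation_pI_right[OF bspec[OF U v], of l] l(1) by auto
  show ?thesis
  proof (rule preserves_axisI[OF bspec[OF U v] ipI])
    fix j k assume jk: "j \<noteq> pI" "k \<noteq> pI" "j \<noteq> k" "rotation (U v) j i \<noteq> 0"
    have "?c2 m = rotation (U v) m i * ?c1 i" if "m \<noteq> pI" for m
    proof -
      have "rotation (U v) m i' * ?c1 i' = 0" if "i' \<noteq> i" for i'
        using graph_single_site[OF G(1) v _ ipI _ i(2), of i'] that
          rotation_pI_right[OF bspec[OF U v], of m] \<open>m \<noteq> pI\<close>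
        by (cases "i' = pI") auto
      then show ?thesis unfolding site by (rule sum_single)
    qed
    then have "rotation (U v) k i \<noteq> 0 \<Longrightarrow> ?c2 k \<noteq> 0 \<and> ?c2 j \<noteq> 0"
      using jk i(2) by simp
    then show "rotation (U v) k i = 0" using graph_single_site[OF G(2) v jk(1,2)] jk(3) by blast
  qed
qed

text \<open>Different nontrivial slices of the second tensor have disjoint supports, since a common
  point would give a stabilizer on \<open>v\<close> alone. In the first tensor only slice
  \<open>i\<close> contributes, so by Parseval their inner product is a positive multiple of the
  product of two entries of column \<open>i\<close>; hence one of these vanishes.\<close>

lemma axis_of_unique_pauli:
  assumes G: "simple_graph V E1" "simple_graph V E2"
    and U: "\<forall>u\<in>V. unitary (U u)"
    and eq: "graph_state V E2 = apply_local V U (graph_state V E1)" and v: "v \<in> V"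
    and W: "W \<subseteq> V" "v \<notin> W" and i: "i \<noteq> pI"
    and ex: "s0 \<in> paulis W" "expect V (graph_state V E1) (s0(v := i)) \<noteq> 0"
    and unique: "\<And>s j. s \<in> paulis W \<Longrightarrow> j \<noteq> pI \<Longrightarrow> j \<noteq> i \<Longrightarrow> expect V (graph_state V E1) (s(v := j)) = 0"
    and no_single: "\<And>l. l \<noteq> pI \<Longrightarrow> expect V (graph_state V E2) ((\<lambda>_. pI)(v := l)) = 0"
  shows "preserves_axis (U v)"
proof (rule preserves_axisI[OF bspec[OF U v] i])
  fix j k assume jk: "j \<noteq> pI" "k \<noteq> pI" "j \<noteq> k" "rotation (U v) j i \<noteq> 0"
  let ?c1 = "expect V (graph_state V E1)" and ?c2 = "expect V (graph_state V E2)"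
  have V: "finite V" using G by (simp add: simple_graph_def)
  have fin: "finite W" using V W finite_subset by blast
  have site: "?c2 (s(v := m)) = (\<Sum>t\<in>paulis W. (\<Prod>u\<in>W. rotation (U u) (s u) (t u)) *
      (rotation (U v) m i * ?c1 (t(v := i))))" if "m \<noteq> pI" "s \<in> paulis W" for m s
  proof -
    have "(\<Sum>i'\<in>UNIV. rotation (U v) m i' * ?c1 (t(v := i'))) = rotation (U v) m i * ?c1 (t(v := i))"
      if t: "t \<in> paulis W" for t
    proof -
      have "rotation (U v) m i' * ?c1 (t(v := i')) = 0" if "i' \<noteq> i" for i'
        using unique[OF t _ that] rotation_pI_right[OF bspec[OF U v], of m] \<open>m \<noteq> pI\<close> by (cases "i' = pI") auto
      then show ?thesis by (rule sum_single)
    qed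
    then show ?thesis
      unfolding eq expect_site[OF V U W(1) v W(2) that(2)] by (intro sum.cong refl) (simp only:)
  qed
  have zero: "?c2 (s(v := j)) * cnj (?c2 (s(v := k))) = 0" if s: "s \<in> paulis W" for s
  proof (rule ccontr)
    assume "\<not> ?thesis"
    then have "?c2 ((\<lambda>u. padd (s u) (s u))(v := padd j k)) \<noteq> 0"
      using expect_padd[OF stabilizer_state_graph_state[OF G(2)], of "s(v := j)" "s(v := k)"]
      unfolding padd_fun_upd by simp
    then show False using no_single[of "padd j k"] jk by simp
  qed
  have "0 = (\<Sum>s\<in>paulis W. ?c2 (s(v := j)) * cnj (?c2 (s(v := k))))"
    by (rule sum.neutral[symmetric]) (use zero in blast)
  also have "\<dots> = (\<Sum>s\<in>paulis W.
      (\<Sum>t\<in>paulis W. (\<Prod>u\<in>W. rotation (U u) (s u) (t u)) * (rotation (U v) j i * ?c1 (t(v := i)))) *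
      cnj (\<Sum>t\<in>paulis W. (\<Prod>u\<in>W. rotation (U u) (s u) (t u)) * (rotation (U v) k i * ?c1 (t(v := i)))))"
    by (intro sum.cong refl arg_cong2[where f = "\<lambda>a b. a * cnj b"] site jk)
  also have "\<dots> = (\<Sum>t\<in>paulis W. (rotation (U v) j i * ?c1 (t(v := i))) * cnj (rotation (U v) k i * ?c1 (t(v := i))))"
    using U W by (intro rotation_parseval[OF fin]) blast
  also have "\<dots> = (\<Sum>t\<in>paulis W. rotation (U v) j i * cnj (rotation (U v) k i) * of_real ((norm (?c1 (t(v := i))))\<^sup>2))"
    by (intro sum.cong refl) (simp only: complex_norm_square complex_cnj_mult mult_ac)
  also have "\<dots> = rotation (U v) j i * cnj (rotation (U v) k i) *
      of_real (\<Sum>t\<in>paulis W. (norm (?c1 (t(v := i))))\<^sup>2)"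
    by (simp only: sum_distrib_left of_real_sum)
  finally have "rotation (U v) j i * cnj (rotation (U v) k i) *
      of_real (\<Sum>t\<in>paulis W. (norm (?c1 (t(v := i))))\<^sup>2) = 0" by simp
  moreover have "(\<Sum>t\<in>paulis W. (norm (?c1 (t(v := i))))\<^sup>2) > 0"
    using ex by (intro sum_pos2[OF finite_paulis[OF fin] ex(1)]) auto
  then have "complex_of_real (\<Sum>t\<in>paulis W. (norm (?c1 (t(v := i))))\<^sup>2) \<noteq> 0"
    by (metis less_irrefl of_real_eq_0_iff)
  ultimately have "cnj (rotation (U v) k i) = 0"
    using jk(4) by (simp only: mult_eq_0_iff) blast
  then show "rotation (U v) k i = 0" by simp
qed

text \<open>Both conditions concern vanishing of slices at \<open>v\<close> with nontrivial labels.
  Rotations mix these slices only with one another, and the isometry on the other sites preserves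
  vanishing.\<close>

lemma minimal_triple_transfer:
  assumes G: "simple_graph V E1" "simple_graph V E2"
    and U: "\<forall>u\<in>V. unitary (U u)"
    and eq: "graph_state V E2 = apply_local V U (graph_state V E1)" and v: "v \<in> V"
    and M: "minimal_triple V (graph_state V E1) v W" and W0: "W \<noteq> {}"
  shows "minimal_triple V (graph_state V E2) v W"
proof -
  let ?c1 = "expect V (graph_state V E1)" and ?c2 = "expect V (graph_state V E2)"
  have V: "finite V" using G by (simp add: simple_graph_def)
  have W: "W \<subseteq> V" "v \<notin> W" using M by (auto simp: minimal_triple_def)
  have fin: "finite W" using V W finite_subset by blast
  note \<psi>1 = stabilizer_state_graph_state[OF G(1)]
  have "\<exists>s\<in>paulis W. ?c2 (s(v := j)) \<noteq> 0" if j: "j \<noteq> pI" for j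
  proof (rule ccontr)
    assume neg: "\<not> ?thesis"
    obtain i where i: "rotation (U v) j i \<noteq> 0" using ex_rotation_row[OF bspec[OF U v]] by blast
    have ipI: "i \<noteq> pI" using i rotation_pI_right[OF bspec[OF U v], of j] j by auto
    then obtain s where s: "s \<in> paulis W" "?c1 (s(v := i)) \<noteq> 0"
      using M unfolding minimal_triple_def by blast
    \<comment> \<open>Stabilizers with different labels at \<open>v\<close> differ on the nonempty
      set \<open>W\<close>, so at the position \<open>s\<close> only the slice \<open>i\<close> is
      nonzero and nothing can cancel.\<close>
    have d: "(\<Sum>i'\<in>UNIV. rotation (U v) j i' * ?c1 (s(v := i'))) = rotation (U v) j i * ?c1 (s(v := i))"
    proof -
      have "rotation (U v) j i' * ?c1 (s(v := i')) = 0" if "i' \<noteq> i" for i'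
      proof (cases "i' = pI")
        case True
        then show ?thesis using rotation_pI_right[OF bspec[OF U v], of j] j by simp
      next
        case False
        have "?c1 (s(v := i')) = 0"
        proof (rule ccontr)
          assume "?c1 (s(v := i')) \<noteq> 0"
          then show False
            using minimal_triple_distinct[OF \<psi>1 M s s(1), of i'] that W0 by blast
        qed
        then show ?thesis by simp
      qed
      then show ?thesis by (rule sum_single)
    qed
    have "0 = (\<Sum>s\<in>paulis W. (norm (?c2 (s(v := j))))\<^sup>2)" using neg by simp
    also have "\<dots> = (\<Sum>s\<in>paulis W. (norm (\<Sum>t\<in>paulis W. (\<Prod>u\<in>W. rotation (U u) (s u) (t u)) *
        (\<Sum>i\<in>UNIV. rotation (U v) j i * ?c1 (t(v := i)))))\<^sup>2)"
      unfolding eq by (intro sum.cong refl) (simp only: expect_site[OF V U W(1) v W(2)])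
    also have "\<dots> = (\<Sum>t\<in>paulis W. (norm (\<Sum>i\<in>UNIV. rotation (U v) j i * ?c1 (t(v := i))))\<^sup>2)"
      using U W by (intro rotation_isometry[OF fin]) blast
    also have "\<dots> > 0"
      by (intro sum_pos2[OF finite_paulis[OF fin] s(1)]) (use d i s(2) in auto)
    finally show False by simp
  qed
  moreover have "?c2 (s(v := j)) = 0" if u: "u \<in> W" and s: "s \<in> paulis (W - {u})" and j: "j \<noteq> pI" for u s j
  proof -
    have "(\<Sum>i\<in>UNIV. rotation (U v) j i * ?c1 (t(v := i))) = 0" if "t \<in> paulis (W - {u})" for t
    proof -
      have "?c1 (t(v := i)) = 0" if "i \<noteq> pI" for i
        using M u \<open>t \<in> _\<close> that unfolding minimal_triple_def by blast
      then have "rotation (U v) j i * ?c1 (t(v := i)) = 0" for i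
        using rotation_pI_right[OF bspec[OF U v], of j] j by (cases "i = pI") simp_all
      then show ?thesis by (simp only: sum.neutral_const)
    qed
    note site_zero = this
    have Wu: "W - {u} \<subseteq> V" "v \<notin> W - {u}" using W by auto
    show ?thesis
      unfolding eq expect_site[OF V U Wu(1) v Wu(2) s]
      by (intro sum.neutral ballI) (simp only: site_zero mult_zero_right)
  qed
  ultimately show ?thesis using W unfolding minimal_triple_def by blast
qed

text \<open>Slices by the Paulis at both \<open>v\<close> and \<open>w\<close> are compared. The
  second site \<open>x\<close> keeps enough of a stabilizer outside \<open>w\<close> to identify its
  label at \<open>v\<close>, so the slices do not interfere.\<close>

lemma axis_of_minimal_triple:
  assumes G: "simple_graph V E1" "simple_graph V E2"
    and U: "\<forall>u\<in>V. unitary (U u)"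
    and eq: "graph_state V E2 = apply_local V U (graph_state V E1)" and v: "v \<in> V"
    and M: "minimal_triple V (graph_state V E1) v W" and w: "w \<in> W" "x \<in> W" "x \<noteq> w"
  shows "preserves_axis (U v)"
proof -
  let ?c1 = "expect V (graph_state V E1)" and ?c2 = "expect V (graph_state V E2)"
  have V: "finite V" using G by (simp add: simple_graph_def)
  have W: "W \<subseteq> V" "v \<notin> W" using M by (auto simp: minimal_triple_def)
  have fin: "finite W" using V W finite_subset by blast
  note \<psi>1 = stabilizer_state_graph_state[OF G(1)]
  note \<psi>2 = stabilizer_state_graph_state[OF G(2)]
  have M2: "minimal_triple V (graph_state V E2) v W"
    using minimal_triple_transfer[OF G U eq v M] w by blast
  let ?R = "W - {w}"
  have R: "?R \<subseteq> V" "v \<notin> ?R" "finite ?R" using W fin by auto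
  have wv: "w \<in> V" "w \<notin> ?R" "w \<noteq> v" using W w by auto
  have upd: "s(w := k) \<in> paulis W" if "s \<in> paulis ?R" for s k using that w by (auto simp: paulis_def)
  have key: "rotation (U w) k (s w) * rotation (U v) j i = 0"
    if i: "i \<noteq> pI" and s: "s \<in> paulis W" "?c1 (s(v := i)) \<noteq> 0"
      and j: "j \<noteq> pI" and t: "t \<in> paulis W" "?c2 (t(v := j)) \<noteq> 0" and k: "k \<noteq> t w" for i s j t k
  proof -
    \<comment> \<open>Label \<open>j\<close> at \<open>v\<close> forces \<open>t w\<close> at
      \<open>w\<close> in the second graph, so its slice with \<open>k\<close> at \<open>w\<close>
      vanishes. By the isometry on \<open>?R\<close>, the combination \<open>d\<close> of slices of
      the first tensor vanishes too.\<close>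
    define d where "d r = (\<Sum>l\<in>UNIV. \<Sum>i\<in>UNIV. rotation (U w) k l * rotation (U v) j i * ?c1 (r(w := l, v := i)))" for r
    have "?c2 (r(w := k, v := j)) = 0" if "r \<in> paulis ?R" for r
    proof (rule ccontr)
      assume "?c2 (r(w := k, v := j)) \<noteq> 0"
      then have "r(w := k) = t"
        using minimal_triple_unique[OF \<psi>2 M2 upd[OF that] _ t j] by blast
      with k show False by auto
    qed
    then have "0 = (\<Sum>r\<in>paulis ?R. (norm (?c2 (r(w := k, v := j))))\<^sup>2)" by simp
    also have "\<dots> = (\<Sum>r\<in>paulis ?R. (norm (\<Sum>t\<in>paulis ?R. (\<Prod>u\<in>?R. rotation (U u) (r u) (t u)) * d t))\<^sup>2)"
      unfolding eq d_def by (intro sum.cong refl) (simp only: expect_two_sites[OF V U R(1) v R(2) wv])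
    also have "\<dots> = (\<Sum>t\<in>paulis ?R. (norm (d t))\<^sup>2)"
      using U R by (intro rotation_isometry) blast+
    finally have "\<forall>t\<in>paulis ?R. (norm (d t))\<^sup>2 = 0"
      using finite_paulis[OF R(3)] by (subst (asm) eq_commute) (simp add: sum_nonneg_eq_0_iff)
    moreover have "s(w := pI) \<in> paulis ?R" using s(1) by (auto simp: paulis_def)
    ultimately have "d (s(w := pI)) = 0" by auto
    moreover have "d (s(w := pI)) = rotation (U w) k (s w) * rotation (U v) j i * ?c1 (s(v := i))"
    proof -
      have pointwise: "rotation (U w) k l * rotation (U v) j i' * ?c1 (s(w := l, v := i')) =
          (if l = s w then if i' = i then rotation (U w) k (s w) * rotation (U v) j i * ?c1 (s(v := i)) else 0 else 0)"
        for l i'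
      proof (cases "i' = pI \<or> ?c1 (s(w := l, v := i')) = 0")
        case True
        then show ?thesis
          using rotation_pI_right[OF bspec[OF U v], of j] j i s(2) by auto
      next
        case False
        have sl: "s(w := l) \<in> paulis W" using s(1) w by (auto simp: paulis_def)
        \<comment> \<open>The site \<open>x\<close> is untouched by the update at \<open>w\<close>,
          so different labels at \<open>v\<close> would contradict
          \<open>minimal_triple_distinct\<close> there.\<close>
        have "i' = i"
        proof (rule ccontr)
          assume "i' \<noteq> i"
          then have "(s(w := l)) x \<noteq> s x"
            using minimal_triple_distinct[OF \<psi>1 M sl _ s] False w by blast
          then show False using w by simp
        qed
        moreover have "s(w := l) = s"
          using minimal_triple_unique[OF \<psi>1 M sl _ s i] False \<open>i' = i\<close> by blast
        then have "l = s w" by (metis fun_upd_same)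
        ultimately show ?thesis by simp
      qed
      have "(\<Sum>i'\<in>UNIV. rotation (U w) k l * rotation (U v) j i' * ?c1 (s(w := l, v := i'))) =
          (if l = s w then rotation (U w) k (s w) * rotation (U v) j i * ?c1 (s(v := i)) else 0)" for l
        unfolding pointwise by simp
      then show ?thesis unfolding d_def by simp
    qed
    ultimately show ?thesis using s(2) by simp
  qed
  define i :: pauli where "i = (True, False)"
  have i: "i \<noteq> pI" by (simp add: i_def)
  obtain s where s: "s \<in> paulis W" "?c1 (s(v := i)) \<noteq> 0"
    using M i unfolding minimal_triple_def by blast
  show ?thesis
  proof (rule preserves_axisI[OF bspec[OF U v] i], rule ccontr)
    fix j k assume jk: "j \<noteq> pI" "k \<noteq> pI" "j \<noteq> k" "rotation (U v) j i \<noteq> 0" "rotation (U v) k i \<noteq> 0"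
    obtain t where t: "t \<in> paulis W" "?c2 (t(v := j)) \<noteq> 0"
      using M2 jk unfolding minimal_triple_def by blast
    obtain t' where t': "t' \<in> paulis W" "?c2 (t'(v := k)) \<noteq> 0"
      using M2 jk unfolding minimal_triple_def by blast
    have "t w \<noteq> t' w" using minimal_triple_distinct[OF \<psi>2 M2 t t' jk(3) w(1)] .
    \<comment> \<open>No \<open>m\<close> equals both \<open>t w\<close> and \<open>t' w\<close>, so
      \<open>key\<close> applies to each \<open>m\<close> and kills a whole column of an orthogonal
      matrix.\<close>
    then have "rotation (U w) m (s w) = 0" for m
      using key[OF i s jk(1) t, of m] key[OF i s jk(2) t', of m] jk by (cases "m = t w") auto
    then show False using ex_rotation_column[OF bspec[OF U wv(1)]] by blast
  qed
qed

text \<open>The triple is that of a Bell pair. The stabilizer with Z at \<open>u\<close> has X part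
  \<open>{v}\<close>, so it is the vertex stabilizer of \<open>v\<close>, whose Z part reveals the
  neighbourhood; likewise with the roles exchanged.\<close>

lemma isolated_pair_of_minimal_triple:
  assumes G: "simple_graph V E" and v: "v \<in> V"
    and M: "minimal_triple V (graph_state V E) v {u}"
  shows "adj E v = {u}" "adj E u = {v}"
proof -
  let ?c = "expect V (graph_state V E)"
  note \<psi> = stabilizer_state_graph_state[OF G]
  have "{u} \<subseteq> V \<and> v \<notin> {u}" using M unfolding minimal_triple_def by blast
  then have u: "u \<in> V" "u \<noteq> v" by auto
  obtain f where f: "\<And>i. i \<noteq> pI \<Longrightarrow> f i \<in> paulis {u} \<and> ?c ((f i)(v := i)) \<noteq> 0"
    using M unfolding minimal_triple_def by metis
  have f_pI: "f i u \<noteq> pI" if "i \<noteq> pI" for i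
    using minimal_triple_full[OF M] f that by blast
  have x_ne: "xpart V ((f i)(v := i)) \<noteq> {}" if "i \<noteq> pI" for i
  proof
    assume "xpart V ((f i)(v := i)) = {}"
    then have "xpart V ((f i)(v := i)) = xpart V (\<lambda>_. pI)" by (simp add: xpart_def)
    then have "((f i)(v := i)) v = pI"
      using expect_graph_state_inj[OF G _ _ _ v] f that expect_identity[OF \<psi>]
      by (metis one_neq_zero)
    with that show False by simp
  qed
  have x_sub: "xpart V ((f i)(v := i)) \<subseteq> {u, v}" and z_sub: "zpart V ((f i)(v := i)) \<subseteq> {u, v}"
    if "i \<noteq> pI" for i using f[OF that] by (auto simp: paulis_def xpart_def zpart_def)
  have distinct: "f i u \<noteq> f j u" if "i \<noteq> pI" "j \<noteq> pI" "i \<noteq> j" for i j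
    using minimal_triple_distinct[OF \<psi> M _ _ _ _ that(3), of "f i" "f j" u] f that by blast
  \<comment> \<open>The three labels at \<open>u\<close> are distinct and nontrivial, so all three
    Paulis occur, Z among them.\<close>
  have "\<exists>i. i \<noteq> pI \<and> f i u = (False, True)"
  proof (rule ccontr)
    assume "\<not> ?thesis"
    then have Z: "f i u \<noteq> (False, True)" if "i \<noteq> pI" for i using that by blast
    let ?x = "(True, False) :: pauli" and ?y = "(True, True) :: pauli" and ?z = "(False, True) :: pauli"
    have ne: "?x \<noteq> pI" "?y \<noteq> pI" "?z \<noteq> pI" "?x \<noteq> ?y" "?x \<noteq> ?z" "?y \<noteq> ?z" by simp_all
    have "padd (f ?x u) (f ?y u) = ?z"
      by (rule padd_third) (use f_pI distinct Z ne in metis)+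
    moreover have "padd (f ?x u) (f ?y u) = f ?z u"
      by (rule padd_third) (use f_pI distinct ne in metis)+
    ultimately show False using Z[OF ne(3)] by metis
  qed
  then obtain i where i: "i \<noteq> pI" "f i u = (False, True)" by blast
  let ?s = "(f i)(v := i)"
  have "u \<notin> xpart V ?s" using i u by (simp add: xpart_def)
  then have "xpart V ?s = {v}" using x_sub[OF i(1)] x_ne[OF i(1)] by blast
  then have z: "zpart V ?s = adj E v" using expect_graph_state_vertex[OF G v] f[OF i(1)] by blast
  moreover have "u \<in> zpart V ?s" using i u by (simp add: zpart_def)
  ultimately show "adj E v = {u}" using z_sub[OF i(1)] not_in_adj[OF G, of v] by auto
  let ?t = "(f (False, True))(v := (False, True))"
  have "v \<notin> xpart V ?t" by (simp add: xpart_def)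
  then have "xpart V ?t = {u}" using x_sub[of "(False, True)"] x_ne[of "(False, True)"] by blast
  then have "zpart V ?t = adj E u"
    using expect_graph_state_vertex[OF G u(1)] f[of "(False, True)"] by blast
  moreover have "v \<in> zpart V ?t" using v by (simp add: zpart_def)
  ultimately show "adj E u = {v}" using z_sub[of "(False, True)"] not_in_adj[OF G, of u] by auto
qed

proposition preserves_axis_or_isolated_pair:
  assumes G: "simple_graph V E1" "simple_graph V E2"
    and U: "\<forall>u\<in>V. unitary (U u)"
    and eq: "graph_state V E2 = apply_local V U (graph_state V E1)" and v: "v \<in> V"
    and not_axis: "\<not> preserves_axis (U v)"
  obtains u where "u \<in> V" "u \<noteq> v" "adj E1 v = {u}" "adj E1 u = {v}" "adj E2 v = {u}" "adj E2 u = {v}"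
proof -
  let ?c1 = "expect V (graph_state V E1)" and ?c2 = "expect V (graph_state V E2)"
  have V: "finite V" using G by (simp add: simple_graph_def)
  note \<psi>1 = stabilizer_state_graph_state[OF G(1)]
  have no_single: "?c2 ((\<lambda>_. pI)(v := l)) = 0" if "l \<noteq> pI" for l
    using axis_of_single_site[OF G U eq v that] not_axis by blast
  \<comment> \<open>One nontrivial label at \<open>v\<close> brings a second by
    \<open>axis_of_unique_pauli\<close>, and the product of the two stabilizers supplies the
    third.\<close>
  have all: "\<exists>s\<in>paulis W. ?c1 (s(v := j)) \<noteq> 0"
    if W: "W \<subseteq> V" "v \<notin> W" and i: "i \<noteq> pI" "s \<in> paulis W" "?c1 (s(v := i)) \<noteq> 0" and j: "j \<noteq> pI"
    for W i s j
  proof -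
    obtain k t where k: "k \<noteq> pI" "k \<noteq> i" "t \<in> paulis W" "?c1 (t(v := k)) \<noteq> 0"
      using axis_of_unique_pauli[OF G U eq v W i _ no_single] not_axis by blast
    show ?thesis
    proof (cases "j = i \<or> j = k")
      case True
      then show ?thesis using i k by blast
    next
      case False
      then have "padd i k = j" using padd_third i k j by metis
      then have "?c1 ((\<lambda>u. padd (s u) (t u))(v := j)) \<noteq> 0"
        using expect_padd[OF \<psi>1 i(3) k(4)] unfolding padd_fun_upd by simp
      then show ?thesis using padd_paulis[OF i(2) k(3)] by blast
    qed
  qed
  \<comment> \<open>The vertex stabilizer of \<open>v\<close> witnesses \<open>P (V - {v})\<close>.
    A set of minimal size with \<open>P\<close> then gives a minimal triple, and the exclusion of
    the empty set and of sets with two or more elements leaves a single partner.\<close>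
  define P where "P W \<longleftrightarrow> W \<subseteq> V \<and> v \<notin> W \<and> (\<exists>i s. i \<noteq> pI \<and> s \<in> paulis W \<and> ?c1 (s(v := i)) \<noteq> 0)" for W
  have "P (V - {v})"
  proof -
    define s where "s u = (u = v, u \<in> adj E1 v)" for u
    have "xpart V s = {v}" "zpart V s = adj E1 v"
      using v adj_subset[OF G(1)] by (auto simp: xpart_def zpart_def s_def)
    then have "?c1 s \<noteq> 0" using expect_graph_state_vertex[OF G(1) v] by blast
    moreover have "s(v := pI) \<in> paulis (V - {v})" using adj_subset[OF G(1)] by (auto simp: paulis_def s_def)
    moreover have "s v \<noteq> pI" by (simp add: s_def)
    ultimately show ?thesis unfolding P_def
      by (intro conjI exI[of _ "s v"] exI[of _ "s(v := pI)"]) auto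
  qed
  then obtain W where W: "P W" "\<And>W'. P W' \<Longrightarrow> card W \<le> card W'"
    using exists_least_iff[of "\<lambda>n. \<exists>W. P W \<and> card W = n"] by (metis not_le)
  have WV: "W \<subseteq> V" "v \<notin> W" using W(1) by (auto simp: P_def)
  then have fin: "finite W" using V finite_subset by blast
  have M: "minimal_triple V (graph_state V E1) v W"
    unfolding minimal_triple_def
  proof (intro conjI allI impI ballI)
    fix i :: pauli assume "i \<noteq> pI"
    then show "\<exists>s\<in>paulis W. ?c1 (s(v := i)) \<noteq> 0" using W(1) all[OF WV] unfolding P_def by blast
  next
    fix u s i assume u: "u \<in> W" "s \<in> paulis (W - {u})" "i \<noteq> pI"
    have "card (W - {u}) < card W" using fin u(1) by (rule card_Diff1_less)
    then have "\<not> P (W - {u})" using W(2) by (meson not_le)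
    then show "?c1 (s(v := i)) = 0" using u WV unfolding P_def by blast
  qed (use WV in auto)
  have "W \<noteq> {}"
  proof
    assume "W = {}"
    have "?c1 ((\<lambda>_. pI)(v := i)) \<noteq> 0" if i: "i \<noteq> pI" for i
    proof -
      obtain s where "s \<in> paulis W" "?c1 (s(v := i)) \<noteq> 0"
        using minimal_triple_ex[OF M i] by blast
      moreover from this \<open>W = {}\<close> have "s = (\<lambda>_. pI)" by simp
      ultimately show ?thesis by metis
    qed
    then show False using graph_single_site[OF G(1) v, of "(True, False)" "(False, True)"] by blast
  qed
  then obtain u where u: "u \<in> W" by blast
  have "W = {u}" using axis_of_minimal_triple[OF G U eq v M u] not_axis u by blast
  with M have M1: "minimal_triple V (graph_state V E1) v {u}" by simp
  have M2: "minimal_triple V (graph_state V E2) v {u}"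
    using minimal_triple_transfer[OF G U eq v M1] by simp
  show thesis
    using that[of u] WV u isolated_pair_of_minimal_triple[OF G(1) v M1]
      isolated_pair_of_minimal_triple[OF G(2) v M2] by blast
qed

subsection \<open>Isolated edges\<close>

lemma apply_local_single:
  assumes V: "finite V" and u: "u \<in> V" and y: "y \<subseteq> V"
  shows "apply_local V (\<lambda>w. if w = u then A else mat 1) \<psi> y =
    A $ (u \<in> y) $ False * \<psi> (y - {u}) + A $ (u \<in> y) $ True * \<psi> (insert u y)"
proof -
  let ?T = "tensor_entry V (\<lambda>w. if w = u then A else mat 1) y"
  have T: "?T x = A $ (u \<in> y) $ (u \<in> x) * (\<Prod>w\<in>V - {u}. if (w \<in> y) = (w \<in> x) then 1 else 0)" for x
  proof -
    have "?T x = A $ (u \<in> y) $ (u \<in> x) *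
        (\<Prod>w\<in>V - {u}. (if w = u then A else mat 1) $ (w \<in> y) $ (w \<in> x))"
      unfolding tensor_entry_def by (subst prod.remove[OF V u]) simp
    also have "(\<Prod>w\<in>V - {u}. (if w = u then A else mat 1) $ (w \<in> y) $ (w \<in> x)) =
        (\<Prod>w\<in>V - {u}. if (w \<in> y) = (w \<in> x) then 1 else 0)"
      by (intro prod.cong) (auto simp: mat_def)
    finally show ?thesis .
  qed
  have T0: "?T x = 0" if x: "x \<in> Pow V - {y - {u}, insert u y}" for x
  proof -
    have "\<exists>w\<in>V - {u}. (w \<in> y) \<noteq> (w \<in> x)"
    proof (rule ccontr)
      assume "\<not> ?thesis"
      then have xy: "w \<in> x \<longleftrightarrow> w \<in> y" if "w \<noteq> u" for w using x y that by blast
      have "w \<in> x \<longleftrightarrow> w \<in> (if u \<in> x then insert u y else y - {u})" for w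
        using xy[of w] by (cases "w = u") auto
      then have "x = (if u \<in> x then insert u y else y - {u})" by blast
      then show False using x by (auto split: if_splits)
    qed
    then have "(\<Prod>w\<in>V - {u}. if (w \<in> y) = (w \<in> x) then 1 else 0 :: complex) = 0"
      using V by (auto simp: prod_zero_iff)
    then show ?thesis by (simp add: T)
  qed
  have "(\<Sum>x\<in>Pow V. ?T x * \<psi> x) = (\<Sum>x\<in>{y - {u}, insert u y}. ?T x * \<psi> x)"
    using V u y T0 by (intro sum.mono_neutral_right) auto
  also have "\<dots> = ?T (y - {u}) * \<psi> (y - {u}) + ?T (insert u y) * \<psi> (insert u y)"
    by (subst sum.insert) auto
  also have "?T (y - {u}) = A $ (u \<in> y) $ False"
    unfolding T by (simp add: prod.neutral)
  also have "?T (insert u y) = A $ (u \<in> y) $ True"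
    unfolding T by (simp add: prod.neutral)
  finally show ?thesis using y by (simp add: apply_local_def)
qed

text \<open>On a Bell state, an operator at one end equals its transpose at the other. The state of
  one edge is a Bell state with a Hadamard gate applied at one end, hence the conjugation.\<close>

lemma transpose_trick:
  fixes g :: "bool \<Rightarrow> bool \<Rightarrow> complex" and A :: qubit_op
  defines "B \<equiv> hadamard ** transpose A ** hadamard"
  assumes g: "g False True = g False False" "g True False = g False False" "g True True = - g False False"
  shows "A $ a $ False * g False c + A $ a $ True * g True c =
    B $ c $ False * g a False + B $ c $ True * g a True"
  by (cases a; cases c)
    (simp_all add: g B_def qubit_simps hadamard_def sqrt2_sq field_simps)

lemma apply_local_isolated_pair:
  assumes G: "simple_graph V E" and uv: "u \<in> V" "v \<in> V" "u \<noteq> v"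
    and adj: "adj E v = {u}" "adj E u = {v}"
  shows "apply_local V (\<lambda>w. if w = u then A else mat 1) (graph_state V E) =
    apply_local V (\<lambda>w. if w = v then hadamard ** transpose A ** hadamard else mat 1) (graph_state V E)"
    (is "?L = ?R")
proof
  fix y
  have V: "finite V" using G by (simp add: simple_graph_def)
  show "?L y = ?R y"
  proof (cases "y \<subseteq> V")
    case y: True
    define z where "z = y - {u, v}"
    have z: "z \<subseteq> V" "u \<notin> z" "v \<notin> z" using y by (auto simp: z_def)
    define g where "g a c = graph_state V E (z \<union> (if a then {u} else {}) \<union> (if c then {v} else {}))" for a c
    have g: "g False True = g False False" "g True False = g False False" "g True True = - g False False"
    proof -
      have "graph_state V E (insert v z) = parity_sign {u} z * graph_state V E z"
        using graph_state_insert[OF G uv(2) z(3,1)] adj by simp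
      then show "g False True = g False False" using z by (simp add: g_def parity_sign_def)
      have 1: "graph_state V E (insert u z) = parity_sign {v} z * graph_state V E z"
        using graph_state_insert[OF G uv(1) z(2,1)] adj by simp
      then show "g True False = g False False" using z by (simp add: g_def parity_sign_def)
      have "graph_state V E (insert v (insert u z)) = parity_sign {u} (insert u z) * graph_state V E (insert u z)"
        using graph_state_insert[OF G uv(2), of "insert u z"] adj z uv by simp
      then show "g True True = - g False False" using 1 z by (simp add: g_def parity_sign_def)
    qed
    have eqs: "y - {u} = z \<union> (if v \<in> y then {v} else {})" "insert u y = z \<union> {u} \<union> (if v \<in> y then {v} else {})"
      "y - {v} = z \<union> (if u \<in> y then {u} else {})" "insert v y = z \<union> (if u \<in> y then {u} else {}) \<union> {v}"
      using uv by (auto simp: z_def)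
    have "graph_state V E (y - {u}) = g False (v \<in> y)" "graph_state V E (insert u y) = g True (v \<in> y)"
      "graph_state V E (y - {v}) = g (u \<in> y) False" "graph_state V E (insert v y) = g (u \<in> y) True"
      unfolding eqs by (simp_all add: g_def)
    then show ?thesis
      using transpose_trick[of g A "u \<in> y" "v \<in> y", OF g]
      by (simp only: apply_local_single[OF V uv(1) y] apply_local_single[OF V uv(2) y])
  qed (simp add: apply_local_def)
qed

lemma unitary_transpose: "unitary A \<Longrightarrow> unitary (transpose A)"
proof -
  assume A: "unitary A"
  have t: "dagger (transpose A) = transpose (dagger A)"
    by (simp add: dagger_def map_matrix_def transpose_def vec_eq_iff)
  show ?thesis
    using A unfolding unitary_def t matrix_transpose_mul[symmetric]
    by (simp add: transpose_mat)
qed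

lemma preserves_axis_mat_1: "preserves_axis (mat 1)"
proof -
  have "rotation (mat 1) k (True, False) = 0" if "k \<noteq> (True, False)" for k
    using that trace_pauli_op_mult[of k "(True, False)"]
    by (simp add: rotation_def dagger_mat)
  then show ?thesis unfolding preserves_axis_def by (metis prod.inject)
qed

text \<open>The operator at \<open>u\<close> is moved to \<open>v\<close>, leaving the identity at
  \<open>u\<close>. Both graphs have the stabilizer with Z at \<open>u\<close> and X at
  \<open>v\<close>, so the remaining operator at \<open>v\<close> has to fix the X axis.\<close>

lemma isolated_pair_merge:
  assumes G: "simple_graph V E1" "simple_graph V E2"
    and U: "\<forall>u\<in>V. unitary (U u)"
    and eq: "graph_state V E2 = apply_local V U (graph_state V E1)"
    and uv: "u \<in> V" "v \<in> V" "u \<noteq> v"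
    and adj: "adj E1 v = {u}" "adj E1 u = {v}" "adj E2 v = {u}" "adj E2 u = {v}"
  obtains W where "unitary W" "preserves_axis W"
    "graph_state V E2 = apply_local V (U(u := mat 1, v := W)) (graph_state V E1)"
proof -
  have V: "finite V" using G by (simp add: simple_graph_def)
  define B where "B = hadamard ** transpose (U u) ** hadamard"
  define W where "W = U v ** B"
  define U' where "U' = U(u := mat 1, v := W)"
  have W: "unitary W"
    unfolding W_def B_def using U uv by (intro unitary_mult unitary_hadamard unitary_transpose) auto
  then have U': "\<forall>u\<in>V. unitary (U' u)" using U by (auto simp: U'_def unitary_def dagger_mat)
  have "graph_state V E2 = apply_local V (U(u := mat 1)) (apply_local V (\<lambda>w. if w = u then U u else mat 1) (graph_state V E1))"
    unfolding eq apply_local_comp[OF V] by (intro fun_cong[OF apply_local_cong]) auto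
  also have "\<dots> = apply_local V (U(u := mat 1)) (apply_local V (\<lambda>w. if w = v then B else mat 1) (graph_state V E1))"
    unfolding B_def by (simp only: apply_local_isolated_pair[OF G(1) uv adj(1,2)])
  also have "\<dots> = apply_local V U' (graph_state V E1)"
    unfolding apply_local_comp[OF V] using uv
    by (intro fun_cong[OF apply_local_cong]) (auto simp: U'_def W_def)
  finally have eq': "graph_state V E2 = apply_local V U' (graph_state V E1)" .
  let ?X = "(True, False) :: pauli" and ?Z = "(False, True) :: pauli"
  let ?s = "\<lambda>k. (\<lambda>_. pI)(u := ?Z, v := k)"
  \<comment> \<open>With Z at \<open>u\<close>, an isolated edge admits only X at \<open>v\<close>:
    a label without X part would give a stabilizer made of Z alone, and Y would make
    \<open>v\<close> its own neighbour.\<close>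
  have s: "expect V (graph_state V E) (?s k) = 0"
    if "simple_graph V E" "adj E v = {u}" "k \<noteq> ?X" for E k
  proof (rule ccontr)
    assume c: "expect V (graph_state V E) (?s k) \<noteq> 0"
    show False
    proof (cases "fst k")
      case False
      then have "xpart V (?s k) = xpart V (\<lambda>_. pI)" by (auto simp: xpart_def)
      then have "(?s k) u = pI"
        using expect_graph_state_inj[OF that(1) c _ _ uv(1)]
          expect_identity[OF stabilizer_state_graph_state[OF that(1)]] by (metis one_neq_zero)
      then show False using uv by simp
    next
      case True
      then have "xpart V (?s k) = {v}" using uv by (auto simp: xpart_def)
      then have "zpart V (?s k) = {u}" using expect_graph_state_vertex[OF that(1) uv(2)] c that(2) by simp
      then have "v \<notin> zpart V (?s k)" using uv by simp
      then have "\<not> snd k" using uv by (simp add: zpart_def)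
      with True that(3) show False by (metis prod.collapse)
    qed
  qed
  have sX: "expect V (graph_state V E1) (?s ?X) \<noteq> 0"
  proof -
    have "xpart V (?s ?X) = {v}" "zpart V (?s ?X) = {u}" using uv by (auto simp: xpart_def zpart_def)
    then show ?thesis using expect_graph_state_vertex[OF G(1) uv(2)] adj(1) by simp
  qed
  have "expect V (graph_state V E2) (?s k) = rotation W k ?X * expect V (graph_state V E1) (?s ?X)" for k
  proof -
    have "expect V (graph_state V E2) (?s k) =
        (\<Sum>l\<in>UNIV. \<Sum>i\<in>UNIV. rotation (U' u) ?Z l * rotation (U' v) k i * expect V (graph_state V E1) ((\<lambda>_. pI)(u := l, v := i)))"
      unfolding eq'
      using expect_two_sites[OF V U' empty_subsetI uv(2) _ uv(1) _ uv(3), of "\<lambda>_. pI" "graph_state V E1" ?Z k]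
      by (simp only: paulis_empty sum.insert sum.empty finite.emptyI empty_iff singleton_iff simp_thms
          prod.empty mult_1 add_0_right)
    also have "\<dots> = (\<Sum>i\<in>UNIV. rotation (U' u) ?Z ?Z * rotation (U' v) k i * expect V (graph_state V E1) (?s i))"
    proof (rule sum_single)
      fix l assume "l \<noteq> ?Z"
      then have "rotation (U' u) ?Z l = 0"
        using trace_pauli_op_mult[of ?Z l] uv by (simp add: U'_def rotation_def dagger_mat)
      then show "(\<Sum>i\<in>UNIV. rotation (U' u) ?Z l * rotation (U' v) k i * expect V (graph_state V E1) ((\<lambda>_. pI)(u := l, v := i))) = 0"
        by (simp only: mult_zero_left sum.neutral_const)
    qed
    also have "\<dots> = rotation (U' u) ?Z ?Z * rotation (U' v) k ?X * expect V (graph_state V E1) (?s ?X)"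
      by (rule sum_single) (simp only: s[OF G(1) adj(1)] mult_zero_right not_False_eq_True)
    also have "rotation (U' u) ?Z ?Z = 1"
      using trace_pauli_op_mult[of ?Z ?Z] uv by (simp add: U'_def rotation_def dagger_mat)
    finally show ?thesis by (simp only: mult_1 U'_def fun_upd_same)
  qed
  then have "rotation W k ?X = 0" if "k \<noteq> ?X" for k
    using s[OF G(2) adj(3) that] sX by (metis mult_eq_0_iff)
  then have "preserves_axis W" unfolding preserves_axis_def by (metis prod.inject)
  with that[OF W] eq' show thesis by (simp add: U'_def)
qed

text \<open>A local unitary with the fewest axis-breaking qubits has none: merging on an isolated
  edge repairs \<open>v\<close>, puts the identity at \<open>u\<close> and changes no other
  qubit.\<close>

proposition LU_equivalent_axes:
  assumes G: "simple_graph V E1" "simple_graph V E2" and LU: "LU_equivalent V E1 E2"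
  obtains U where "\<forall>u\<in>V. unitary (U u) \<and> preserves_axis (U u)"
    "graph_state V E2 = apply_local V U (graph_state V E1)"
proof -
  have V: "finite V" using G by (simp add: simple_graph_def)
  define P where "P U \<longleftrightarrow> (\<forall>u\<in>V. unitary (U u)) \<and> graph_state V E2 = apply_local V U (graph_state V E1)" for U
  define bad where "bad U = {u \<in> V. \<not> preserves_axis (U u)}" for U
  obtain U0 where "P U0" using LU unfolding LU_equivalent_def P_def by blast
  then obtain U where U: "P U" "\<And>U'. P U' \<Longrightarrow> card (bad U) \<le> card (bad U')"
    using arg_min_nat_lemma[of P U0 "\<lambda>U. card (bad U)"] by blast
  then have U1: "\<forall>u\<in>V. unitary (U u)" "graph_state V E2 = apply_local V U (graph_state V E1)"
    by (auto simp: P_def)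
  have "bad U = {}"
  proof (rule ccontr)
    assume "bad U \<noteq> {}"
    then obtain v where v: "v \<in> V" "\<not> preserves_axis (U v)" by (auto simp: bad_def)
    obtain u where u: "u \<in> V" "u \<noteq> v" "adj E1 v = {u}" "adj E1 u = {v}" "adj E2 v = {u}" "adj E2 u = {v}"
      using preserves_axis_or_isolated_pair[OF G U1 v] by blast
    obtain W where W: "unitary W" "preserves_axis W"
        "graph_state V E2 = apply_local V (U(u := mat 1, v := W)) (graph_state V E1)"
      using isolated_pair_merge[OF G U1 u(1) v(1) u(2-6)] by blast
    have "P (U(u := mat 1, v := W))"
      using W U1 by (auto simp: P_def unitary_def dagger_mat)
    moreover have "card (bad (U(u := mat 1, v := W))) < card (bad U)"
    proof (rule psubset_card_mono)
      show "finite (bad U)" using V by (simp add: bad_def)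
      show "bad (U(u := mat 1, v := W)) \<subset> bad U"
        using v W(2) preserves_axis_mat_1 by (auto simp: bad_def)
    qed
    ultimately show False using U(2) by (meson not_le)
  qed
  then show thesis using that U1 by (auto simp: bad_def)
qed

subsection \<open>Reduction to diagonal operators\<close>

lemma clifford_mat_1: "clifford (mat 1)"
  by (rule clifford.global_phase) simp

lemma clifford_to_Z:
  assumes "i \<noteq> pI"
  obtains C where "clifford C" "C ** pauli_op i ** dagger C = pauli_op (False, True)"
proof -
  let ?S = "phase_gate ** (phase_gate ** phase_gate)"
  have "clifford (hadamard ** ?S)" by (intro clifford.intros)
  moreover have "(hadamard ** ?S) ** pauli_op (True, True) ** dagger (hadamard ** ?S) = pauli_op (False, True)"
    by (auto simp: qubit_simps hadamard_def phase_gate_def sqrt2_sq field_simps)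
  moreover have "hadamard ** pauli_op (True, False) ** dagger hadamard = pauli_op (False, True)"
    by (auto simp: qubit_simps hadamard_def sqrt2_sq field_simps)
  moreover have "mat 1 ** pauli_op (False, True) ** dagger (mat 1) = pauli_op (False, True)"
    by (simp add: dagger_mat)
  ultimately show thesis
    using that assms clifford.hadamard clifford_mat_1 by (cases i; cases "fst i"; cases "snd i") auto
qed

lemma clifford_X: "clifford (pauli_op (True, False))"
proof -
  have "hadamard ** (phase_gate ** phase_gate) ** hadamard = pauli_op (True, False)"
    by (auto simp: qubit_simps hadamard_def phase_gate_def sqrt2_sq field_simps)
  moreover have "clifford (hadamard ** (phase_gate ** phase_gate) ** hadamard)"
    by (intro clifford.intros)
  ultimately show ?thesis by simp
qed

definition diagonal :: "qubit_op \<Rightarrow> bool" where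
  "diagonal D \<longleftrightarrow> D $ True $ False = 0 \<and> D $ False $ True = 0"

lemma diagonal_iff_commute_Z:
  "diagonal D \<longleftrightarrow> D ** pauli_op (False, True) = pauli_op (False, True) ** D"
  by (auto simp: diagonal_def qubit_simps)

lemma unitary_diagonal_norm:
  assumes "unitary D" "diagonal D"
  shows "norm (D $ i $ i) = 1"
proof -
  have "(dagger D ** D) $ i $ i = 1" using assms by (simp add: unitary_def mat_def)
  then have "cnj (D $ i $ i) * D $ i $ i = 1"
    using assms(2) by (cases i) (simp_all add: diagonal_def qubit_simps)
  then have "complex_of_real ((norm (D $ i $ i))\<^sup>2) = 1"
    by (simp only: complex_norm_square mult.commute)
  then have "(norm (D $ i $ i))\<^sup>2 = 1" by (simp only: of_real_eq_1_iff)
  then show ?thesis by (simp add: power2_eq_1_iff) (metis norm_ge_zero not_one_le_zero neg_le_0_iff_le zero_le_one minus_minus le_minus_iff)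
qed

text \<open>Cliffords act transitively on the Pauli axes, so both the axis and its image may be
  moved to Z. The resulting operator commutes or anticommutes with Z, as the factor \<open>r\<close>
  squares to 1; in the second case an extra X makes it commute, and commuting with Z means
  diagonal.\<close>

lemma preserves_axis_decomposition:
  assumes U: "unitary U" "preserves_axis U"
  obtains A B D where "clifford A" "clifford B" "unitary D" "diagonal D" "U = B ** D ** A"
proof -
  obtain i j where ij: "i \<noteq> pI" "j \<noteq> pI" "\<And>k. k \<noteq> j \<Longrightarrow> rotation U k i = 0"
    using U(2) unfolding preserves_axis_def by blast
  define r where "r = rotation U j i"
  have conj: "U ** pauli_op i ** dagger U = mat r ** pauli_op j"
  proof -
    have "(U ** pauli_op i ** dagger U) $ a $ b = r * pauli_op j $ a $ b" for a b
      unfolding conj_pauli_op r_def by (rule sum_single) (simp add: ij(3))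
    moreover have "(mat r ** pauli_op j) $ a $ b = r * pauli_op j $ a $ b" for a b
      by (cases a) (simp_all add: matrix_matrix_mult_def UNIV_bool mat_def)
    ultimately show ?thesis by (simp add: vec_eq_iff)
  qed
  have "r\<^sup>2 = 1"
  proof -
    have "(U ** pauli_op i ** dagger U) ** (U ** pauli_op i ** dagger U) =
        U ** (pauli_op i ** (dagger U ** U) ** pauli_op i) ** dagger U"
      by (simp add: matrix_mul_assoc)
    also have "\<dots> = mat 1" using U(1) by (simp add: unitary_def pauli_op_square)
    finally have "(mat r ** pauli_op j) ** (mat r ** pauli_op j) = mat 1" unfolding conj .
    moreover have "(mat r ** pauli_op j) ** (mat r ** pauli_op j) = mat (r\<^sup>2) ** (pauli_op j ** pauli_op j)"
      by (auto simp: qubit_simps power2_eq_square)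
    ultimately have "mat (r\<^sup>2) = (mat 1 :: qubit_op)" by (simp add: pauli_op_square)
    then have "mat (r\<^sup>2) $ True $ True = (mat 1 :: qubit_op) $ True $ True" by simp
    then show ?thesis by (simp add: mat_def)
  qed
  then have r: "r = 1 \<or> r = -1" by (simp only: power2_eq_1_iff)
  obtain A where A: "clifford A" "A ** pauli_op i ** dagger A = pauli_op (False, True)"
    using clifford_to_Z[OF ij(1)] by blast
  obtain C where C: "clifford C" "C ** pauli_op j ** dagger C = pauli_op (False, True)"
    using clifford_to_Z[OF ij(2)] by blast
  note uA = clifford_unitary[OF A(1), unfolded unitary_def] and uC = clifford_unitary[OF C(1), unfolded unitary_def]
  let ?Z = "pauli_op (False, True)" and ?X = "pauli_op (True, False)"
  define W where "W = C ** U ** dagger A"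
  have uW: "unitary W"
    unfolding W_def by (intro unitary_mult unitary_dagger U(1) clifford_unitary[OF A(1)] clifford_unitary[OF C(1)])
  have AZ: "dagger A ** ?Z = pauli_op i ** dagger A"
  proof -
    have "dagger A ** ?Z = (dagger A ** A) ** pauli_op i ** dagger A"
      unfolding A(2)[symmetric] by (simp add: matrix_mul_assoc)
    then show ?thesis using uA by simp
  qed
  have CZ: "C ** pauli_op j = ?Z ** C"
  proof -
    have "?Z ** C = C ** pauli_op j ** (dagger C ** C)"
      unfolding C(2)[symmetric] by (simp add: matrix_mul_assoc)
    then show ?thesis using uC by simp
  qed
  have UZ: "U ** pauli_op i = mat r ** pauli_op j ** U"
  proof -
    have "mat r ** pauli_op j ** U = U ** pauli_op i ** (dagger U ** U)"
      unfolding conj[symmetric] by (simp add: matrix_mul_assoc)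
    then show ?thesis using U(1) by (simp add: unitary_def)
  qed
  have comm: "M ** mat r = mat r ** M" for M :: qubit_op
    by (simp add: qubit_simps mult.commute)
  have WZ: "W ** ?Z = mat r ** (?Z ** W)"
  proof -
    have "W ** ?Z = C ** (U ** pauli_op i) ** dagger A"
      unfolding W_def by (metis AZ matrix_mul_assoc)
    also have "\<dots> = (C ** mat r) ** pauli_op j ** U ** dagger A"
      unfolding UZ by (simp add: matrix_mul_assoc)
    also have "\<dots> = mat r ** ((C ** pauli_op j) ** U ** dagger A)"
      unfolding comm by (simp add: matrix_mul_assoc)
    finally show ?thesis unfolding CZ W_def by (simp add: matrix_mul_assoc)
  qed
  have UW: "U = dagger C ** W ** A"
  proof -
    have "dagger C ** W ** A = (dagger C ** C) ** U ** (dagger A ** A)"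
      unfolding W_def by (simp add: matrix_mul_assoc)
    then show ?thesis using uA uC by simp
  qed
  from r show thesis
  proof
    assume "r = 1"
    then have "diagonal W" using WZ by (simp add: diagonal_iff_commute_Z)
    then show thesis using that[OF A(1) clifford_dagger[OF C(1)] uW] UW by blast
  next
    assume "r = -1"
    have "?X ** W ** ?Z = ?X ** mat r ** ?Z ** W"
      using WZ by (metis matrix_mul_assoc)
    also have "?X ** mat r ** ?Z = ?Z ** ?X"
      using \<open>r = -1\<close> by (auto simp: qubit_simps)
    finally have "diagonal (?X ** W)" by (simp add: diagonal_iff_commute_Z matrix_mul_assoc)
    moreover have "unitary (?X ** W)" by (intro unitary_mult unitary_pauli_op uW)
    moreover have "clifford (dagger C ** ?X)"
      by (intro clifford.mult clifford_dagger clifford_X C(1))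
    moreover have "U = (dagger C ** ?X) ** (?X ** W) ** A"
    proof -
      have "(dagger C ** ?X) ** (?X ** W) ** A = dagger C ** (?X ** ?X) ** W ** A"
        by (simp add: matrix_mul_assoc)
      then show ?thesis using UW by (simp add: pauli_op_square)
    qed
    ultimately show thesis using that[OF A(1)] by blast
  qed
qed

section \<open>Diagonal operators between stabilizer states\<close>

lemma fourth_root_of_unity_cases:
  fixes w :: complex
  assumes "w ^ 4 = 1"
  shows "\<exists>k. w = \<i> ^ k"
proof -
  have "(w\<^sup>2)\<^sup>2 = 1" using assms by (simp flip: power_mult)
  then consider "w\<^sup>2 = 1" | "w\<^sup>2 = -1" by (metis power2_eq_1_iff)
  then show ?thesis
  proof cases
    case 1
    then have "w = \<i> ^ 0 \<or> w = \<i> ^ 2" by (simp add: power2_eq_1_iff)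
    then show ?thesis by blast
  next
    case 2
    then have "(w - \<i>) * (w + \<i>) = 0" by (simp add: algebra_simps power2_eq_square)
    then have "w = \<i> ^ 1 \<or> w = \<i> ^ 3" by (auto simp: eq_neg_iff_add_eq_0 power3_eq_cube)
    then show ?thesis by blast
  qed
qed

lemma clifford_diagonal:
  assumes "diagonal D" "norm (D $ False $ False) = 1" "D $ True $ True = D $ False $ False * w" "w ^ 4 = 1"
  shows "clifford D"
proof -
  obtain k where k: "w = \<i> ^ k" using fourth_root_of_unity_cases[OF assms(4)] by blast
  define F :: "nat \<Rightarrow> qubit_op" where "F n = (\<chi> i j. if i = j then (if i then \<i> ^ n else 1) else 0)" for n
  have "clifford (F n)" for n
  proof (induction n)
    case 0
    have "F 0 = mat 1" by (auto simp: F_def vec_eq_iff mat_def)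
    then show ?case using clifford_mat_1 by simp
  next
    case (Suc n)
    have "F (Suc n) = phase_gate ** F n"
      by (auto simp: F_def qubit_simps phase_gate_def)
    then show ?case using Suc clifford.intros by simp
  qed
  moreover have "D = mat (D $ False $ False) ** F k"
    using assms k by (auto simp: F_def qubit_simps diagonal_def all_bool_eq)
  ultimately show ?thesis using assms(2) clifford.mult clifford.global_phase by metis
qed

text \<open>The diagonal operator matters only on the support of \<open>S1\<close>, a coset of the
  group \<open>L\<close>. There the ratio of the two states is a quadratic phase, to which
  \<open>quarter_phases\<close> applies.\<close>

proposition diagonal_to_clifford:
  assumes S: "stabilizer_state V S1" "stabilizer_state V S2" and card: "card V \<le> 22"
    and D: "\<And>u. u \<in> V \<Longrightarrow> unitary (D u) \<and> diagonal (D u)"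
    and eq: "S2 = apply_local V D S1"
  obtains D' where "\<And>u. u \<in> V \<Longrightarrow> clifford (D' u)" "S2 = apply_local V D' S1"
proof -
  note S1 = stabilizer_stateD[OF S(1)] and S2 = stabilizer_stateD[OF S(2)]
  note V = S1(1)
  define R where "R x = (\<Prod>u\<in>V. D u $ (u \<in> x) $ (u \<in> x))" for x
  have Dnorm: "norm (D u $ b $ b) = 1" if "u \<in> V" for u b
    using unitary_diagonal_norm D that by blast
  then have Dnz: "D u $ b $ b \<noteq> 0" if "u \<in> V" for u b
    using that by (metis norm_zero zero_neq_one)
  have Rnz: "R x \<noteq> 0" for x using V Dnz by (simp add: R_def)
  have S2R: "S2 x = R x * S1 x" if "x \<subseteq> V" for x
    unfolding eq R_def using apply_local_diagonal[OF V, of D S1 x] D that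
    by (simp add: diagonal_def)
  obtain p where p: "p \<subseteq> V" "S1 p \<noteq> 0"
  proof -
    have "\<exists>p\<in>Pow V. S1 p \<noteq> 0"
    proof (rule ccontr)
      assume "\<not> ?thesis"
      then have "inner_state V S1 S1 = 0" unfolding inner_state_def by (intro sum.neutral) auto
      then show False using S1(3) by simp
    qed
    then show thesis using that by blast
  qed
  define L where "L = {y. y \<subseteq> V \<and> S1 (p \<ominus> y) \<noteq> 0}"
  have LV: "y \<subseteq> V" if "y \<in> L" for y using that by (simp add: L_def)
  \<comment> \<open>The relative phase of the two diagonal entries at \<open>u\<close>, oriented
    away from the base point \<open>p\<close>, so that a displacement \<open>y\<close> from
    \<open>p\<close> contributes \<open>prod e y\<close>.\<close>
  define e where "e u = D u $ (u \<notin> p) $ (u \<notin> p) / D u $ (u \<in> p) $ (u \<in> p)" for u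
  have enz: "e u \<noteq> 0" if "u \<in> V" for u using Dnz that by (simp add: e_def)
  have Re: "R (p \<ominus> y) = R p * prod e y" if y: "y \<subseteq> V" for y
  proof -
    have "R (p \<ominus> y) = (\<Prod>u\<in>V. D u $ (u \<in> p) $ (u \<in> p) * (if u \<in> y then e u else 1))"
      unfolding R_def using Dnz by (intro prod.cong) (auto simp: e_def)
    also have "\<dots> = R p * (\<Prod>u\<in>V. if u \<in> y then e u else 1)"
      by (simp only: prod.distrib R_def)
    also have "(\<Prod>u\<in>V. if u \<in> y then e u else 1) = prod e y"
      using V y by (intro prod.mono_neutral_cong_right) auto
    finally show ?thesis .
  qed
  have shift: "\<exists>b c. finite b \<and> c \<noteq> 0 \<and> (\<forall>y\<subseteq>V. \<psi> (y \<ominus> a) = c * parity_sign b y * \<psi> y)"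
    if \<psi>: "stabilizer_state V \<psi>" "\<psi> p \<noteq> 0" "\<psi> (p \<ominus> a) \<noteq> 0" for \<psi> a
  proof -
    obtain s where s: "expect V \<psi> s \<noteq> 0" "xpart V s = p \<ominus> (p \<ominus> a)"
      using stabilizer_connecting[OF \<psi>] by blast
    obtain c where "c \<noteq> 0" "\<And>y. y \<subseteq> V \<Longrightarrow> \<psi> (y \<ominus> xpart V s) = c * parity_sign (zpart V s) y * \<psi> y"
      using stabilizer_shift[OF \<psi>(1) s(1)] by blast
    moreover have "finite (zpart V s)" using V zpart_subset finite_subset by metis
    ultimately show ?thesis using s(2) by auto
  qed
  have L: "y \<ominus> a \<in> L" if ya: "y \<in> L" "a \<in> L" for y a
  proof -
    obtain b c where "c \<noteq> 0" "\<forall>y\<subseteq>V. S1 (y \<ominus> a) = c * parity_sign b y * S1 y"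
      using shift[OF S(1) p(2), of a] ya by (auto simp: L_def)
    moreover have "p \<ominus> y \<subseteq> V" using p(1) ya by (simp add: L_def sdiff_subset)
    ultimately have "S1 ((p \<ominus> y) \<ominus> a) \<noteq> 0" using ya by (simp add: L_def)
    moreover have "y \<ominus> a \<subseteq> V" using ya by (simp add: L_def sdiff_subset)
    ultimately show ?thesis by (simp add: L_def sdiff_assoc)
  qed
  have quad: "\<exists>\<omega>. \<forall>y\<in>L. \<omega> y ^ 2 = 1 \<and> prod e (y \<ominus> a) = prod e a * prod e y * \<omega> y \<and>
      (\<forall>z\<in>L. \<omega> (y \<ominus> z) = \<omega> y * \<omega> z)" if a: "a \<in> L" for a
  proof -
    have aV: "a \<subseteq> V" "S1 (p \<ominus> a) \<noteq> 0" using a by (simp_all add: L_def)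
    have paV: "p \<ominus> a \<subseteq> V" using p aV by (simp add: sdiff_subset)
    obtain b1 c1 where 1: "finite b1" "c1 \<noteq> 0" "\<forall>y\<subseteq>V. S1 (y \<ominus> a) = c1 * parity_sign b1 y * S1 y"
      using shift[OF S(1) p(2) aV(2)] by blast
    have "S2 p \<noteq> 0" "S2 (p \<ominus> a) \<noteq> 0" using S2R p aV(2) paV Rnz by simp_all
    then obtain b2 c2 where 2: "finite b2" "c2 \<noteq> 0" "\<forall>y\<subseteq>V. S2 (y \<ominus> a) = c2 * parity_sign b2 y * S2 y"
      using shift[OF S(2)] by blast
    \<comment> \<open>Translation by \<open>a\<close> multiplies each state by a constant and a
      character on its support; the ratio \<open>R\<close> picks up the quotient, and signs are
      their own inverses.\<close>
    define \<omega> where "\<omega> y = parity_sign b1 y * parity_sign b2 y" for y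
    have R: "R (x \<ominus> a) = c2 / c1 * \<omega> x * R x" if x: "x \<subseteq> V" "S1 x \<noteq> 0" for x
    proof -
      have "R (x \<ominus> a) * (c1 * parity_sign b1 x * S1 x) = c2 * parity_sign b2 x * (R x * S1 x)"
        using 1(3) 2(3) x S2R[of "x \<ominus> a"] S2R[OF x(1)] sdiff_subset[OF x(1) aV(1)] by simp
      then have "R (x \<ominus> a) * c1 * parity_sign b1 x = c2 * parity_sign b2 x * R x"
        using x(2) by (simp add: mult.assoc)
      then have "R (x \<ominus> a) * c1 * parity_sign b1 x * parity_sign b1 x =
          c2 * parity_sign b2 x * R x * parity_sign b1 x" by (rule arg_cong)
      then have "R (x \<ominus> a) * c1 = c2 * \<omega> x * R x"
        by (simp add: mult.assoc) (simp add: \<omega>_def mult_ac)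
      then show ?thesis using 1(2) by (simp add: field_simps)
    qed
    have \<omega>_sdiff: "\<omega> (x \<ominus> y) = \<omega> x * \<omega> y" for x y
      using 1(1) 2(1) by (simp add: \<omega>_def parity_sign_sdiff mult_ac)
    have main: "prod e (y \<ominus> a) = c2 / c1 * \<omega> p * \<omega> y * prod e y" if y: "y \<in> L" for y
    proof -
      have yV: "y \<subseteq> V" "S1 (p \<ominus> y) \<noteq> 0" using y by (simp_all add: L_def)
      have "R p * prod e (y \<ominus> a) = R ((p \<ominus> y) \<ominus> a)"
        using Re[OF sdiff_subset[OF yV(1) aV(1)]] by (simp add: sdiff_assoc)
      also have "\<dots> = c2 / c1 * \<omega> (p \<ominus> y) * R (p \<ominus> y)"
        using yV p(1) by (intro R) (simp_all add: sdiff_subset)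
      also have "\<dots> = R p * (c2 / c1 * \<omega> p * \<omega> y * prod e y)"
        using Re[OF yV(1)] by (simp add: \<omega>_sdiff mult_ac)
      finally show ?thesis using Rnz[of p] mult_left_cancel by blast
    qed
    have "{} \<in> L" using p by (simp add: L_def)
    then have "prod e a = c2 / c1 * \<omega> p" using main[of "{}"] by (simp add: \<omega>_def)
    then have "prod e (y \<ominus> a) = prod e a * prod e y * \<omega> y" if "y \<in> L" for y
      using main[OF that] by (simp add: mult_ac)
    moreover have "\<omega> y ^ 2 = 1" for y by (simp add: \<omega>_def power_mult_distrib)
    ultimately show ?thesis using \<omega>_sdiff by blast
  qed
  obtain e' where e': "\<And>u. e' u ^ 4 = 1" "\<And>y. y \<in> L \<Longrightarrow> prod e' y = prod e y"
    using quarter_phases[OF V card LV L enz quad] by blast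
  \<comment> \<open>The entry at the value of \<open>p\<close> is kept and the other one is changed,
    so the replacement agrees with \<open>D\<close> at the base point. For \<open>u\<close> in
    \<open>p\<close> the ratio of the True entry to the False entry is thus the inverse of
    \<open>e' u\<close>.\<close>
  define D' where "D' u = (\<chi> i j. if i = j then D u $ (u \<in> p) $ (u \<in> p) * (if i = (u \<in> p) then 1 else e' u) else 0)" for u
  have D'diag: "diagonal (D' u)" for u by (simp add: D'_def diagonal_def)
  have e'nz: "e' u \<noteq> 0" and e'norm: "norm (e' u) = 1" for u
  proof -
    show "e' u \<noteq> 0" using e'(1)[of u] by auto
    show "norm (e' u) = 1" using power_eq_1_iff[OF e'(1)[of u]] by simp
  qed
  have "clifford (D' u)" if u: "u \<in> V" for u
  proof (cases "u \<in> p")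
    case False
    show ?thesis
      by (rule clifford_diagonal[OF D'diag, of u "e' u"]) (use False u Dnorm e'(1) in \<open>simp_all add: D'_def\<close>)
  next
    case True
    show ?thesis
      by (rule clifford_diagonal[OF D'diag, of u "inverse (e' u)"])
        (use True u Dnorm e'(1) e'norm e'nz in \<open>simp_all add: D'_def norm_mult power_inverse\<close>)
  qed
  moreover have "S2 = apply_local V D' S1"
  proof
    fix x
    show "S2 x = apply_local V D' S1 x"
    proof (cases "x \<subseteq> V")
      case x: True
      have app: "apply_local V D' S1 x = (\<Prod>u\<in>V. D' u $ (u \<in> x) $ (u \<in> x)) * S1 x"
        using apply_local_diagonal[OF V, of D' S1 x] D'diag x by (simp add: diagonal_def)
      show ?thesis
      proof (cases "S1 x = 0")
        case True
        then show ?thesis using app S2R[OF x] by simp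
      next
        case False
        define y where "y = p \<ominus> x"
        have y: "y \<in> L" "x = p \<ominus> y" using False x p by (simp_all add: y_def L_def sdiff_subset)
        have "(\<Prod>u\<in>V. D' u $ (u \<in> x) $ (u \<in> x)) =
            (\<Prod>u\<in>V. D u $ (u \<in> p) $ (u \<in> p) * (if u \<in> y then e' u else 1))"
          by (intro prod.cong) (auto simp: D'_def y(2))
        also have "\<dots> = R p * (\<Prod>u\<in>V. if u \<in> y then e' u else 1)"
          by (simp only: prod.distrib R_def)
        also have "(\<Prod>u\<in>V. if u \<in> y then e' u else 1) = prod e' y"
          using V LV[OF y(1)] by (intro prod.mono_neutral_cong_right) auto
        also have "R p * prod e' y = R x" using e'(2)[OF y(1)] Re[OF LV[OF y(1)]] y(2) by simp
        finally show ?thesis using app S2R[OF x] by simp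
      qed
    next
      case False
      then show ?thesis using S2(2) by (simp add: supported_def apply_local_def)
    qed
  qed
  ultimately show thesis using that by blast
qed

theorem proposition34:
  fixes V :: "'v::linorder set" and E1 E2 :: "'v set set"
  assumes "simple_graph V E1" and "simple_graph V E2"
    and "card V \<le> 19"
  shows "LU_equivalent V E1 E2 \<longleftrightarrow> LC_equivalent V E1 E2"
proof
  assume "LC_equivalent V E1 E2"
  then show "LU_equivalent V E1 E2"
    unfolding LC_equivalent_def LU_equivalent_def using clifford_unitary by blast
next
  assume LU: "LU_equivalent V E1 E2"
  let ?g1 = "graph_state V E1" and ?g2 = "graph_state V E2"
  have V: "finite V" using assms(1) by (simp add: simple_graph_def)
  obtain U where U: "\<forall>u\<in>V. unitary (U u) \<and> preserves_axis (U u)" "?g2 = apply_local V U ?g1"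
    using LU_equivalent_axes[OF assms(1,2) LU] by blast
  have "\<forall>u\<in>V. \<exists>A B D. clifford A \<and> clifford B \<and> unitary D \<and> diagonal D \<and> U u = B ** D ** A"
    using U(1) preserves_axis_decomposition by metis
  then obtain A B D where ABD: "\<And>u. u \<in> V \<Longrightarrow> clifford (A u)" "\<And>u. u \<in> V \<Longrightarrow> clifford (B u)"
      "\<And>u. u \<in> V \<Longrightarrow> unitary (D u) \<and> diagonal (D u)" "\<And>u. u \<in> V \<Longrightarrow> U u = B u ** D u ** A u"
    by metis
  \<comment> \<open>The outer Clifford factors are absorbed into the two graph states, which remain
    stabilizer states, so that only diagonal factors are left between them.\<close>
  define S1 where "S1 = apply_local V A ?g1"
  define S2 where "S2 = apply_local V (\<lambda>u. dagger (B u)) ?g2"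
  have "stabilizer_state V S1"
    unfolding S1_def using stabilizer_state_graph_state[OF assms(1)] ABD(1) by (rule stabilizer_state_clifford)
  moreover have "stabilizer_state V S2"
    unfolding S2_def using stabilizer_state_graph_state[OF assms(2)] clifford_dagger[OF ABD(2)]
    by (rule stabilizer_state_clifford)
  moreover have "card V \<le> 22" using assms(3) by simp
  moreover have "S2 = apply_local V D S1"
    unfolding S1_def S2_def U(2) apply_local_comp[OF V]
  proof (intro fun_cong[OF apply_local_cong])
    fix u assume "u \<in> V"
    then have "dagger (B u) ** B u = mat 1"
      using clifford_unitary[OF ABD(2)] by (simp add: unitary_def)
    then show "dagger (B u) ** U u = D u ** A u"
      unfolding ABD(4)[OF \<open>u \<in> V\<close>] by (simp add: matrix_mul_assoc)
  qed
  ultimately obtain D' where D': "\<And>u. u \<in> V \<Longrightarrow> clifford (D' u)" "S2 = apply_local V D' S1"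
    using diagonal_to_clifford[of V S1 S2 D] ABD(3) by metis
  have "?g2 = apply_local V B S2"
    unfolding S2_def apply_local_comp[OF V]
    by (rule apply_local_id[symmetric, OF V]) (use clifford_unitary[OF ABD(2)] in \<open>simp_all add: unitary_def\<close>)
  also have "\<dots> = apply_local V (\<lambda>u. B u ** (D' u ** A u)) ?g1"
    unfolding D'(2) S1_def apply_local_comp[OF V] ..
  finally have "?g2 = apply_local V (\<lambda>u. B u ** (D' u ** A u)) ?g1" .
  moreover have "\<forall>u\<in>V. clifford (B u ** (D' u ** A u))"
    by (intro ballI clifford.mult ABD(1,2) D'(1))
  ultimately show "LC_equivalent V E1 E2"
    unfolding LC_equivalent_def by (intro exI conjI)
qed

end
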